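(* Let $b,\sigma,b^n,\sigma^n:\mathbb{R}\times\mathcal{P}_2(\mathbb{R})\to\mathbb{R}$ ($n\ge1$) be functions such that each of the pairs $(f,g)=(b,\sigma)$ and $(f,g)=(b^n,\sigma^n)$, $n\ge1$, satisfies the Lipschitz assumption: there exists a constant $L>0$ such that $|f(x,\mu)-f(y,\nu)|+|g(x,\mu)-g(y,\nu)|\le L(|x-y|+\mathcal{W}_2(\mu,\nu))$ for all $x,y\in\mathbb{R}$, $\mu,\nu\in\mathcal{P}_2(\mathbb{R})$. Let $h:\mathbb{R}\to\mathbb{R}$ be increasing with $m|x-y|\le|h(x)-h(y)|\le M|x-y|$ for all $x,y$, for some $0<m\le M$, and let $\xi$ be an $\mathcal{F}_0$-measurable random variable with $\mathbb{E}[\xi^2]<\infty$, $\mathbb{E}[h(\xi)]\ge0$. Suppose that for each compact set $D\subset\mathbb{R}$, $$\lim_{n\to\infty}\sup_{x\in D}\sup_{\mu\in\mathcal{P}_2(\mathbb{R})}\big(|b^n(x,\mu)-b(x,\mu)|+|\sigma^n(x,\mu)-\sigma(x,\mu)|\big)=0.$$ Let $(X,K)$ and $(X^n,K^n)$ be the unique deterministic flat solutions of the mean reflected McKean-Vlasov SDEs with initial condition $\xi$, constraint function $h$ and coefficients $(b,\sigma)$ and $(b^n,\sigma^n)$ respectively, driven by the same Brownian motion. Then for each $T>0$, $$\lim_{n\to\infty}\mathbb{E}\Big[\sup_{t\le T}|X^n_t-X_t|^2\Big]=0.$$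
   Context: $(\Omega,\mathcal{F},\{\mathcal{F}_t\},\mathbb{P})$ is a complete filtered probability space with a standard one-dimensional $\{\mathcal{F}_t\}$-Brownian motion $B$; $\mathcal{L}_Z$ is the law of $Z$; $\mathcal{P}_2(\mathbb{R})$ is the set of probability measures on $\mathbb{R}$ with finite second moment, $\mathcal{W}_2$ the 2-Wasserstein distance. The mean reflected McKean-Vlasov SDE with data $(\xi,b,\sigma,h)$ is $$X_t=\xi+\int_0^tb(X_s,\mathcal{L}_{X_s})ds+\int_0^t\sigma(X_s,\mathcal{L}_{X_s})dB_s+K_t,\quad \mathbb{E}[h(X_t)]\ge0,\quad\int_0^t\mathbb{E}[h(X_s)]dK_s=0,\quad t\ge0,$$ with $X$ continuous adapted and $K$ a non-decreasing continuous deterministic function, $K_0=0$; the unique such pair is the deterministic flat solution.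
   Formalization: The Lipschitz constant L is taken to be common to (b,σ) and all (bⁿ,σⁿ); with constants depending on n the claim fails, e.g. b=0, σ=σⁿ=1, h=id, ξ=1, bⁿ(x)=Cₙ·max(x−n,0) with Cₙ growing fast. *)

theory Defs
  imports "HOL-Probability.Probability"
begin

section \<open>Probability measures with finite second moment and the Wasserstein distance\<close>

definition P2 :: "real measure set" where
  "P2 = {\<mu> \<in> space (prob_algebra borel). integrable \<mu> (\<lambda>x. x\<^sup>2)}"

definition couplings :: "real measure \<Rightarrow> real measure \<Rightarrow> (real \<times> real) measure set" where
  "couplings \<mu> \<nu> = {\<pi> \<in> space (prob_algebra (borel \<Otimes>\<^sub>M borel)).
     distr \<pi> borel fst = \<mu> \<and> distr \<pi> borel snd = \<nu>}"

text \<open>Meant for arguments in \<open>P2\<close>: there the set of couplings is nonempty and the cost is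
  integrable under each of them.\<close>

definition W2 :: "real measure \<Rightarrow> real measure \<Rightarrow> real" where
  "W2 \<mu> \<nu> = sqrt (INF \<pi>\<in>couplings \<mu> \<nu>. \<integral>z. (fst z - snd z)\<^sup>2 \<partial>\<pi>)"

text \<open>A function on \<open>\<real> \<times> P2\<close> is encoded as a function of type
  \<open>real \<Rightarrow> real measure \<Rightarrow> real\<close> whose values off \<open>P2\<close> are irrelevant. The constant is an
  explicit parameter, so that one constant can be imposed on a whole sequence of pairs.\<close>

definition lipschitz_coeffs ::
  "real \<Rightarrow> (real \<Rightarrow> real measure \<Rightarrow> real) \<Rightarrow> (real \<Rightarrow> real measure \<Rightarrow> real) \<Rightarrow> bool" where
  "lipschitz_coeffs L f g \<longleftrightarrow>
     (\<forall>x y. \<forall>\<mu>\<in>P2. \<forall>\<nu>\<in>P2.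
        \<bar>f x \<mu> - f y \<nu>\<bar> + \<bar>g x \<mu> - g y \<nu>\<bar> \<le> L * (\<bar>x - y\<bar> + W2 \<mu> \<nu>))"


section \<open>Filtered probability spaces and Brownian motion\<close>

text \<open>Time is \<open>[0, \<infinity>)\<close>, encoded in the reals; nothing is required at negative times.\<close>

locale complete_filtered_prob_space = prob_space M + complete_measure M
  for M :: "'a measure" and F :: "real \<Rightarrow> 'a measure" +
  assumes subalgebra_F: "\<And>t. 0 \<le> t \<Longrightarrow> subalgebra M (F t)"
    and F_mono: "\<And>s t. 0 \<le> s \<Longrightarrow> s \<le> t \<Longrightarrow> sets (F s) \<subseteq> sets (F t)"
    and null_sets_F: "null_sets M \<subseteq> sets (F 0)"

definition adapted :: "(real \<Rightarrow> 'a measure) \<Rightarrow> (real \<Rightarrow> 'a \<Rightarrow> real) \<Rightarrow> bool" where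
  "adapted F X \<longleftrightarrow> (\<forall>t\<ge>0. X t \<in> borel_measurable (F t))"

definition progressive :: "(real \<Rightarrow> 'a measure) \<Rightarrow> (real \<Rightarrow> 'a \<Rightarrow> real) \<Rightarrow> bool" where
  "progressive F H \<longleftrightarrow>
     (\<forall>t\<ge>0. (\<lambda>(s, \<omega>). H s \<omega>) \<in> borel_measurable (restrict_space borel {0..t} \<Otimes>\<^sub>M F t))"

definition brownian_motion ::
  "'a measure \<Rightarrow> (real \<Rightarrow> 'a measure) \<Rightarrow> (real \<Rightarrow> 'a \<Rightarrow> real) \<Rightarrow> bool" where
  "brownian_motion M F B \<longleftrightarrow>
     adapted F B \<and>
     (AE \<omega> in M. B 0 \<omega> = 0) \<and>
     (AE \<omega> in M. continuous_on {0..} (\<lambda>t. B t \<omega>)) \<and>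
     (\<forall>s t. 0 \<le> s \<and> s < t \<longrightarrow>
        distributed M lborel (\<lambda>\<omega>. B t \<omega> - B s \<omega>) (normal_density 0 (sqrt (t - s))) \<and>
        prob_space.indep_set M (sets (F s))
          {(\<lambda>\<omega>. B t \<omega> - B s \<omega>) -` A \<inter> space M | A. A \<in> sets borel})"


section \<open>The It\^o integral\<close>

text \<open>An elementary process is given by a number \<open>k\<close> of steps, a partition
  \<open>0 \<le> \<tau> 0 \<le> \<dots> \<le> \<tau> k\<close> and bounded heights \<open>\<phi> i\<close>, known at time \<open>\<tau> i\<close>; it represents
  the integrand that equals \<open>\<phi> i\<close> on the interval from \<open>\<tau> i\<close> (excluded) to \<open>\<tau> (i + 1)\<close>.\<close>

definition elementary ::
  "(real \<Rightarrow> 'a measure) \<Rightarrow> nat \<Rightarrow> (nat \<Rightarrow> real) \<Rightarrow> (nat \<Rightarrow> 'a \<Rightarrow> real) \<Rightarrow> bool" where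
  "elementary F k \<tau> \<phi> \<longleftrightarrow>
     0 \<le> \<tau> 0 \<and> mono_on {..k} \<tau> \<and>
     (\<forall>i<k. \<phi> i \<in> borel_measurable (F (\<tau> i)) \<and> (\<exists>C. \<forall>\<omega>\<in>space (F (\<tau> i)). \<bar>\<phi> i \<omega>\<bar> \<le> C))"

definition elem_process ::
  "nat \<Rightarrow> (nat \<Rightarrow> real) \<Rightarrow> (nat \<Rightarrow> 'a \<Rightarrow> real) \<Rightarrow> real \<Rightarrow> 'a \<Rightarrow> real" where
  "elem_process k \<tau> \<phi> s \<omega> = (\<Sum>i<k. \<phi> i \<omega> * indicator {\<tau> i<..\<tau> (Suc i)} s)"

definition elem_integral ::
  "(real \<Rightarrow> 'a \<Rightarrow> real) \<Rightarrow> nat \<Rightarrow> (nat \<Rightarrow> real) \<Rightarrow> (nat \<Rightarrow> 'a \<Rightarrow> real) \<Rightarrow> real \<Rightarrow> 'a \<Rightarrow> real" where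
  "elem_integral B k \<tau> \<phi> t \<omega> =
     (\<Sum>i<k. \<phi> i \<omega> * (B (min t (\<tau> (Suc i))) \<omega> - B (min t (\<tau> i)) \<omega>))"

text \<open>\<open>I\<close> is (a continuous adapted version of) the It\^o integral process of \<open>H\<close> against \<open>B\<close>,
  for progressive \<open>H\<close> in \<open>L\<^sup>2([0,T] \<times> \<Omega>)\<close> for every \<open>T\<close>: the \<open>L\<^sup>2\<close> limit of the integrals of
  elementary processes that approximate \<open>H\<close>. Square integrability of \<open>H\<close> is implied by the
  existence of the approximating sequence.\<close>

definition ito_integral ::
  "'a measure \<Rightarrow> (real \<Rightarrow> 'a measure) \<Rightarrow> (real \<Rightarrow> 'a \<Rightarrow> real) \<Rightarrow>
     (real \<Rightarrow> 'a \<Rightarrow> real) \<Rightarrow> (real \<Rightarrow> 'a \<Rightarrow> real) \<Rightarrow> bool" where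
  "ito_integral M F B H I \<longleftrightarrow>
     progressive F H \<and>
     adapted F I \<and>
     (AE \<omega> in M. continuous_on {0..} (\<lambda>t. I t \<omega>)) \<and>
     (\<exists>k \<tau> \<phi>. (\<forall>j. elementary F (k j) (\<tau> j) (\<phi> j)) \<and>
        (\<forall>T\<ge>0.
          (\<lambda>j::nat. \<integral>\<^sup>+\<omega>. (\<integral>\<^sup>+s\<in>{0..T}.
              ennreal ((elem_process (k j) (\<tau> j) (\<phi> j) s \<omega> - H s \<omega>)\<^sup>2) \<partial>lborel) \<partial>M)
            \<longlonglongrightarrow> 0 \<and>
          (\<lambda>j::nat. \<integral>\<^sup>+\<omega>. ennreal ((elem_integral B (k j) (\<tau> j) (\<phi> j) T \<omega> - I T \<omega>)\<^sup>2) \<partial>M)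
            \<longlonglongrightarrow> 0))"


section \<open>Deterministic flat solutions\<close>

text \<open>The measure \<open>dK\<close> on \<open>[0, \<infinity>)\<close> of a continuous non-decreasing \<open>K\<close>; \<open>K\<close> is extended to
  negative times by the constant \<open>K 0\<close>, because \<open>interval_measure\<close> expects a function on the
  whole line.\<close>

definition stieltjes :: "(real \<Rightarrow> real) \<Rightarrow> real measure" where
  "stieltjes K = interval_measure (\<lambda>s. K (max 0 s))"

abbreviation law :: "'a measure \<Rightarrow> ('a \<Rightarrow> real) \<Rightarrow> real measure" where
  "law M Z \<equiv> distr M borel Z"

text \<open>Besides the equation and the constraints, the definition asks for what gives them a
  meaning: \<open>X t\<close> has a law in \<open>P2\<close>, and the integrals exist.\<close>

definition deterministic_flat_solution ::
  "'a measure \<Rightarrow> (real \<Rightarrow> 'a measure) \<Rightarrow> (real \<Rightarrow> 'a \<Rightarrow> real) \<Rightarrow> ('a \<Rightarrow> real) \<Rightarrow>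
     (real \<Rightarrow> real measure \<Rightarrow> real) \<Rightarrow> (real \<Rightarrow> real measure \<Rightarrow> real) \<Rightarrow> (real \<Rightarrow> real) \<Rightarrow>
     (real \<Rightarrow> 'a \<Rightarrow> real) \<Rightarrow> (real \<Rightarrow> real) \<Rightarrow> bool" where
  "deterministic_flat_solution M F B \<xi> b \<sigma> h X K \<longleftrightarrow>
     adapted F X \<and>
     (\<forall>\<omega>\<in>space M. continuous_on {0..} (\<lambda>t. X t \<omega>)) \<and>
     (\<forall>t\<ge>0. law M (X t) \<in> P2) \<and>
     K 0 = 0 \<and> mono_on {0..} K \<and> continuous_on {0..} K \<and>
     (\<exists>I. ito_integral M F B (\<lambda>s \<omega>. \<sigma> (X s \<omega>) (law M (X s))) I \<and>
       (AE \<omega> in M. \<forall>t\<ge>0.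
          set_integrable lborel {0..t} (\<lambda>s. b (X s \<omega>) (law M (X s))) \<and>
          X t \<omega> = \<xi> \<omega> + (LINT s:{0..t}|lborel. b (X s \<omega>) (law M (X s))) + I t \<omega> + K t)) \<and>
     (\<forall>t\<ge>0. 0 \<le> (\<integral>\<omega>. h (X t \<omega>) \<partial>M)) \<and>
     (\<forall>t\<ge>0.
        set_integrable (stieltjes K) {0..t} (\<lambda>s. \<integral>\<omega>. h (X s \<omega>) \<partial>M) \<and>
        (LINT s:{0..t}|stieltjes K. (\<integral>\<omega>. h (X s \<omega>) \<partial>M)) = 0)"

end

theory Submission
  imports Defs
begin

text \<open>Write \<open>Y = X\<^sup>n - X\<close> and \<open>V = Y - (K\<^sup>n - K)\<close>, so that \<open>V\<close> is the sum of a drift difference and a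
  difference of stochastic integrals. Where \<open>K\<^sup>n - K\<close> exceeds \<open>(N / m) * sup E \<bar>V\<bar>\<close>, the constraint
  \<open>E (h X\<^sup>n) \<ge> 0\<close> is not tight, hence flatness keeps \<open>K\<^sup>n\<close> constant there; by symmetry
  \<open>sup \<bar>K\<^sup>n - K\<bar> \<le> (N / m) * sup E \<bar>V\<bar>\<close>. Cauchy-Schwarz and Doob's inequality bound \<open>E (sup V\<^sup>2)\<close> by the
  time integral of \<open>E Y\<^sup>2\<close> plus the mean square of the discrepancy of the coefficients along \<open>X\<close>, and
  a Gronwall argument removes the first term. The discrepancy is small where \<open>sup \<bar>X\<bar> \<le> R\<close>, by locally
  uniform convergence, and elsewhere it is at most a constant plus \<open>2 * L * sup \<bar>X\<bar>\<close>, which has small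
  mean square there because \<open>sup \<bar>X\<bar>\<close> is square integrable.\<close>

section \<open>Paths\<close>

text \<open>The estimate runs in a circle: \<open>V\<close> is bounded through \<open>Y\<close>, the
  compensators through \<open>V\<close>, and \<open>Y\<close> through both. The circle closes
  because the compensators are deterministic: their difference at a time is controlled by
  \<open>E \<bar>V\<bar>\<close> at the times before it, with no supremum inside the expectation,
  while \<open>V\<close> depends on \<open>Y\<close> only through a time integral, which leaves room
  for an exponential weight. Absorbing a weighted supremum into itself is legitimate only if it is
  finite. A flat solution is merely known to have a second moment at each single time, so a square
  integrable majorant of the whole path has to come first. The Wasserstein distance is used only
  from above: two random variables on one space couple their own laws. The stochastic integral is
  given as an \<open>L2\<close> limit of elementary integrals, so its martingale property, the
  maximal inequality and a bound for differences are derived from that description. A single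
  Lipschitz constant for all \<open>n\<close> makes the stability constant and the tail bound
  uniform, so that the radius \<open>R\<close> can be fixed before \<open>n\<close>.\<close>

text \<open>Dyadic times are dense, so continuity transfers the bound on them to every time. A
  countable supremum is measurable, and the nested grids suit monotone convergence.\<close>

lemma SUP_dyadic:
  fixes f :: "real \<Rightarrow> real"
  assumes T: "0 \<le> T" and cont: "continuous_on {0..T} f"
  shows "(SUP t\<in>{0..T}. ennreal (f t)) = (SUP k. SUP i\<in>{..(2::nat)^k}. ennreal (f (T * real i / 2^k)))"
proof (rule antisym)
  have in_T: "T * real i / 2^k \<in> {0..T}" if "i \<le> 2^k" for i k :: nat
  proof -
    have "real i \<le> 2^k" using that by (metis of_nat_le_iff of_nat_numeral of_nat_power)
    then show ?thesis using T by (auto simp: field_simps mult_left_mono)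
  qed
  show "(SUP k. SUP i\<in>{..(2::nat)^k}. ennreal (f (T * real i / 2^k))) \<le> (SUP t\<in>{0..T}. ennreal (f t))"
    by (intro SUP_least SUP_upper) (use in_T in auto)
  let ?R = "(SUP k. SUP i\<in>{..(2::nat)^k}. ennreal (f (T * real i / 2^k)))"
  show "(SUP t\<in>{0..T}. ennreal (f t)) \<le> ?R"
  proof (rule SUP_least)
    fix t assume t: "t \<in> {0..T}"
    \<comment> \<open>The index of the grid point just to the left of \<open>t\<close>. For
      \<open>T = 0\<close> the quotient \<open>t / T\<close> is 0 by convention, which makes every
      index 0; this degenerate case needs no separate argument.\<close>
    define i where "i k = nat \<lfloor>2^k * (t / T)\<rfloor>" for k :: nat
    have tT: "0 \<le> t / T" "t / T \<le> 1" using t T by (auto simp: divide_simps)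
    have i_le: "i k \<le> 2^k" for k
    proof -
      have "2^k * (t/T) \<le> 2^k" using tT by (intro mult_left_le) auto
      then have "\<lfloor>2^k * (t/T)\<rfloor> \<le> 2^k" by (simp add: floor_le_iff)
      then show ?thesis unfolding i_def by (simp add: nat_le_iff)
    qed
    have tz: "T = 0 \<Longrightarrow> t = 0" using t by auto
    have lim: "(\<lambda>k. T * real (i k) / 2^k) \<longlonglongrightarrow> t"
    proof (rule real_tendsto_sandwich)
      have r: "real (i k) \<le> 2^k * (t/T)" "2^k * (t/T) - 1 \<le> real (i k)" for k :: nat
      proof -
        define z where "z = 2^k * (t/T)"
        have "0 \<le> z" unfolding z_def by (intro mult_nonneg_nonneg tT) auto
        then have "real (i k) = of_int \<lfloor>z\<rfloor>" unfolding i_def z_def[symmetric] by simp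
        then show "real (i k) \<le> 2^k * (t/T)" "2^k * (t/T) - 1 \<le> real (i k)"
          unfolding z_def[symmetric] by linarith+
      qed
      show "\<forall>\<^sub>F k in sequentially. t - T / 2^k \<le> T * real (i k) / 2^k"
      proof (rule always_eventually, rule allI)
        fix k
        have "T * (2^k * (t/T) - 1) \<le> T * real (i k)" using r T by (intro mult_left_mono)
        moreover have "T * (2^k * (t/T) - 1) = 2^k * t - T"
          by (cases "T = 0") (auto simp: tz algebra_simps)
        ultimately have "(2^k * t - T) / 2^k \<le> T * real (i k) / 2^k" by (intro divide_right_mono) auto
        then show "t - T / 2^k \<le> T * real (i k) / 2^k" by (simp add: diff_divide_distrib)
      qed
      show "\<forall>\<^sub>F k in sequentially. T * real (i k) / 2^k \<le> t"
      proof (rule always_eventually, rule allI)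
        fix k
        have "T * real (i k) \<le> T * (2^k * (t/T))" using r T by (intro mult_left_mono)
        also have "\<dots> = 2^k * t" by (cases "T = 0") (auto simp: tz)
        finally have "T * real (i k) / 2^k \<le> 2^k * t / 2^k" by (intro divide_right_mono) auto
        then show "T * real (i k) / 2^k \<le> t" by simp
      qed
      have "(\<lambda>k. t - T * (1/2)^k) \<longlonglongrightarrow> t - T * 0"
        by (intro tendsto_intros LIMSEQ_realpow_zero) auto
      then show "(\<lambda>k. t - T / 2^k) \<longlonglongrightarrow> t" by (simp add: power_divide)
    qed simp
    have "(\<lambda>k. f (T * real (i k) / 2^k)) \<longlonglongrightarrow> f t"
      using cont t lim in_T[OF i_le] by (auto simp: continuous_on_sequentially o_def)
    then have "(\<lambda>k. ennreal (f (T * real (i k) / 2^k))) \<longlonglongrightarrow> ennreal (f t)" by (rule tendsto_ennrealI)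
    then show "ennreal (f t) \<le> ?R"
    proof (rule LIMSEQ_le_const2, intro exI allI impI)
      fix k
      show "ennreal (f (T * real (i k) / 2^k)) \<le> ?R"
        by (rule SUP_upper2[of k], simp, rule SUP_upper) (use i_le in auto)
    qed
  qed
qed

lemma set_integral_exp_le:
  fixes l t :: real assumes "0 < l" "0 \<le> t"
  shows "set_integrable lborel {0..t} (\<lambda>s. exp (l * s))"
    and "(LINT s:{0..t}|lborel. exp (l * s)) \<le> exp (l * t) / l"
proof -
  have "has_bochner_integral lborel (\<lambda>s. exp (l * s) * indicator {0..t} s) (exp (l * t) / l - exp (l * 0) / l)"
    using assms by (intro has_bochner_integral_FTC_Icc_real) (auto intro!: derivative_eq_intros continuous_intros)
  then have *: "has_bochner_integral lborel (\<lambda>s. indicator {0..t} s *\<^sub>R exp (l * s)) (exp (l * t) / l - exp (l * 0) / l)"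
    by (simp add: mult.commute)
  show "set_integrable lborel {0..t} (\<lambda>s. exp (l * s))"
    using * unfolding set_integrable_def by (auto dest: integrable.intros)
  show "(LINT s:{0..t}|lborel. exp (l * s)) \<le> exp (l * t) / l"
    using has_bochner_integral_integral_eq[OF *] assms unfolding set_lebesgue_integral_def by simp
qed

text \<open>Evaluate the hypothesis where \<open>f s * exp (- (2 * L * s))\<close> attains its
  maximum \<open>a\<close>. The rate \<open>2 * L\<close> is chosen so that the integral contributes
  at most half of the left side there; absorbing that half is what turns \<open>c\<close> into
  \<open>2 * c\<close>. If \<open>a\<close> is negative, \<open>0 \<le> c\<close> already gives the
  bound.\<close>

lemma gronwall_continuous:
  fixes f :: "real \<Rightarrow> real"
  assumes L: "0 < L" and c: "0 \<le> c" and cont: "continuous_on {0..T} f"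
    and bd: "\<And>t. t \<in> {0..T} \<Longrightarrow> f t \<le> c + L * (LINT s:{0..t}|lborel. f s)"
    and t: "t \<in> {0..T}"
  shows "f t \<le> 2 * c * exp (2 * L * T)"
proof -
  have "continuous_on {0..T} (\<lambda>s. f s * exp (- (2 * L * s)))" using cont by (intro continuous_intros)
  then obtain u where u: "u \<in> {0..T}" and max: "\<And>s. s \<in> {0..T} \<Longrightarrow> f s * exp (- (2 * L * s)) \<le> f u * exp (- (2 * L * u))"
    using continuous_attains_sup[of "{0..T}" "\<lambda>s. f s * exp (- (2 * L * s))"] t by auto
  define a where "a = f u * exp (- (2 * L * u))"
  have fa: "f s \<le> a * exp (2 * L * s)" if "s \<in> {0..T}" for s
    using max[OF that] by (simp add: a_def exp_minus field_simps)
  have fu: "f u = a * exp (2 * L * u)" by (simp add: a_def exp_minus field_simps)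
  have a2: "a \<le> 2 * c"
  proof (cases "0 \<le> a")
    case True
    have "set_integrable lborel {0..u} f"
      using cont u by (intro borel_integrable_atLeastAtMost' continuous_on_subset[OF cont]) auto
    then have "(LINT s:{0..u}|lborel. f s) \<le> (LINT s:{0..u}|lborel. a * exp (2 * L * s))"
      using u fa L by (intro set_integral_mono set_integrable_mult_right set_integral_exp_le(1)) auto
    also have "\<dots> = a * (LINT s:{0..u}|lborel. exp (2 * L * s))" by simp
    also have "\<dots> \<le> a * (exp (2 * L * u) / (2 * L))"
      using u L True by (intro mult_left_mono set_integral_exp_le(2)) auto
    finally have "L * (LINT s:{0..u}|lborel. f s) \<le> a * exp (2 * L * u) / 2" using L by (simp add: field_simps)
    with bd[OF u] fu have "a * exp (2 * L * u) \<le> 2 * c" by simp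
    moreover have "a \<le> a * exp (2 * L * u)" using True u L by (simp add: mult_left_le mult_le_cancel_left1)
    ultimately show ?thesis by simp
  qed (use c in auto)
  have "f t \<le> a * exp (2 * L * t)" by (rule fa[OF t])
  also have "\<dots> \<le> 2 * c * exp (2 * L * t)" using a2 by (intro mult_right_mono) auto
  also have "\<dots> \<le> 2 * c * exp (2 * L * T)" using t c L by (intro mult_left_mono) auto
  finally show ?thesis .
qed

text \<open>Cauchy-Schwarz against the indicator of \<open>{0..r}\<close>, whose mass is at most
  \<open>T\<close>. The right side extends to \<open>t\<close> so that it no longer depends on
  \<open>r\<close> and bounds the squares for all \<open>r\<close> at once.\<close>

lemma square_set_integral_le:
  fixes f :: "real \<Rightarrow> real"
  assumes cont: "continuous_on {0..t} f" and r: "0 \<le> r" "r \<le> t" "t \<le> T" and nn: "\<And>s. s \<in> {0..t} \<Longrightarrow> 0 \<le> f s"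
  shows "ennreal ((LINT s:{0..r}|lborel. f s)\<^sup>2) \<le> ennreal T * (\<integral>\<^sup>+s\<in>{0..t}. ennreal ((f s)\<^sup>2) \<partial>lborel)"
proof -
  have cr: "continuous_on {0..r} f" using cont r by (auto intro: continuous_on_subset)
  have i: "set_integrable lborel {0..r} f"
    by (rule borel_integrable_atLeastAtMost'[OF cr])
  have m: "(\<lambda>s. f s * indicator {0..t} s) \<in> borel_measurable borel"
    using borel_measurable_continuous_on_indicator[OF _ cont] by (simp add: mult.commute)
  define g where "g s = ennreal (f s * indicator {0..t} s)" for s
  have gm[measurable]: "g \<in> borel_measurable borel" unfolding g_def using m by measurable
  have "ennreal (LINT s:{0..r}|lborel. f s) = (\<integral>\<^sup>+s. ennreal (indicator {0..r} s *\<^sub>R f s) \<partial>lborel)"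
    using i nn r unfolding set_lebesgue_integral_def set_integrable_def
    by (intro nn_integral_eq_integral[symmetric]) (auto simp: indicator_def)
  also have "\<dots> = (\<integral>\<^sup>+s. g s * indicator {0..r} s \<partial>lborel)"
    using r by (intro nn_integral_cong) (auto simp: g_def indicator_def)
  finally have "(ennreal (LINT s:{0..r}|lborel. f s))\<^sup>2 = (\<integral>\<^sup>+s. g s * indicator {0..r} s \<partial>lborel)\<^sup>2" by simp
  also have "\<dots> \<le> (\<integral>\<^sup>+s. (g s)\<^sup>2 \<partial>lborel) * (\<integral>\<^sup>+s. (indicator {0..r} s)\<^sup>2 \<partial>lborel)"
    by (intro Cauchy_Schwarz_nn_integral) auto
  also have "(\<integral>\<^sup>+s. (indicator {0..r} s :: ennreal)\<^sup>2 \<partial>lborel) = (\<integral>\<^sup>+s. indicator {0..r} s \<partial>lborel)"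
    by (intro nn_integral_cong) (auto simp: indicator_def)
  also have "\<dots> = ennreal r" using r by simp
  also have "(\<integral>\<^sup>+s. (g s)\<^sup>2 \<partial>lborel) = (\<integral>\<^sup>+s\<in>{0..t}. ennreal ((f s)\<^sup>2) \<partial>lborel)"
    using nn by (intro nn_integral_cong) (auto simp: g_def indicator_def ennreal_power)
  finally have "(ennreal (LINT s:{0..r}|lborel. f s))\<^sup>2 \<le> (\<integral>\<^sup>+s\<in>{0..t}. ennreal ((f s)\<^sup>2) \<partial>lborel) * ennreal r" .
  also have "\<dots> \<le> (\<integral>\<^sup>+s\<in>{0..t}. ennreal ((f s)\<^sup>2) \<partial>lborel) * ennreal T"
    using r by (intro mult_left_mono ennreal_leI) auto
  finally have *: "(ennreal (LINT s:{0..r}|lborel. f s))\<^sup>2 \<le> ennreal T * (\<integral>\<^sup>+s\<in>{0..t}. ennreal ((f s)\<^sup>2) \<partial>lborel)"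
    by (simp add: mult.commute)
  have "0 \<le> (LINT s:{0..r}|lborel. f s)"
    unfolding set_lebesgue_integral_def using nn r by (intro integral_nonneg_AE) (auto simp: indicator_def)
  then show ?thesis using * by (simp add: ennreal_power)
qed

section \<open>Maximal inequality for finite sequences\<close>

primrec running_max :: "(nat \<Rightarrow> real) \<Rightarrow> nat \<Rightarrow> real" where
  "running_max x 0 = \<bar>x 0\<bar>"
| "running_max x (Suc n) = max (running_max x n) \<bar>x (Suc n)\<bar>"

lemma running_max_ge: "i \<le> n \<Longrightarrow> \<bar>x i\<bar> \<le> running_max x n"
  by (induction n) (auto simp: le_Suc_eq le_max_iff_disj)

lemma running_max_nonneg: "0 \<le> running_max x n"
  by (induction n) auto

text \<open>A crude bound that serves to make the running maximum square integrable; the sharp one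
  follows.\<close>

lemma running_max_square_le_sum: "(running_max x n)\<^sup>2 \<le> (\<Sum>i\<le>n. (x i)\<^sup>2)"
proof (induction n)
  case (Suc n)
  have "(running_max x (Suc n))\<^sup>2 \<le> (running_max x n)\<^sup>2 + (x (Suc n))\<^sup>2"
    by (auto simp: max_def)
  with Suc show ?case by simp
qed simp

text \<open>The pathwise form of Doob's \<open>L\<^sup>2\<close> inequality: for a martingale \<open>x\<close> the sum on the right
  has expectation zero.\<close>

lemma running_max_square_le:
  "(running_max x n)\<^sup>2 \<le> 4 * (x n)\<^sup>2 - 4 * (\<Sum>i<n. running_max x i * sgn (x i) * (x (Suc i) - x i))"
proof -
  \<comment> \<open>Discrete integration by parts. The sign linearises the increment of
    \<open>\<bar>x\<bar>\<close> from below, and the running maximum \<open>S\<close> grows only at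
    indices where it equals \<open>\<bar>x\<bar>\<close>, so the sum of \<open>S\<close> times the
    increments of \<open>\<bar>x\<bar>\<close> stays below
    \<open>S * \<bar>x\<bar> - S^2 / 2\<close>.\<close>
  have "(\<Sum>i<n. running_max x i * sgn (x i) * (x (Suc i) - x i)) \<le> running_max x n * \<bar>x n\<bar> - (running_max x n)\<^sup>2 / 2"
  proof (induction n)
    case 0
    show ?case by (simp add: power2_eq_square field_simps)
  next
    case (Suc n)
    let ?S = "running_max x n"
    have "sgn (x n) * (x (Suc n) - x n) \<le> \<bar>x (Suc n)\<bar> - \<bar>x n\<bar>"
      by (cases "x n" "0::real" rule: linorder_cases) auto
    then have "?S * (sgn (x n) * (x (Suc n) - x n)) \<le> ?S * (\<bar>x (Suc n)\<bar> - \<bar>x n\<bar>)"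
      using running_max_nonneg by (rule mult_left_mono)
    with Suc have "(\<Sum>i<Suc n. running_max x i * sgn (x i) * (x (Suc i) - x i)) \<le> ?S * \<bar>x (Suc n)\<bar> - ?S\<^sup>2 / 2"
      by (simp add: algebra_simps)
    also have "\<dots> \<le> running_max x (Suc n) * \<bar>x (Suc n)\<bar> - (running_max x (Suc n))\<^sup>2 / 2"
    proof (cases "?S \<le> \<bar>x (Suc n)\<bar>")
      case True
      have "0 \<le> (\<bar>x (Suc n)\<bar> - ?S)\<^sup>2" by simp
      with True show ?thesis by (simp add: max_def power2_eq_square algebra_simps)
    qed (simp add: max_def)
    finally show ?case .
  qed
  \<comment> \<open>This square gives \<open>S * \<bar>x\<bar> \<le> S^2 / 4 + x^2\<close>, the
    source of the constant 4.\<close>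
  moreover have "0 \<le> (running_max x n / 2 - \<bar>x n\<bar>)\<^sup>2 * 4" by simp
  ultimately show ?thesis by (simp add: power2_eq_square algebra_simps)
qed

section \<open>Brownian increments and the isometry\<close>

definition L2 :: "'a measure \<Rightarrow> ('a \<Rightarrow> real) \<Rightarrow> bool" where
  "L2 M f \<longleftrightarrow> f \<in> borel_measurable M \<and> integrable M (\<lambda>x. (f x)\<^sup>2)"

lemma L2_measurable: "L2 M f \<Longrightarrow> f \<in> borel_measurable M"
  and L2_square_integrable: "L2 M f \<Longrightarrow> integrable M (\<lambda>x. (f x)\<^sup>2)"
  by (auto simp: L2_def)

lemma L2_mult_integrable:
  assumes "L2 M f" "L2 M g" shows "integrable M (\<lambda>x. f x * g x)"
proof (rule Bochner_Integration.integrable_bound)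
  show "integrable M (\<lambda>x. (f x)\<^sup>2 + (g x)\<^sup>2)" using assms by (auto simp: L2_def)
  show "AE x in M. norm (f x * g x) \<le> norm ((f x)\<^sup>2 + (g x)\<^sup>2)"
  proof (rule AE_I2)
    fix x
    have "0 \<le> (\<bar>f x\<bar> - \<bar>g x\<bar>)\<^sup>2" "0 \<le> (f x)\<^sup>2" "0 \<le> (g x)\<^sup>2" by auto
    moreover have "(\<bar>f x\<bar> - \<bar>g x\<bar>)\<^sup>2 = (f x)\<^sup>2 + (g x)\<^sup>2 - 2 * \<bar>f x * g x\<bar>"
      by (simp add: power2_diff abs_mult)
    ultimately have "2 * \<bar>f x * g x\<bar> \<le> (f x)\<^sup>2 + (g x)\<^sup>2" by linarith
    then show "norm (f x * g x) \<le> norm ((f x)\<^sup>2 + (g x)\<^sup>2)" by simp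
  qed
qed (use assms in \<open>auto simp: L2_def\<close>)

lemma L2_add:
  assumes "L2 M f" "L2 M g" shows "L2 M (\<lambda>x. f x + g x)"
proof -
  have "integrable M (\<lambda>x. (f x)\<^sup>2 + 2 * (f x * g x) + (g x)\<^sup>2)"
    using assms L2_mult_integrable[OF assms] by (auto simp: L2_def)
  then have "integrable M (\<lambda>x. (f x + g x)\<^sup>2)" by (simp add: power2_sum algebra_simps)
  then show ?thesis using assms by (auto simp: L2_def)
qed

lemma L2_mult_bounded:
  assumes f: "L2 M f" and z: "z \<in> borel_measurable M" "\<And>x. x \<in> space M \<Longrightarrow> \<bar>z x\<bar> \<le> C"
  shows "L2 M (\<lambda>x. z x * f x)"
  unfolding L2_def
proof (intro conjI)
  show "integrable M (\<lambda>x. (z x * f x)\<^sup>2)"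
  proof (rule Bochner_Integration.integrable_bound)
    show "integrable M (\<lambda>x. C\<^sup>2 * (f x)\<^sup>2)" using f by (auto simp: L2_def)
    show "AE x in M. norm ((z x * f x)\<^sup>2) \<le> norm (C\<^sup>2 * (f x)\<^sup>2)"
    proof (rule AE_I2)
      fix x assume "x \<in> space M"
      then have "(z x)\<^sup>2 \<le> C\<^sup>2" using z(2)[of x] by (metis abs_ge_zero power2_abs power_mono)
      then show "norm ((z x * f x)\<^sup>2) \<le> norm (C\<^sup>2 * (f x)\<^sup>2)"
        by (simp add: power_mult_distrib mult_right_mono)
    qed
  qed (use f z in \<open>auto simp: L2_def\<close>)
qed (use f z in \<open>auto simp: L2_def\<close>)

lemma L2_cmult: "L2 M f \<Longrightarrow> L2 M (\<lambda>x. c * f x)"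
  by (rule L2_mult_bounded[where C="\<bar>c\<bar>"]) auto

lemma L2_diff: "L2 M f \<Longrightarrow> L2 M g \<Longrightarrow> L2 M (\<lambda>x. f x - g x)"
  using L2_add[of M f "\<lambda>x. -1 * g x"] L2_cmult[of M g "-1"] by simp

lemma L2_zero: "L2 M (\<lambda>x. 0)" by (simp add: L2_def)

lemma L2_sum: "(\<And>i. i \<in> I \<Longrightarrow> L2 M (f i)) \<Longrightarrow> L2 M (\<lambda>x. \<Sum>i\<in>I. f i x)"
  by (induction I rule: infinite_finite_induct) (auto intro: L2_zero L2_add)

lemma L2_bound:
  assumes "L2 M f" "g \<in> borel_measurable M" "\<And>x. x \<in> space M \<Longrightarrow> (g x)\<^sup>2 \<le> (f x)\<^sup>2"
  shows "L2 M g"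
  using assms unfolding L2_def by (auto intro: Bochner_Integration.integrable_bound[of M "\<lambda>x. (f x)\<^sup>2"])

lemma L2_nn_integral: "L2 M f \<Longrightarrow> (\<integral>\<^sup>+x. ennreal ((f x)\<^sup>2) \<partial>M) = ennreal (\<integral>x. (f x)\<^sup>2 \<partial>M)"
  unfolding L2_def by (intro nn_integral_eq_integral) auto

lemma L2_iff_nn_integral:
  "f \<in> borel_measurable M \<Longrightarrow> L2 M f \<longleftrightarrow> (\<integral>\<^sup>+x. ennreal ((f x)\<^sup>2) \<partial>M) < \<infinity>"
  unfolding L2_def by (simp add: integrable_iff_bounded)

lemma (in finite_measure) L2_bounded:
  assumes "f \<in> borel_measurable M" "\<And>x. x \<in> space M \<Longrightarrow> \<bar>f x\<bar> \<le> C" shows "L2 M f"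
proof -
  have "L2 M (\<lambda>x. 1)" by (simp add: L2_def)
  from L2_mult_bounded[OF this assms] show ?thesis by simp
qed

lemma (in finite_measure) L2_integrable: "L2 M f \<Longrightarrow> integrable M f"
  using L2_mult_integrable[of M f "\<lambda>_. 1"] L2_bounded[of "\<lambda>_. 1" 1] by simp

lemma (in prob_space) square_expectation_le:
  assumes "L2 M f" shows "(expectation f)\<^sup>2 \<le> expectation (\<lambda>x. (f x)\<^sup>2)"
  using variance_eq[OF L2_integrable[OF assms] L2_square_integrable[OF assms]] variance_positive[of f] by simp

lemma square_add_le: "(x + y)\<^sup>2 \<le> 2 * x\<^sup>2 + 2 * (y\<^sup>2 :: real)"
proof -
  have "0 \<le> (x - y)\<^sup>2" by simp
  then show ?thesis unfolding power2_diff power2_sum by linarith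
qed

text \<open>Deliberately asymmetric: when two stochastic integrals are compared through their
  approximations, the outer summands are errors that vanish in the limit, and only the smaller
  factor of the middle one survives.\<close>

lemma square_add3_le: "(x + y + z)\<^sup>2 \<le> 4 * x\<^sup>2 + 2 * y\<^sup>2 + 4 * (z\<^sup>2 :: real)"
  using square_add_le[of "x + z" y] square_add_le[of x z] by (simp add: algebra_simps)

lemma square_add3_mean_le: "(x + y + z)\<^sup>2 \<le> 3 * x\<^sup>2 + 3 * y\<^sup>2 + 3 * (z\<^sup>2 :: real)"
proof -
  have "0 \<le> (x - y)\<^sup>2 + (x - z)\<^sup>2 + (y - z)\<^sup>2" by simp
  then show ?thesis by (simp add: power2_eq_square algebra_simps)
qed

lemma square_le_of_abs_le: "\<bar>x\<bar> \<le> y \<Longrightarrow> x\<^sup>2 \<le> (y :: real)\<^sup>2"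
  using power_mono[of "\<bar>x\<bar>" y 2] by simp

section \<open>Moments and independence of increments\<close>

locale filtered_brownian_motion = complete_filtered_prob_space M F
  for M :: "'a measure" and F :: "real \<Rightarrow> 'a measure" +
  fixes B :: "real \<Rightarrow> 'a \<Rightarrow> real"
  assumes BM: "brownian_motion M F B"
begin

lemma space_F: "0 \<le> t \<Longrightarrow> space (F t) = space M"
  using subalgebra_F by (auto simp: subalgebra_def)

lemma F_measurable_M: "0 \<le> t \<Longrightarrow> f \<in> borel_measurable (F t) \<Longrightarrow> f \<in> borel_measurable M"
  by (rule measurable_from_subalg[OF subalgebra_F])

lemma F_measurable_mono:
  assumes "0 \<le> s" "s \<le> t" "f \<in> borel_measurable (F s)" shows "f \<in> borel_measurable (F t)"
proof -
  have "subalgebra (F t) (F s)" using assms F_mono[of s t] space_F[of s] space_F[of t] by (auto simp: subalgebra_def)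
  then show ?thesis using assms(3) measurable_from_subalg by blast
qed

lemma B_measurable: "0 \<le> t \<Longrightarrow> B t \<in> borel_measurable (F t)"
  using BM by (auto simp: brownian_motion_def adapted_def)

lemma increment_measurable: "0 \<le> s \<Longrightarrow> s \<le> t \<Longrightarrow> (\<lambda>\<omega>. B t \<omega> - B s \<omega>) \<in> borel_measurable (F t)"
  by (intro borel_measurable_diff B_measurable F_measurable_mono[of s t "B s"]) auto

lemma increment_normal:
  "0 \<le> s \<Longrightarrow> s < t \<Longrightarrow> distributed M lborel (\<lambda>\<omega>. B t \<omega> - B s \<omega>) (normal_density 0 (sqrt (t - s)))"
  using BM unfolding brownian_motion_def by blast

lemma increment_moments:
  assumes "0 \<le> s" "s \<le> t"
  shows "L2 M (\<lambda>\<omega>. B t \<omega> - B s \<omega>)"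
    and "expectation (\<lambda>\<omega>. B t \<omega> - B s \<omega>) = 0"
    and "expectation (\<lambda>\<omega>. (B t \<omega> - B s \<omega>)\<^sup>2) = t - s"
proof -
  have "L2 M (\<lambda>\<omega>. B t \<omega> - B s \<omega>) \<and> expectation (\<lambda>\<omega>. B t \<omega> - B s \<omega>) = 0 \<and>
    expectation (\<lambda>\<omega>. (B t \<omega> - B s \<omega>)\<^sup>2) = t - s"
  proof (cases "s = t")
    case False
    with assms have st: "s < t" by simp
    note D = increment_normal[OF assms(1) st]
    have E: "expectation (\<lambda>\<omega>. B t \<omega> - B s \<omega>) = 0"
      by (rule normal_distributed_expectation[OF _ D]) (use st in auto)
    have V: "variance (\<lambda>\<omega>. B t \<omega> - B s \<omega>) = (sqrt (t - s))\<^sup>2"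
      by (rule normal_distributed_variance[OF _ D]) (use st in auto)
    have m: "(\<lambda>\<omega>. B t \<omega> - B s \<omega>) \<in> borel_measurable M"
      by (rule F_measurable_M[OF _ increment_measurable[OF assms]]) (use assms in simp)
    have "integrable lborel (\<lambda>x. normal_density 0 (sqrt (t - s)) x * x\<^sup>2)"
      using integrable_normal_moment[of "sqrt (t - s)" 0 2] st by simp
    then have "integrable M (\<lambda>\<omega>. (B t \<omega> - B s \<omega>)\<^sup>2)"
      using distributed_integrable[OF D, of "\<lambda>x. x\<^sup>2"] by (simp add: normal_density_nonneg)
    then have "L2 M (\<lambda>\<omega>. B t \<omega> - B s \<omega>)" using m by (simp add: L2_def)
    then show ?thesis using E V st by simp
  qed (auto simp: L2_zero)
  then show "L2 M (\<lambda>\<omega>. B t \<omega> - B s \<omega>)"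
    and "expectation (\<lambda>\<omega>. B t \<omega> - B s \<omega>) = 0"
    and "expectation (\<lambda>\<omega>. (B t \<omega> - B s \<omega>)\<^sup>2) = t - s" by auto
qed

text \<open>The definition of Brownian motion speaks of the preimages under the increment, whereas
  \<open>indep_var\<close> speaks of generated sigma-algebras. Preimages are stable under
  intersection, so independence extends to what they generate.\<close>

lemma increment_indep:
  assumes "0 \<le> s" "s < t" and Z: "Z \<in> borel_measurable (F s)"
  shows "indep_var borel Z borel (\<lambda>\<omega>. B t \<omega> - B s \<omega>)"
proof -
  let ?D = "\<lambda>\<omega>. B t \<omega> - B s \<omega>"
  have ind: "indep_set (sets (F s)) {?D -` A \<inter> space M | A. A \<in> sets borel}"
    using BM assms unfolding brownian_motion_def by blast
  have rv: "Z \<in> borel_measurable M" "?D \<in> borel_measurable M"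
    using F_measurable_M[OF assms(1) Z] F_measurable_M[OF _ increment_measurable[of s t]] assms by auto
  have "indep_set {Z -` A \<inter> space M | A. A \<in> sets borel} {?D -` A \<inter> space M | A. A \<in> sets borel}"
    using ind unfolding indep_sets2_eq
  proof (elim conjE, intro conjI)
    assume *: "\<forall>a\<in>sets (F s). \<forall>b\<in>{?D -` A \<inter> space M |A. A \<in> sets borel}. prob (a \<inter> b) = prob a * prob b"
    have "Z -` A \<inter> space M \<in> sets (F s)" if "A \<in> sets borel" for A
      using measurable_sets[OF Z that] space_F assms by simp
    then show "\<forall>a\<in>{Z -` A \<inter> space M |A. A \<in> sets borel}.
       \<forall>b\<in>{?D -` A \<inter> space M |A. A \<in> sets borel}. prob (a \<inter> b) = prob a * prob b"
      using * by blast
  qed (use rv in \<open>auto intro: measurable_sets\<close>)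
  then have "indep_set (sigma_sets (space M) {Z -` A \<inter> space M | A. A \<in> sets borel})
      (sigma_sets (space M) {?D -` A \<inter> space M | A. A \<in> sets borel})"
  proof (rule indep_set_sigma_sets)
    have *: "Int_stable {f -` A \<inter> space M | A. A \<in> sets (borel :: real measure)}" for f :: "'a \<Rightarrow> real"
    proof (safe intro!: Int_stableI)
      fix A A' :: "real set" assume "A \<in> sets borel" "A' \<in> sets borel"
      then show "\<exists>C. f -` A \<inter> space M \<inter> (f -` A' \<inter> space M) = f -` C \<inter> space M \<and> C \<in> sets borel"
        by (intro exI[of _ "A \<inter> A'"]) auto
    qed
    show "Int_stable {Z -` A \<inter> space M | A. A \<in> sets borel}" by (rule *)
    show "Int_stable {?D -` A \<inter> space M | A. A \<in> sets borel}" by (rule *)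
  qed
  then show ?thesis using rv unfolding indep_var_eq by auto
qed

text \<open>Independence lets expectations factor. The first moment feeds the martingale property,
  the second the isometry; the case \<open>s = t\<close> is split off because the normal law is
  available only for proper intervals.\<close>

lemma increment_mult:
  assumes st: "0 \<le> s" "s \<le> t" and Z: "Z \<in> borel_measurable (F s)" "integrable M Z"
  shows "integrable M (\<lambda>\<omega>. Z \<omega> * (B t \<omega> - B s \<omega>))"
    and "expectation (\<lambda>\<omega>. Z \<omega> * (B t \<omega> - B s \<omega>)) = 0"
    and "integrable M (\<lambda>\<omega>. Z \<omega> * (B t \<omega> - B s \<omega>)\<^sup>2)"
    and "expectation (\<lambda>\<omega>. Z \<omega> * (B t \<omega> - B s \<omega>)\<^sup>2) = expectation Z * (t - s)"
proof -
  let ?D = "\<lambda>\<omega>. B t \<omega> - B s \<omega>"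
  note mom = increment_moments[OF st]
  have "integrable M (\<lambda>\<omega>. Z \<omega> * ?D \<omega>) \<and> expectation (\<lambda>\<omega>. Z \<omega> * ?D \<omega>) = 0 \<and>
    integrable M (\<lambda>\<omega>. Z \<omega> * (?D \<omega>)\<^sup>2) \<and> expectation (\<lambda>\<omega>. Z \<omega> * (?D \<omega>)\<^sup>2) = expectation Z * (t - s)"
  proof (cases "s = t")
    case False
    with st have "s < t" by simp
    note ind = increment_indep[OF st(1) this Z(1)]
    have ind2: "indep_var borel Z borel (\<lambda>\<omega>. (?D \<omega>)\<^sup>2)"
      using indep_var_compose[OF ind, of "\<lambda>x. x" borel "\<lambda>x. x\<^sup>2" borel] by (simp add: o_def)
    have i: "integrable M ?D" "integrable M (\<lambda>\<omega>. (?D \<omega>)\<^sup>2)"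
      using mom(1) L2_integrable L2_square_integrable by auto
    show ?thesis
      using indep_var_integrable[OF ind Z(2) i(1)] indep_var_lebesgue_integral[OF ind Z(2) i(1)]
        indep_var_integrable[OF ind2 Z(2) i(2)] indep_var_lebesgue_integral[OF ind2 Z(2) i(2)] mom by simp
  qed auto
  then show "integrable M (\<lambda>\<omega>. Z \<omega> * (B t \<omega> - B s \<omega>))"
    and "expectation (\<lambda>\<omega>. Z \<omega> * (B t \<omega> - B s \<omega>)) = 0"
    and "integrable M (\<lambda>\<omega>. Z \<omega> * (B t \<omega> - B s \<omega>)\<^sup>2)"
    and "expectation (\<lambda>\<omega>. Z \<omega> * (B t \<omega> - B s \<omega>)\<^sup>2) = expectation Z * (t - s)" by auto
qed

text \<open>Plays two roles: an admissible height for an increment that starts at time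
  \<open>t\<close>, and a test function for the martingale property at time
  \<open>t\<close>.\<close>

definition bounded_at :: "real \<Rightarrow> ('a \<Rightarrow> real) \<Rightarrow> bool" where
  "bounded_at t \<phi> \<longleftrightarrow> \<phi> \<in> borel_measurable (F t) \<and> (\<exists>C. \<forall>\<omega>\<in>space M. \<bar>\<phi> \<omega>\<bar> \<le> C)"

lemma bounded_atD: "bounded_at t \<phi> \<Longrightarrow> 0 \<le> t \<Longrightarrow> \<phi> \<in> borel_measurable M"
  unfolding bounded_at_def by (elim conjE) (rule F_measurable_M)

lemma bounded_at_mono: "bounded_at s \<phi> \<Longrightarrow> 0 \<le> s \<Longrightarrow> s \<le> t \<Longrightarrow> bounded_at t \<phi>"
  unfolding bounded_at_def by (elim conjE, rule conjI, rule F_measurable_mono)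

lemma bounded_at_mult:
  assumes "bounded_at t \<phi>" "bounded_at t \<psi>" shows "bounded_at t (\<lambda>\<omega>. \<phi> \<omega> * \<psi> \<omega>)"
proof -
  obtain C D where "\<forall>\<omega>\<in>space M. \<bar>\<phi> \<omega>\<bar> \<le> C" "\<forall>\<omega>\<in>space M. \<bar>\<psi> \<omega>\<bar> \<le> D"
    using assms unfolding bounded_at_def by blast
  then have "\<forall>\<omega>\<in>space M. \<bar>\<phi> \<omega> * \<psi> \<omega>\<bar> \<le> C * D"
    unfolding abs_mult by (intro ballI mult_mono) (auto intro: order_trans[OF abs_ge_zero])
  then show ?thesis using assms unfolding bounded_at_def by auto
qed

lemma bounded_at_L2_mult: "bounded_at t \<phi> \<Longrightarrow> 0 \<le> t \<Longrightarrow> L2 M f \<Longrightarrow> L2 M (\<lambda>\<omega>. \<phi> \<omega> * f \<omega>)"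
  by (frule (1) bounded_atD) (auto simp: bounded_at_def intro: L2_mult_bounded)

lemma bounded_at_L2: "bounded_at t \<phi> \<Longrightarrow> 0 \<le> t \<Longrightarrow> L2 M \<phi>"
  using bounded_at_L2_mult[of t \<phi> "\<lambda>_. 1"] L2_bounded[of "\<lambda>_. 1" 1] by simp

text \<open>Only the time shared by the two intervals contributes. Increments over the remaining
  pieces are centred and independent of a factor known when they start, so their products have mean
  zero.\<close>

lemma covariance_ordered:
  assumes ab: "0 \<le> a" "a \<le> b" and cd: "c \<le> d" and ac: "a \<le> c"
    and \<phi>: "bounded_at a \<phi>" and \<psi>: "bounded_at c \<psi>"
  shows "expectation (\<lambda>\<omega>. (\<phi> \<omega> * (B b \<omega> - B a \<omega>)) * (\<psi> \<omega> * (B d \<omega> - B c \<omega>)))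
    = expectation (\<lambda>\<omega>. \<phi> \<omega> * \<psi> \<omega>) * measure lborel ({a<..b} \<inter> {c<..d})"
proof -
  have c0: "0 \<le> c" using ab ac by simp
  have p: "bounded_at c (\<lambda>\<omega>. \<phi> \<omega> * \<psi> \<omega>)" using bounded_at_mult[OF bounded_at_mono[OF \<phi> ab(1) ac] \<psi>] .
  have incr: "L2 M (\<lambda>\<omega>. (\<phi> \<omega> * \<psi> \<omega>) * (B v \<omega> - B u \<omega>))" if "0 \<le> u" "u \<le> v" for u v
    by (rule bounded_at_L2_mult[OF p c0 increment_moments(1)[OF that]])
  have Fm: "(\<lambda>\<omega>. (\<phi> \<omega> * \<psi> \<omega>) * (B v \<omega> - B u \<omega>)) \<in> borel_measurable (F w)"
    if "0 \<le> u" "u \<le> v" "v \<le> w" "c \<le> w" for u v w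
  proof (rule borel_measurable_times)
    show "(\<lambda>\<omega>. \<phi> \<omega> * \<psi> \<omega>) \<in> borel_measurable (F w)"
      using bounded_at_mono[OF p c0 that(4)] by (simp add: bounded_at_def)
    show "(\<lambda>\<omega>. B v \<omega> - B u \<omega>) \<in> borel_measurable (F w)"
      by (rule F_measurable_mono[OF _ that(3) increment_measurable[OF that(1,2)]]) (use that in simp)
  qed
  show ?thesis
  proof (cases "b \<le> c")
    case True
    then have "{a<..b} \<inter> {c<..d} = {}" by auto
    moreover have "expectation (\<lambda>\<omega>. (\<phi> \<omega> * \<psi> \<omega> * (B b \<omega> - B a \<omega>)) * (B d \<omega> - B c \<omega>)) = 0"
      by (rule increment_mult(2)[OF c0 cd Fm L2_integrable[OF incr]]) (use ab True in auto)
    ultimately show ?thesis by (simp add: mult_ac del: Int_greaterThanAtMost)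
  next
    case False
    \<comment> \<open>The overlap is the interval from \<open>c\<close> to \<open>e\<close>; the
      part from \<open>e\<close> to \<open>f\<close> belongs to whichever interval ends later.
      Naming them by \<open>min\<close> and \<open>max\<close> treats nested and staggered intervals
      together.\<close>
    define e f where "e = min b d" and "f = max b d"
    have e: "c \<le> e" "e \<le> f" using False cd by (auto simp: e_def f_def)
    have e0: "0 \<le> e" using c0 e by simp
    have "{a<..b} \<inter> {c<..d} = {c<..e}" using False ac by (auto simp: e_def)
    then have meas: "measure lborel ({a<..b} \<inter> {c<..d}) = e - c" using e by simp
    let ?P = "\<lambda>\<omega>. \<phi> \<omega> * \<psi> \<omega>"
    have split: "(\<phi> \<omega> * (B b \<omega> - B a \<omega>)) * (\<psi> \<omega> * (B d \<omega> - B c \<omega>)) =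
      (?P \<omega> * (B c \<omega> - B a \<omega>)) * (B d \<omega> - B c \<omega>) + ?P \<omega> * (B e \<omega> - B c \<omega>)\<^sup>2
      + (?P \<omega> * (B e \<omega> - B c \<omega>)) * (B f \<omega> - B e \<omega>)" for \<omega>
      by (cases "b \<le> d") (auto simp: e_def f_def power2_eq_square algebra_simps)
    note 1 = increment_mult(1,2)[OF c0 cd Fm[OF ab(1) ac order_refl order_refl] L2_integrable[OF incr[OF ab(1) ac]]]
    note 2 = increment_mult(3,4)[OF c0 e(1) _ L2_integrable[OF bounded_at_L2[OF p c0]]]
    note 3 = increment_mult(1,2)[OF e0 e(2) Fm[OF c0 e(1) order_refl e(1)] L2_integrable[OF incr[OF c0 e(1)]]]
    have pm: "?P \<in> borel_measurable (F c)" using p by (simp add: bounded_at_def)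
    show ?thesis unfolding split meas
      using 1 2[OF pm] 3 by simp
  qed
qed

lemma covariance:
  assumes "0 \<le> a" "a \<le> b" "0 \<le> c" "c \<le> d" and "bounded_at a \<phi>" "bounded_at c \<psi>"
  shows "expectation (\<lambda>\<omega>. (\<phi> \<omega> * (B b \<omega> - B a \<omega>)) * (\<psi> \<omega> * (B d \<omega> - B c \<omega>)))
    = expectation (\<lambda>\<omega>. \<phi> \<omega> * \<psi> \<omega>) * measure lborel ({a<..b} \<inter> {c<..d})"
proof (cases "a \<le> c")
  case True
  then show ?thesis using covariance_ordered assms by blast
next
  case False
  have "expectation (\<lambda>\<omega>. (\<psi> \<omega> * (B d \<omega> - B c \<omega>)) * (\<phi> \<omega> * (B b \<omega> - B a \<omega>)))
    = expectation (\<lambda>\<omega>. \<psi> \<omega> * \<phi> \<omega>) * measure lborel ({c<..d} \<inter> {a<..b})"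
    by (rule covariance_ordered) (use assms False in auto)
  then show ?thesis by (simp add: mult.commute Int_commute)
qed

text \<open>Both sides expand into the same double sum, weighted by the lengths of pairwise
  overlaps. The intervals may overlap freely: a difference of two elementary integrals over
  unrelated partitions is then one such sum, and no common refinement has to be built.\<close>

lemma isometry:
  fixes a b :: "'i \<Rightarrow> real" and \<phi> :: "'i \<Rightarrow> 'a \<Rightarrow> real"
  assumes I: "finite I" and ab: "\<And>i. i \<in> I \<Longrightarrow> 0 \<le> a i" "\<And>i. i \<in> I \<Longrightarrow> a i \<le> b i"
    and \<phi>: "\<And>i. i \<in> I \<Longrightarrow> bounded_at (a i) (\<phi> i)"
  shows "L2 M (\<lambda>\<omega>. \<Sum>i\<in>I. \<phi> i \<omega> * (B (b i) \<omega> - B (a i) \<omega>))"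
    and "(\<integral>\<^sup>+\<omega>. ennreal ((\<Sum>i\<in>I. \<phi> i \<omega> * (B (b i) \<omega> - B (a i) \<omega>))\<^sup>2) \<partial>M) =
      (\<integral>\<^sup>+\<omega>. (\<integral>\<^sup>+s. ennreal ((\<Sum>i\<in>I. \<phi> i \<omega> * indicator {a i<..b i} s)\<^sup>2) \<partial>lborel) \<partial>M)"
proof -
  let ?X = "\<lambda>i \<omega>. \<phi> i \<omega> * (B (b i) \<omega> - B (a i) \<omega>)"
  let ?m = "\<lambda>i j. measure lborel ({a i<..b i} \<inter> {a j<..b j})"
  have X: "L2 M (?X i)" if "i \<in> I" for i
    using that by (intro bounded_at_L2_mult[OF \<phi>] increment_moments ab)
  show L: "L2 M (\<lambda>\<omega>. \<Sum>i\<in>I. ?X i \<omega>)" by (rule L2_sum[OF X])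
  have "(\<integral>\<omega>. (\<Sum>i\<in>I. ?X i \<omega>)\<^sup>2 \<partial>M) = (\<integral>\<omega>. (\<Sum>i\<in>I. \<Sum>j\<in>I. ?X i \<omega> * ?X j \<omega>) \<partial>M)"
    by (simp add: power2_eq_square sum_product)
  also have "\<dots> = (\<Sum>i\<in>I. \<Sum>j\<in>I. expectation (\<lambda>\<omega>. ?X i \<omega> * ?X j \<omega>))"
    using X by (subst Bochner_Integration.integral_sum) (auto intro!: sum.cong Bochner_Integration.integral_sum Bochner_Integration.integrable_sum L2_mult_integrable)
  also have "\<dots> = (\<Sum>i\<in>I. \<Sum>j\<in>I. expectation (\<lambda>\<omega>. \<phi> i \<omega> * \<phi> j \<omega>) * ?m i j)"
    by (intro sum.cong refl covariance ab \<phi>)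
  also have "\<dots> = (\<integral>\<omega>. (\<Sum>i\<in>I. \<Sum>j\<in>I. \<phi> i \<omega> * \<phi> j \<omega> * ?m i j) \<partial>M)"
  proof -
    have "has_bochner_integral M (\<lambda>\<omega>. \<Sum>i\<in>I. \<Sum>j\<in>I. \<phi> i \<omega> * \<phi> j \<omega> * ?m i j)
      (\<Sum>i\<in>I. \<Sum>j\<in>I. expectation (\<lambda>\<omega>. \<phi> i \<omega> * \<phi> j \<omega>) * ?m i j)"
      using bounded_at_L2[OF \<phi> ab(1)]
      by (intro has_bochner_integral_sum has_bochner_integral_mult_left has_bochner_integral_integrable L2_mult_integrable)
    then show ?thesis by (rule has_bochner_integral_integral_eq[symmetric])
  qed
  finally have E: "(\<integral>\<omega>. (\<Sum>i\<in>I. ?X i \<omega>)\<^sup>2 \<partial>M) = (\<integral>\<omega>. (\<Sum>i\<in>I. \<Sum>j\<in>I. \<phi> i \<omega> * \<phi> j \<omega> * ?m i j) \<partial>M)" .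
  have has: "has_bochner_integral lborel (\<lambda>s. (\<Sum>i\<in>I. \<phi> i \<omega> * indicator {a i<..b i} s)\<^sup>2)
      (\<Sum>i\<in>I. \<Sum>j\<in>I. \<phi> i \<omega> * \<phi> j \<omega> * ?m i j)" for \<omega>
  proof -
    have sq: "(\<Sum>i\<in>I. \<phi> i \<omega> * indicator {a i<..b i} s)\<^sup>2 =
      (\<Sum>i\<in>I. \<Sum>j\<in>I. \<phi> i \<omega> * \<phi> j \<omega> * indicator ({a i<..b i} \<inter> {a j<..b j}) s)" for s :: real
      by (simp add: power2_eq_square sum_product indicator_inter_arith mult_ac del: Int_greaterThanAtMost)
    have "emeasure lborel ({a i<..b i} \<inter> {a j<..b j}) < \<infinity>" for i j
      by (rule le_less_trans[OF emeasure_mono[of _ "{a i..b i}"]]) (auto simp: emeasure_lborel_Icc_eq)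
    then show ?thesis unfolding sq
      by (intro has_bochner_integral_sum has_bochner_integral_mult_right has_bochner_integral_real_indicator) auto
  qed
  have inner: "(\<integral>\<^sup>+s. ennreal ((\<Sum>i\<in>I. \<phi> i \<omega> * indicator {a i<..b i} s)\<^sup>2) \<partial>lborel)
      = ennreal (\<Sum>i\<in>I. \<Sum>j\<in>I. \<phi> i \<omega> * \<phi> j \<omega> * ?m i j)" for \<omega>
    using has[of \<omega>] has_bochner_integral_integral_eq[OF has[of \<omega>]]
    by (subst nn_integral_eq_integral) (auto dest: integrable.intros)
  \<comment> \<open>The double sum is the time integral of a square, hence nonnegative; this is what
    allows its expectation to be read as a nonnegative integral.\<close>
  have nonneg: "0 \<le> (\<Sum>i\<in>I. \<Sum>j\<in>I. \<phi> i \<omega> * \<phi> j \<omega> * ?m i j)" for \<omega>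
    unfolding has_bochner_integral_integral_eq[OF has, symmetric] by simp
  have "integrable M (\<lambda>\<omega>. \<Sum>i\<in>I. \<Sum>j\<in>I. \<phi> i \<omega> * \<phi> j \<omega> * ?m i j)"
    using bounded_at_L2[OF \<phi> ab(1)] by (auto intro!: Bochner_Integration.integrable_sum L2_mult_integrable integrable_mult_left)
  then show "(\<integral>\<^sup>+\<omega>. ennreal ((\<Sum>i\<in>I. ?X i \<omega>)\<^sup>2) \<partial>M) =
      (\<integral>\<^sup>+\<omega>. (\<integral>\<^sup>+s. ennreal ((\<Sum>i\<in>I. \<phi> i \<omega> * indicator {a i<..b i} s)\<^sup>2) \<partial>lborel) \<partial>M)"
    unfolding inner L2_nn_integral[OF L] E using nonneg by (intro nn_integral_eq_integral[symmetric]) auto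
qed

end

section \<open>Martingale property and maximal inequality of the stochastic integral\<close>

lemma nn_integral_square_add3_le:
  fixes f g h :: "'a \<Rightarrow> real"
  assumes [measurable]: "f \<in> borel_measurable N" "g \<in> borel_measurable N" "h \<in> borel_measurable N"
  shows "(\<integral>\<^sup>+x. ennreal ((f x + g x + h x)\<^sup>2) \<partial>N) \<le>
    4 * (\<integral>\<^sup>+x. ennreal ((f x)\<^sup>2) \<partial>N) + 2 * (\<integral>\<^sup>+x. ennreal ((g x)\<^sup>2) \<partial>N) + 4 * (\<integral>\<^sup>+x. ennreal ((h x)\<^sup>2) \<partial>N)"
proof -
  have "(\<integral>\<^sup>+x. ennreal ((f x + g x + h x)\<^sup>2) \<partial>N) \<le>
    (\<integral>\<^sup>+x. 4 * ennreal ((f x)\<^sup>2) + 2 * ennreal ((g x)\<^sup>2) + 4 * ennreal ((h x)\<^sup>2) \<partial>N)"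
  proof (rule nn_integral_mono)
    fix x
    have "ennreal ((f x + g x + h x)\<^sup>2) \<le> ennreal (4 * (f x)\<^sup>2 + 2 * (g x)\<^sup>2 + 4 * (h x)\<^sup>2)"
      by (rule ennreal_leI[OF square_add3_le])
    also have "\<dots> = 4 * ennreal ((f x)\<^sup>2) + 2 * ennreal ((g x)\<^sup>2) + 4 * ennreal ((h x)\<^sup>2)"
      by (simp add: ennreal_plus ennreal_mult)
    finally show "ennreal ((f x + g x + h x)\<^sup>2) \<le> 4 * ennreal ((f x)\<^sup>2) + 2 * ennreal ((g x)\<^sup>2) + 4 * ennreal ((h x)\<^sup>2)" .
  qed
  also have "\<dots> = 4 * (\<integral>\<^sup>+x. ennreal ((f x)\<^sup>2) \<partial>N) + 2 * (\<integral>\<^sup>+x. ennreal ((g x)\<^sup>2) \<partial>N) + 4 * (\<integral>\<^sup>+x. ennreal ((h x)\<^sup>2) \<partial>N)"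
    by (simp add: nn_integral_add nn_integral_cmult)
  finally show ?thesis .
qed

text \<open>On the product space an integrand is a single function, so inequalities for sums of
  square integrable functions apply to it directly.\<close>

lemma nn_integral_iterated_square:
  fixes f :: "'a \<Rightarrow> real \<Rightarrow> real"
  assumes [measurable]: "(\<lambda>(\<omega>, s). f \<omega> s) \<in> borel_measurable (M \<Otimes>\<^sub>M lborel)"
  shows "(\<integral>\<^sup>+\<omega>. (\<integral>\<^sup>+s\<in>{0..T}. ennreal ((f \<omega> s)\<^sup>2) \<partial>lborel) \<partial>M) =
    (\<integral>\<^sup>+z. ennreal ((f (fst z) (snd z) * indicator {0..T} (snd z))\<^sup>2) \<partial>(M \<Otimes>\<^sub>M lborel))"
proof -
  have *: "(\<lambda>z. f (fst z) (snd z)) \<in> borel_measurable (M \<Otimes>\<^sub>M lborel)"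
    using assms by (simp add: case_prod_beta')
  have "(\<integral>\<^sup>+\<omega>. (\<integral>\<^sup>+s. ennreal ((f \<omega> s * indicator {0..T} s)\<^sup>2) \<partial>lborel) \<partial>M) =
    (\<integral>\<^sup>+z. ennreal ((f (fst z) (snd z) * indicator {0..T} (snd z))\<^sup>2) \<partial>(M \<Otimes>\<^sub>M lborel))"
    using * by (subst lborel.nn_integral_fst[symmetric]) simp_all
  moreover have "ennreal ((f \<omega> s)\<^sup>2) * indicator {0..T} s = ennreal ((f \<omega> s * indicator {0..T} s)\<^sup>2)" for \<omega> s
    by (auto simp: indicator_def)
  ultimately show ?thesis by simp
qed

section \<open>Elementary integrals: isometry and martingale property\<close>

context filtered_brownian_motion
begin

lemma elementaryD:
  assumes "elementary F k \<tau> \<phi>" "i < k"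
  shows "0 \<le> \<tau> i" "\<tau> i \<le> \<tau> (Suc i)" "bounded_at (\<tau> i) (\<phi> i)"
proof -
  have m: "mono_on {..k} \<tau>" "0 \<le> \<tau> 0" using assms by (auto simp: elementary_def)
  show 0: "0 \<le> \<tau> i" using m(2) mono_onD[OF m(1), of 0 i] assms(2) by auto
  show "\<tau> i \<le> \<tau> (Suc i)" using mono_onD[OF m(1), of i "Suc i"] assms(2) by auto
  show "bounded_at (\<tau> i) (\<phi> i)"
    using assms unfolding elementary_def bounded_at_def space_F[OF 0, symmetric] by auto
qed

lemma elem_isometry:
  assumes e: "elementary F k \<tau> \<phi>" and e': "elementary F k' \<tau>' \<phi>'" and T: "0 \<le> T"
  shows "L2 M (\<lambda>\<omega>. elem_integral B k \<tau> \<phi> T \<omega> - elem_integral B k' \<tau>' \<phi>' T \<omega>)"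
    and "(\<integral>\<^sup>+\<omega>. ennreal ((elem_integral B k \<tau> \<phi> T \<omega> - elem_integral B k' \<tau>' \<phi>' T \<omega>)\<^sup>2) \<partial>M) =
      (\<integral>\<^sup>+\<omega>. (\<integral>\<^sup>+s\<in>{0..T}. ennreal ((elem_process k \<tau> \<phi> s \<omega> - elem_process k' \<tau>' \<phi>' s \<omega>)\<^sup>2) \<partial>lborel) \<partial>M)"
proof -
  \<comment> \<open>The disjoint sum indexes the intervals of both partitions; the second family
    enters with the opposite sign.\<close>
  define I where "I = {..<k} <+> {..<k'}"
  define a b where "a = case_sum (\<lambda>i. min T (\<tau> i)) (\<lambda>i. min T (\<tau>' i))"
    and "b = case_sum (\<lambda>i. min T (\<tau> (Suc i))) (\<lambda>i. min T (\<tau>' (Suc i)))"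
  \<comment> \<open>Truncation at \<open>T\<close> pulls the start of a late interval back to
    \<open>T\<close>, where its height need not be known yet. The truncated increment is zero in
    that case, so the height may be replaced by 0.\<close>
  define \<psi> where "\<psi> = case_sum (\<lambda>i \<omega>. if \<tau> i < T then \<phi> i \<omega> else 0) (\<lambda>i \<omega>. if \<tau>' i < T then - \<phi>' i \<omega> else 0)"
  have I: "finite I" by (simp add: I_def)
  have a0: "0 \<le> a i" if "i \<in> I" for i
    using that T elementaryD(1)[OF e] elementaryD(1)[OF e'] by (auto simp: I_def a_def)
  have ab: "a i \<le> b i" if "i \<in> I" for i
    using that T elementaryD(2)[OF e] elementaryD(2)[OF e'] by (auto simp: I_def a_def b_def min_le_iff_disj)
  have zero: "bounded_at t (\<lambda>_. 0)" for t by (auto simp: bounded_at_def)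
  have neg: "bounded_at t (\<lambda>\<omega>. - f \<omega>)" if "bounded_at t f" for t f
    using that by (auto simp: bounded_at_def)
  have \<psi>: "bounded_at (a i) (\<psi> i)" if i: "i \<in> I" for i
  proof (cases i)
    case (Inl j)
    then have "j < k" using i by (auto simp: I_def)
    then show ?thesis using elementaryD[OF e, of j] zero by (cases "\<tau> j < T") (auto simp: Inl a_def \<psi>_def min_def)
  next
    case (Inr j)
    then have "j < k'" using i by (auto simp: I_def)
    then show ?thesis using elementaryD[OF e', of j] zero neg by (cases "\<tau>' j < T") (auto simp: Inr a_def \<psi>_def min_def)
  qed
  have term1: "(if p < T then x else 0) * (B (min T q) \<omega> - B (min T p) \<omega>) = x * (B (min T q) \<omega> - B (min T p) \<omega>)"
    if "p \<le> q" for p q x \<omega> using that by (auto simp: min_def)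
  have term2: "(if p < T then x else 0) * indicator {min T p<..min T q} s = x * indicator {p<..q} s * indicator {0..T} s"
    if "0 \<le> p" "p \<le> q" for p q s x :: real using that by (auto simp: indicator_def min_def)
  have sum1: "(\<Sum>i\<in>I. \<psi> i \<omega> * (B (b i) \<omega> - B (a i) \<omega>)) =
      elem_integral B k \<tau> \<phi> T \<omega> - elem_integral B k' \<tau>' \<phi>' T \<omega>" for \<omega>
  proof -
    have 1: "(\<Sum>i<k. (if \<tau> i < T then \<phi> i \<omega> else 0) * (B (min T (\<tau> (Suc i))) \<omega> - B (min T (\<tau> i)) \<omega>)) =
      (\<Sum>i<k. \<phi> i \<omega> * (B (min T (\<tau> (Suc i))) \<omega> - B (min T (\<tau> i)) \<omega>))"
      by (intro sum.cong refl term1 elementaryD(2)[OF e]) auto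
    have 2: "(\<Sum>i<k'. (if \<tau>' i < T then - \<phi>' i \<omega> else 0) * (B (min T (\<tau>' (Suc i))) \<omega> - B (min T (\<tau>' i)) \<omega>)) =
      (\<Sum>i<k'. (- \<phi>' i \<omega>) * (B (min T (\<tau>' (Suc i))) \<omega> - B (min T (\<tau>' i)) \<omega>))"
      by (intro sum.cong refl term1 elementaryD(2)[OF e']) auto
    have "(\<Sum>i\<in>I. \<psi> i \<omega> * (B (b i) \<omega> - B (a i) \<omega>)) =
      (\<Sum>i<k. \<phi> i \<omega> * (B (min T (\<tau> (Suc i))) \<omega> - B (min T (\<tau> i)) \<omega>)) +
      (\<Sum>i<k'. (- \<phi>' i \<omega>) * (B (min T (\<tau>' (Suc i))) \<omega> - B (min T (\<tau>' i)) \<omega>))"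
      by (simp only: I_def sum.Plus finite_lessThan o_def a_def b_def \<psi>_def sum.case 1 2)
    then show ?thesis by (simp add: elem_integral_def sum_negf)
  qed
  have sum2: "(\<Sum>i\<in>I. \<psi> i \<omega> * indicator {a i<..b i} s) =
      (elem_process k \<tau> \<phi> s \<omega> - elem_process k' \<tau>' \<phi>' s \<omega>) * indicator {0..T} s" for \<omega> s
  proof -
    have 1: "(\<Sum>i<k. (if \<tau> i < T then \<phi> i \<omega> else 0) * indicator {min T (\<tau> i)<..min T (\<tau> (Suc i))} s) =
      (\<Sum>i<k. \<phi> i \<omega> * indicator {\<tau> i<..\<tau> (Suc i)} s * indicator {0..T} s)"
      by (intro sum.cong refl term2 elementaryD(1,2)[OF e]) auto
    have 2: "(\<Sum>i<k'. (if \<tau>' i < T then - \<phi>' i \<omega> else 0) * indicator {min T (\<tau>' i)<..min T (\<tau>' (Suc i))} s) =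
      (\<Sum>i<k'. (- \<phi>' i \<omega>) * indicator {\<tau>' i<..\<tau>' (Suc i)} s * indicator {0..T} s)"
      by (intro sum.cong refl term2 elementaryD(1,2)[OF e']) auto
    have "(\<Sum>i\<in>I. \<psi> i \<omega> * indicator {a i<..b i} s) =
      (\<Sum>i<k. \<phi> i \<omega> * indicator {\<tau> i<..\<tau> (Suc i)} s * indicator {0..T} s) +
      (\<Sum>i<k'. (- \<phi>' i \<omega>) * indicator {\<tau>' i<..\<tau>' (Suc i)} s * indicator {0..T} s)"
      by (simp only: I_def sum.Plus finite_lessThan o_def a_def b_def \<psi>_def sum.case 1 2)
    then show ?thesis
      by (simp only: elem_process_def sum_distrib_right left_diff_distrib mult_minus_left sum_negf add_uminus_conv_diff)
  qed
  have sq: "ennreal (x\<^sup>2) * indicator {0..T} s = ennreal ((x * indicator {0..T} s)\<^sup>2)" for x s :: real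
    by (auto simp: indicator_def)
  show "L2 M (\<lambda>\<omega>. elem_integral B k \<tau> \<phi> T \<omega> - elem_integral B k' \<tau>' \<phi>' T \<omega>)"
    using isometry(1)[where a=a and b=b and \<phi>=\<psi> and I=I, OF I a0 ab \<psi>] unfolding sum1 .
  show "(\<integral>\<^sup>+\<omega>. ennreal ((elem_integral B k \<tau> \<phi> T \<omega> - elem_integral B k' \<tau>' \<phi>' T \<omega>)\<^sup>2) \<partial>M) =
      (\<integral>\<^sup>+\<omega>. (\<integral>\<^sup>+s\<in>{0..T}. ennreal ((elem_process k \<tau> \<phi> s \<omega> - elem_process k' \<tau>' \<phi>' s \<omega>)\<^sup>2) \<partial>lborel) \<partial>M)"
    using isometry(2)[where a=a and b=b and \<phi>=\<psi> and I=I, OF I a0 ab \<psi>] unfolding sum1 sum2 sq .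
qed

lemma elem_L2:
  assumes "elementary F k \<tau> \<phi>" "0 \<le> T" shows "L2 M (elem_integral B k \<tau> \<phi> T)"
proof -
  \<comment> \<open>The elementary process with no steps has integral 0, so square integrability of
    one integral is a special case of that of a difference.\<close>
  have "elementary F 0 (\<lambda>_. 0) (\<lambda>_ _. 0)" by (simp add: elementary_def mono_on_def)
  from elem_isometry(1)[OF assms(1) this assms(2)] show ?thesis by (simp add: elem_integral_def[abs_def])
qed

text \<open>The martingale property stated without conditional expectations: increments are
  orthogonal to bounded test functions known at the earlier time. In this form it passes to
  \<open>L2\<close> limits by a single inequality.\<close>

definition martingale_L2 :: "(real \<Rightarrow> 'a \<Rightarrow> real) \<Rightarrow> bool" where
  "martingale_L2 J \<longleftrightarrow> (\<forall>t\<ge>0. J t \<in> borel_measurable (F t) \<and> L2 M (J t)) \<and>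
    (\<forall>s t Z. 0 \<le> s \<longrightarrow> s \<le> t \<longrightarrow> bounded_at s Z \<longrightarrow> expectation (\<lambda>\<omega>. Z \<omega> * (J t \<omega> - J s \<omega>)) = 0)"

lemma martingale_L2_D:
  assumes "martingale_L2 J"
  shows "0 \<le> t \<Longrightarrow> J t \<in> borel_measurable (F t)" "0 \<le> t \<Longrightarrow> L2 M (J t)"
    "0 \<le> s \<Longrightarrow> s \<le> t \<Longrightarrow> bounded_at s Z \<Longrightarrow> expectation (\<lambda>\<omega>. Z \<omega> * (J t \<omega> - J s \<omega>)) = 0"
  using assms unfolding martingale_L2_def by blast+

text \<open>The part of the interval from \<open>p\<close> to \<open>q\<close> gained between times
  \<open>s\<close> and \<open>t\<close> is the one from \<open>max s p\<close> to
  \<open>min t q\<close>. At its start both \<open>Z\<close> and \<open>\<phi>\<close> are known, so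
  the increment over it is centred against their product; if there is no such part, both truncated
  increments agree.\<close>

lemma elem_term_martingale:
  assumes st: "0 \<le> s" "s \<le> t" and pq: "0 \<le> p" "p \<le> q" and \<phi>: "bounded_at p \<phi>" and Z: "bounded_at s Z"
  shows "has_bochner_integral M (\<lambda>\<omega>. Z \<omega> * (\<phi> \<omega> * (B (min t q) \<omega> - B (min t p) \<omega>) - \<phi> \<omega> * (B (min s q) \<omega> - B (min s p) \<omega>))) 0"
proof -
  consider "q \<le> s" | "t \<le> p" | "p < t" "s < q" by linarith
  then show ?thesis
  proof cases
    case 3
    define u v where "u = max s p" and "v = min t q"
    have uv: "0 \<le> u" "u \<le> v" using st pq 3 by (auto simp: u_def v_def)
    have bd: "bounded_at u (\<lambda>\<omega>. Z \<omega> * \<phi> \<omega>)"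
      by (intro bounded_at_mult bounded_at_mono[OF \<phi>] bounded_at_mono[OF Z]) (use st pq in \<open>auto simp: u_def\<close>)
    have meas: "(\<lambda>\<omega>. Z \<omega> * \<phi> \<omega>) \<in> borel_measurable (F u)" using bd unfolding bounded_at_def by (rule conjunct1)
    have "has_bochner_integral M (\<lambda>\<omega>. (Z \<omega> * \<phi> \<omega>) * (B v \<omega> - B u \<omega>)) 0"
      using increment_mult(1,2)[OF uv meas L2_integrable[OF bounded_at_L2[OF bd uv(1)]]] by (simp add: has_bochner_integral_iff)
    moreover have "(Z \<omega> * \<phi> \<omega>) * (B v \<omega> - B u \<omega>) =
      Z \<omega> * (\<phi> \<omega> * (B (min t q) \<omega> - B (min t p) \<omega>) - \<phi> \<omega> * (B (min s q) \<omega> - B (min s p) \<omega>))" for \<omega>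
    proof (cases "p \<le> s")
      case True
      then have "u = s" "min t p = p" "min s p = p" "min s q = s" "min t q = v" using 3 st by (auto simp: u_def v_def)
      then show ?thesis by (simp add: algebra_simps)
    next
      case False
      then have "u = p" "min t p = p" "min s p = s" "min s q = s" "min t q = v" using 3 st by (auto simp: u_def v_def)
      then show ?thesis by (simp add: algebra_simps)
    qed
    ultimately show ?thesis by simp
  next
    case 1
    then have "min t q = q" "min s q = q" "min t p = p" "min s p = p" using st pq by auto
    then show ?thesis by (simp add: has_bochner_integral_zero)
  next
    case 2
    then have "min t q = t" "min s q = s" "min t p = t" "min s p = s" using st pq by auto
    then show ?thesis by (simp add: has_bochner_integral_zero)
  qed
qed

lemma elem_martingale:
  assumes e: "elementary F k \<tau> \<phi>" and st: "0 \<le> s" "s \<le> t" and Z: "bounded_at s Z"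
  shows "expectation (\<lambda>\<omega>. Z \<omega> * (elem_integral B k \<tau> \<phi> t \<omega> - elem_integral B k \<tau> \<phi> s \<omega>)) = 0"
proof -
  have "has_bochner_integral M (\<lambda>\<omega>. \<Sum>i<k. Z \<omega> * (\<phi> i \<omega> * (B (min t (\<tau> (Suc i))) \<omega> - B (min t (\<tau> i)) \<omega>)
      - \<phi> i \<omega> * (B (min s (\<tau> (Suc i))) \<omega> - B (min s (\<tau> i)) \<omega>))) (\<Sum>i<k. 0)"
    by (intro has_bochner_integral_sum elem_term_martingale st Z elementaryD[OF e]) auto
  moreover have "(\<Sum>i<k. Z \<omega> * (\<phi> i \<omega> * (B (min t (\<tau> (Suc i))) \<omega> - B (min t (\<tau> i)) \<omega>)
      - \<phi> i \<omega> * (B (min s (\<tau> (Suc i))) \<omega> - B (min s (\<tau> i)) \<omega>))) =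
      Z \<omega> * (elem_integral B k \<tau> \<phi> t \<omega> - elem_integral B k \<tau> \<phi> s \<omega>)" for \<omega>
    by (simp add: elem_integral_def sum_distrib_left sum_subtractf right_diff_distrib)
  ultimately show ?thesis by (auto dest: has_bochner_integral_integral_eq)
qed

section \<open>Passage from elementary to general integrands\<close>

lemma bounded_L2_limit:
  assumes Z: "bounded_at s Z" "0 \<le> s" and f: "\<And>j::nat. L2 M (f j)" and g: "L2 M g"
    and lim: "(\<lambda>j. \<integral>\<^sup>+\<omega>. ennreal ((f j \<omega> - g \<omega>)\<^sup>2) \<partial>M) \<longlonglongrightarrow> 0"
  shows "(\<lambda>j. expectation (\<lambda>\<omega>. Z \<omega> * f j \<omega>)) \<longlonglongrightarrow> expectation (\<lambda>\<omega>. Z \<omega> * g \<omega>)"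
proof -
  obtain C where C: "\<And>\<omega>. \<omega> \<in> space M \<Longrightarrow> \<bar>Z \<omega>\<bar> \<le> C" using Z unfolding bounded_at_def by blast
  have d: "L2 M (\<lambda>\<omega>. f j \<omega> - g \<omega>)" for j by (rule L2_diff[OF f g])
  have le: "(expectation (\<lambda>\<omega>. Z \<omega> * f j \<omega>) - expectation (\<lambda>\<omega>. Z \<omega> * g \<omega>))\<^sup>2 \<le> C\<^sup>2 * expectation (\<lambda>\<omega>. (f j \<omega> - g \<omega>)\<^sup>2)" for j
  proof -
    have "expectation (\<lambda>\<omega>. Z \<omega> * f j \<omega>) - expectation (\<lambda>\<omega>. Z \<omega> * g \<omega>) = expectation (\<lambda>\<omega>. Z \<omega> * (f j \<omega> - g \<omega>))"
      using L2_mult_integrable[OF bounded_at_L2[OF Z] f[of j]] L2_mult_integrable[OF bounded_at_L2[OF Z] g]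
      by (simp add: right_diff_distrib)
    also have "\<dots>\<^sup>2 \<le> expectation (\<lambda>\<omega>. (Z \<omega> * (f j \<omega> - g \<omega>))\<^sup>2)"
      by (rule square_expectation_le[OF bounded_at_L2_mult[OF Z d]])
    also have "\<dots> \<le> expectation (\<lambda>\<omega>. C\<^sup>2 * (f j \<omega> - g \<omega>)\<^sup>2)"
    proof (rule integral_mono)
      show "integrable M (\<lambda>\<omega>. (Z \<omega> * (f j \<omega> - g \<omega>))\<^sup>2)"
        by (rule L2_square_integrable[OF bounded_at_L2_mult[OF Z d]])
      show "integrable M (\<lambda>\<omega>. C\<^sup>2 * (f j \<omega> - g \<omega>)\<^sup>2)" using L2_square_integrable[OF d] by simp
      fix \<omega> assume "\<omega> \<in> space M"
      then have "(Z \<omega>)\<^sup>2 \<le> C\<^sup>2" using C[of \<omega>] by (metis abs_ge_zero power2_abs power_mono)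
      then show "(Z \<omega> * (f j \<omega> - g \<omega>))\<^sup>2 \<le> C\<^sup>2 * (f j \<omega> - g \<omega>)\<^sup>2"
        by (simp add: power_mult_distrib mult_right_mono)
    qed
    finally show ?thesis by simp
  qed
  have "(\<lambda>j. ennreal (expectation (\<lambda>\<omega>. (f j \<omega> - g \<omega>)\<^sup>2))) \<longlonglongrightarrow> ennreal 0"
    using lim by (simp add: L2_nn_integral[OF d])
  then have "(\<lambda>j. expectation (\<lambda>\<omega>. (f j \<omega> - g \<omega>)\<^sup>2)) \<longlonglongrightarrow> 0"
    by (subst (asm) tendsto_ennreal_iff) (auto intro: always_eventually)
  then have y: "(\<lambda>j. C\<^sup>2 * expectation (\<lambda>\<omega>. (f j \<omega> - g \<omega>)\<^sup>2)) \<longlonglongrightarrow> 0"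
    by (rule tendsto_mult_right_zero)
  define x where "x j = expectation (\<lambda>\<omega>. Z \<omega> * f j \<omega>) - expectation (\<lambda>\<omega>. Z \<omega> * g \<omega>)" for j
  have "(\<lambda>j. (x j)\<^sup>2) \<longlonglongrightarrow> 0"
  proof (rule tendsto_sandwich[OF _ _ tendsto_const y])
    show "\<forall>\<^sub>F j in sequentially. 0 \<le> (x j)\<^sup>2" by simp
    show "\<forall>\<^sub>F j in sequentially. (x j)\<^sup>2 \<le> C\<^sup>2 * expectation (\<lambda>\<omega>. (f j \<omega> - g \<omega>)\<^sup>2)"
      unfolding x_def by (rule always_eventually, rule allI, rule le)
  qed
  then have "(\<lambda>j. sqrt ((x j)\<^sup>2)) \<longlonglongrightarrow> sqrt 0" by (rule tendsto_real_sqrt)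
  then have "x \<longlonglongrightarrow> 0" by (simp add: tendsto_rabs_zero_iff)
  then show ?thesis unfolding x_def by (rule LIM_zero_cancel)
qed

lemma ito_integralD:
  assumes "ito_integral M F B H I"
  obtains k \<tau> \<phi> where "\<And>j. elementary F (k j) (\<tau> j) (\<phi> j)"
    "\<And>T. 0 \<le> T \<Longrightarrow> (\<lambda>j::nat. \<integral>\<^sup>+\<omega>. (\<integral>\<^sup>+s\<in>{0..T}.
              ennreal ((elem_process (k j) (\<tau> j) (\<phi> j) s \<omega> - H s \<omega>)\<^sup>2) \<partial>lborel) \<partial>M) \<longlonglongrightarrow> 0"
    "\<And>T. 0 \<le> T \<Longrightarrow> (\<lambda>j::nat. \<integral>\<^sup>+\<omega>. ennreal ((elem_integral B (k j) (\<tau> j) (\<phi> j) T \<omega> - I T \<omega>)\<^sup>2) \<partial>M) \<longlonglongrightarrow> 0"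
proof -
  from assms obtain k \<tau> \<phi> where *: "\<forall>j. elementary F (k j) (\<tau> j) (\<phi> j)"
    "\<forall>T\<ge>0. (\<lambda>j::nat. \<integral>\<^sup>+\<omega>. (\<integral>\<^sup>+s\<in>{0..T}.
              ennreal ((elem_process (k j) (\<tau> j) (\<phi> j) s \<omega> - H s \<omega>)\<^sup>2) \<partial>lborel) \<partial>M) \<longlonglongrightarrow> 0 \<and>
          (\<lambda>j::nat. \<integral>\<^sup>+\<omega>. ennreal ((elem_integral B (k j) (\<tau> j) (\<phi> j) T \<omega> - I T \<omega>)\<^sup>2) \<partial>M) \<longlonglongrightarrow> 0"
    unfolding ito_integral_def by (elim conjE exE) (rule that)
  show thesis by (rule that[of k \<tau> \<phi>]) (simp_all only: *)
qed

lemma ito_integral_progressive: "ito_integral M F B H I \<Longrightarrow> progressive F H"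
  unfolding ito_integral_def by (elim conjE)

lemma ito_integral_adapted: "ito_integral M F B H I \<Longrightarrow> adapted F I"
  unfolding ito_integral_def by (elim conjE)

lemma ito_integral_continuous: "ito_integral M F B H I \<Longrightarrow> AE \<omega> in M. continuous_on {0..} (\<lambda>t. I t \<omega>)"
  unfolding ito_integral_def by (elim conjE)

text \<open>Some elementary integral lies within mean square distance 1 of \<open>I t\<close>, which
  gives square integrability. Orthogonality to a bounded test function holds for every elementary
  integral and survives the limit.\<close>

lemma ito_integral_martingale:
  assumes ito: "ito_integral M F B H I" shows "martingale_L2 I"
proof -
  obtain k \<tau> \<phi> where e: "\<And>j. elementary F (k j) (\<tau> j) (\<phi> j)"
    and lim: "\<And>T. 0 \<le> T \<Longrightarrow> (\<lambda>j::nat. \<integral>\<^sup>+\<omega>. ennreal ((elem_integral B (k j) (\<tau> j) (\<phi> j) T \<omega> - I T \<omega>)\<^sup>2) \<partial>M) \<longlonglongrightarrow> 0"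
    by (rule ito_integralD[OF ito]) blast
  let ?N = "\<lambda>j. elem_integral B (k j) (\<tau> j) (\<phi> j)"
  have IF: "I t \<in> borel_measurable (F t)" if "0 \<le> t" for t
    using ito_integral_adapted[OF ito] that by (simp add: adapted_def)
  have N: "L2 M (?N j t)" if "0 \<le> t" for j t using elem_L2[OF e that] .
  have L: "L2 M (I t)" if t: "0 \<le> t" for t
  proof -
    have m: "I t \<in> borel_measurable M" using F_measurable_M[OF t IF[OF t]] .
    have "\<forall>\<^sub>F j in sequentially. (\<integral>\<^sup>+\<omega>. ennreal ((?N j t \<omega> - I t \<omega>)\<^sup>2) \<partial>M) < 1"
      by (rule order_tendstoD(2)[OF lim[OF t]]) simp
    then obtain j where j: "(\<integral>\<^sup>+\<omega>. ennreal ((?N j t \<omega> - I t \<omega>)\<^sup>2) \<partial>M) < 1"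
      by (auto dest: eventually_happens)
    then have "(\<integral>\<^sup>+\<omega>. ennreal ((?N j t \<omega> - I t \<omega>)\<^sup>2) \<partial>M) < \<infinity>"
      by (metis ennreal_one_less_top infinity_ennreal_def order_less_trans)
    then have "L2 M (\<lambda>\<omega>. ?N j t \<omega> - I t \<omega>)"
      using m L2_measurable[OF N[OF t]] by (subst L2_iff_nn_integral) auto
    from L2_diff[OF N[OF t, of j] this] show ?thesis by simp
  qed
  have "expectation (\<lambda>\<omega>. Z \<omega> * (I t \<omega> - I s \<omega>)) = 0" if st: "0 \<le> s" "s \<le> t" and Z: "bounded_at s Z" for s t Z
  proof -
    have t: "0 \<le> t" using st by simp
    have i: "integrable M (\<lambda>\<omega>. Z \<omega> * f \<omega>)" if "L2 M f" for f
      by (rule L2_mult_integrable[OF bounded_at_L2[OF Z st(1)] that])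
    have "(\<lambda>j. expectation (\<lambda>\<omega>. Z \<omega> * ?N j t \<omega>) - expectation (\<lambda>\<omega>. Z \<omega> * ?N j s \<omega>)) \<longlonglongrightarrow>
      expectation (\<lambda>\<omega>. Z \<omega> * I t \<omega>) - expectation (\<lambda>\<omega>. Z \<omega> * I s \<omega>)"
      by (intro tendsto_diff bounded_L2_limit[OF Z st(1)] N L lim st t)
    moreover have "expectation (\<lambda>\<omega>. Z \<omega> * ?N j t \<omega>) - expectation (\<lambda>\<omega>. Z \<omega> * ?N j s \<omega>) = 0" for j
      using elem_martingale[OF e st Z, of j] i[OF N[OF t, of j]] i[OF N[OF st(1), of j]]
      by (simp add: right_diff_distrib)
    ultimately have "expectation (\<lambda>\<omega>. Z \<omega> * I t \<omega>) - expectation (\<lambda>\<omega>. Z \<omega> * I s \<omega>) = 0"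
      by (simp add: LIMSEQ_const_iff)
    then show ?thesis using i[OF L[OF t]] i[OF L[OF st(1)]] by (simp add: right_diff_distrib)
  qed
  then show ?thesis using IF L by (auto simp: martingale_L2_def)
qed

lemma martingale_L2_diff:
  assumes "martingale_L2 I" "martingale_L2 J" shows "martingale_L2 (\<lambda>t \<omega>. I t \<omega> - J t \<omega>)"
proof -
  note I = martingale_L2_D[OF assms(1)] and J = martingale_L2_D[OF assms(2)]
  have "expectation (\<lambda>\<omega>. Z \<omega> * ((I t \<omega> - J t \<omega>) - (I s \<omega> - J s \<omega>))) = 0"
    if st: "0 \<le> s" "s \<le> t" and Z: "bounded_at s Z" for s t Z
  proof -
    have t: "0 \<le> t" using st by simp
    have i: "integrable M (\<lambda>\<omega>. Z \<omega> * (I t \<omega> - I s \<omega>))" "integrable M (\<lambda>\<omega>. Z \<omega> * (J t \<omega> - J s \<omega>))"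
      by (intro L2_mult_integrable bounded_at_L2[OF Z st(1)] L2_diff I J st t)+
    have "Z \<omega> * ((I t \<omega> - J t \<omega>) - (I s \<omega> - J s \<omega>)) = Z \<omega> * (I t \<omega> - I s \<omega>) - Z \<omega> * (J t \<omega> - J s \<omega>)" for \<omega>
      by (simp add: algebra_simps)
    then show ?thesis using I(3)[OF st Z] J(3)[OF st Z] i by simp
  qed
  then show ?thesis using I(1,2) J(1,2) by (auto simp: martingale_L2_def intro: L2_diff)
qed

text \<open>Truncate \<open>Z\<close> at levels \<open>- k\<close> and \<open>k\<close> and let
  \<open>k\<close> grow, with the product of \<open>Z\<close> and the increment as integrable
  majorant. The weights in the maximal inequality are square integrable but not bounded, which is
  why the test functions have to be enlarged.\<close>

lemma martingale_L2_orthogonal: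
  assumes J: "martingale_L2 J" and st: "0 \<le> s" "s \<le> t" and Z: "Z \<in> borel_measurable (F s)" "L2 M Z"
  shows "expectation (\<lambda>\<omega>. Z \<omega> * (J t \<omega> - J s \<omega>)) = 0"
proof -
  let ?D = "\<lambda>\<omega>. J t \<omega> - J s \<omega>"
  define Zk where "Zk k \<omega> = max (- real k) (min (real k) (Z \<omega>))" for k \<omega>
  have D: "L2 M ?D" using martingale_L2_D(2)[OF J] st by (intro L2_diff) auto
  have Zk: "bounded_at s (Zk k)" for k
    unfolding bounded_at_def Zk_def using Z(1) by (auto intro!: exI[of _ "real k"])
  have "(\<lambda>k. expectation (\<lambda>\<omega>. Zk k \<omega> * ?D \<omega>)) \<longlonglongrightarrow> expectation (\<lambda>\<omega>. Z \<omega> * ?D \<omega>)"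
  proof (rule integral_dominated_convergence)
    show "integrable M (\<lambda>\<omega>. \<bar>Z \<omega> * ?D \<omega>\<bar>)" using L2_mult_integrable[OF Z(2) D] by simp
    show "(\<lambda>\<omega>. Z \<omega> * ?D \<omega>) \<in> borel_measurable M" using L2_measurable[OF Z(2)] L2_measurable[OF D] by auto
    show "(\<lambda>\<omega>. Zk k \<omega> * ?D \<omega>) \<in> borel_measurable M" for k
      using bounded_atD[OF Zk st(1)] L2_measurable[OF D] by auto
    show "AE \<omega> in M. (\<lambda>k. Zk k \<omega> * ?D \<omega>) \<longlonglongrightarrow> Z \<omega> * ?D \<omega>"
    proof (rule AE_I2, intro tendsto_mult tendsto_const)
      fix \<omega>
      obtain k0 :: nat where "\<bar>Z \<omega>\<bar> \<le> real k0" using real_arch_simple by blast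
      then have "\<forall>\<^sub>F k in sequentially. Zk k \<omega> = Z \<omega>"
        unfolding eventually_sequentially by (intro exI[of _ k0]) (auto simp: Zk_def)
      then show "(\<lambda>k. Zk k \<omega>) \<longlonglongrightarrow> Z \<omega>" by (rule tendsto_eventually)
    qed
    show "AE \<omega> in M. norm (Zk k \<omega> * ?D \<omega>) \<le> \<bar>Z \<omega> * ?D \<omega>\<bar>" for k
      unfolding Zk_def by (intro AE_I2) (auto simp: abs_mult intro!: mult_right_mono)
  qed
  then show ?thesis by (simp add: martingale_L2_D(3)[OF J st Zk] LIMSEQ_const_iff)
qed

section \<open>Doob's inequality\<close>

lemma doob_L2_discrete:
  assumes J: "martingale_L2 J" and u: "0 \<le> u 0" "mono u"
  shows "L2 M (\<lambda>\<omega>. running_max (\<lambda>i. J (u i) \<omega>) n)"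
    and "expectation (\<lambda>\<omega>. (running_max (\<lambda>i. J (u i) \<omega>) n)\<^sup>2) \<le> 4 * expectation (\<lambda>\<omega>. (J (u n) \<omega>)\<^sup>2)"
proof -
  have u0: "0 \<le> u i" for i using u monoD[OF u(2), of 0 i] by linarith
  have ui: "u i \<le> u j" if "i \<le> j" for i j using monoD[OF u(2) that] .
  let ?S = "\<lambda>n \<omega>. running_max (\<lambda>i. J (u i) \<omega>) n"
  have JF: "J (u i) \<in> borel_measurable (F (u i))" for i using martingale_L2_D(1)[OF J u0] .
  have JL: "L2 M (J (u i))" for i using martingale_L2_D(2)[OF J u0] .
  have SF: "?S i \<in> borel_measurable (F (u i))" for i
  proof (induction i)
    case (Suc i)
    have [measurable]: "?S i \<in> borel_measurable (F (u (Suc i)))" "J (u (Suc i)) \<in> borel_measurable (F (u (Suc i)))"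
      by (rule F_measurable_mono[OF u0 ui Suc], simp) (rule JF)
    show ?case unfolding running_max.simps by measurable
  next
    case 0
    show ?case unfolding running_max.simps using JF[of 0] by measurable
  qed
  have SL: "L2 M (?S i)" for i
    unfolding L2_def
  proof (intro conjI)
    show m: "?S i \<in> borel_measurable M" using F_measurable_M[OF u0 SF] .
    show "integrable M (\<lambda>\<omega>. (?S i \<omega>)\<^sup>2)"
    proof (rule Bochner_Integration.integrable_bound)
      show "integrable M (\<lambda>\<omega>. \<Sum>j\<le>i. (J (u j) \<omega>)\<^sup>2)" using L2_square_integrable[OF JL] by simp
      show "AE \<omega> in M. norm ((?S i \<omega>)\<^sup>2) \<le> norm (\<Sum>j\<le>i. (J (u j) \<omega>)\<^sup>2)"
        by (intro AE_I2) (auto intro: order_trans[OF running_max_square_le_sum])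
    qed (use m in auto)
  qed
  then show "L2 M (?S n)" .
  \<comment> \<open>The weight from the pathwise inequality. It is known at time \<open>u i\<close>,
    so the expectation of its product with the next increment of \<open>J\<close> vanishes.\<close>
  let ?Z = "\<lambda>i \<omega>. ?S i \<omega> * sgn (J (u i) \<omega>)"
  have ZF: "?Z i \<in> borel_measurable (F (u i))" for i using SF JF by auto
  have ZL: "L2 M (?Z i)" for i
  proof (rule L2_bound[OF SL[of i]])
    show "?Z i \<in> borel_measurable M" using F_measurable_M[OF u0 ZF] .
    show "(?Z i \<omega>)\<^sup>2 \<le> (?S i \<omega>)\<^sup>2" for \<omega> by (auto simp: sgn_if power_mult_distrib)
  qed
  have D: "L2 M (\<lambda>\<omega>. J (u (Suc i)) \<omega> - J (u i) \<omega>)" for i by (intro L2_diff JL)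
  have i: "integrable M (\<lambda>\<omega>. ?Z i \<omega> * (J (u (Suc i)) \<omega> - J (u i) \<omega>))" for i
    by (rule L2_mult_integrable[OF ZL D])
  have "expectation (\<lambda>\<omega>. (?S n \<omega>)\<^sup>2) \<le> expectation (\<lambda>\<omega>. 4 * (J (u n) \<omega>)\<^sup>2 - 4 * (\<Sum>i<n. ?Z i \<omega> * (J (u (Suc i)) \<omega> - J (u i) \<omega>)))"
    using L2_square_integrable[OF SL] L2_square_integrable[OF JL] i
    by (intro integral_mono running_max_square_le) auto
  also have "\<dots> = 4 * expectation (\<lambda>\<omega>. (J (u n) \<omega>)\<^sup>2)"
    using L2_square_integrable[OF JL] i martingale_L2_orthogonal[OF J u0 ui ZF ZL] by simp
  finally show "expectation (\<lambda>\<omega>. (?S n \<omega>)\<^sup>2) \<le> 4 * expectation (\<lambda>\<omega>. (J (u n) \<omega>)\<^sup>2)" .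
qed

text \<open>Paths are continuous only almost surely, so a measurable majorant \<open>Q\<close>
  stands in for the supremum over all times: the supremum over dyadic times, reached by the discrete
  inequality and monotone convergence.\<close>

lemma doob_L2:
  assumes J: "martingale_L2 J" and cont: "AE \<omega> in M. continuous_on {0..} (\<lambda>t. J t \<omega>)" and T: "0 \<le> T"
  obtains Q where "Q \<in> borel_measurable M" "AE \<omega> in M. \<forall>t\<in>{0..T}. ennreal ((J t \<omega>)\<^sup>2) \<le> Q \<omega>"
    "(\<integral>\<^sup>+\<omega>. Q \<omega> \<partial>M) \<le> 4 * (\<integral>\<^sup>+\<omega>. ennreal ((J T \<omega>)\<^sup>2) \<partial>M)"
proof -
  define g where "g k \<omega> = (SUP i\<in>{..(2::nat)^k}. ennreal ((J (T * real i / 2^k) \<omega>)\<^sup>2))" for k \<omega>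
  have pos: "0 \<le> T * real i / 2^k" for i k using T by simp
  have Jm[measurable]: "J (T * real i / 2^k) \<in> borel_measurable M" for i k
    using L2_measurable[OF martingale_L2_D(2)[OF J pos]] .
  have gm[measurable]: "g k \<in> borel_measurable M" for k unfolding g_def by measurable
  \<comment> \<open>The grids are nested: index \<open>i\<close> at level \<open>k\<close> is index
    \<open>2 * i\<close> at level \<open>Suc k\<close>.\<close>
  have inc: "incseq g"
  proof (rule incseq_SucI, rule le_funI)
    fix k \<omega>
    show "g k \<omega> \<le> g (Suc k) \<omega>" unfolding g_def
    proof (rule SUP_least)
      fix i :: nat assume "i \<in> {..2^k}"
      then show "ennreal ((J (T * real i / 2^k) \<omega>)\<^sup>2) \<le> (SUP i\<in>{..2^Suc k}. ennreal ((J (T * real i / 2^Suc k) \<omega>)\<^sup>2))"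
        by (intro SUP_upper2[of "2*i"]) auto
    qed
  qed
  have AE: "AE \<omega> in M. \<forall>t\<in>{0..T}. ennreal ((J t \<omega>)\<^sup>2) \<le> (SUP k. g k \<omega>)"
    using cont
  proof eventually_elim
    case (elim \<omega>)
    have c: "continuous_on {0..T} (\<lambda>t. (J t \<omega>)\<^sup>2)"
      by (intro continuous_intros continuous_on_subset[OF elim]) auto
    show ?case unfolding g_def SUP_dyadic[OF T c, symmetric] by (auto intro: SUP_upper)
  qed
  have "(\<integral>\<^sup>+\<omega>. (SUP k. g k \<omega>) \<partial>M) = (SUP k. \<integral>\<^sup>+\<omega>. g k \<omega> \<partial>M)"
    by (rule nn_integral_monotone_convergence_SUP[OF inc]) auto
  also have "\<dots> \<le> 4 * (\<integral>\<^sup>+\<omega>. ennreal ((J T \<omega>)\<^sup>2) \<partial>M)"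
  proof (rule SUP_least)
    fix k
    define u where "u i = T * real i / 2^k" for i
    have u: "0 \<le> u 0" "mono u" using T by (auto simp: u_def mono_def divide_right_mono mult_left_mono)
    have uT: "u (2^k) = T" by (simp add: u_def)
    have "(\<integral>\<^sup>+\<omega>. g k \<omega> \<partial>M) \<le> (\<integral>\<^sup>+\<omega>. ennreal ((running_max (\<lambda>i. J (u i) \<omega>) (2^k))\<^sup>2) \<partial>M)"
    proof (rule nn_integral_mono)
      fix \<omega>
      show "g k \<omega> \<le> ennreal ((running_max (\<lambda>i. J (u i) \<omega>) (2^k))\<^sup>2)"
        unfolding g_def u_def[symmetric]
      proof (intro SUP_least ennreal_leI)
        fix i :: nat assume "i \<in> {..2^k}"
        then have "\<bar>J (u i) \<omega>\<bar> \<le> running_max (\<lambda>i. J (u i) \<omega>) (2^k)" by (intro running_max_ge[of i _ "\<lambda>i. J (u i) \<omega>"]) simp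
        then show "(J (u i) \<omega>)\<^sup>2 \<le> (running_max (\<lambda>i. J (u i) \<omega>) (2^k))\<^sup>2"
          by (metis abs_ge_zero power2_abs power_mono)
      qed
    qed
    also have "\<dots> = ennreal (expectation (\<lambda>\<omega>. (running_max (\<lambda>i. J (u i) \<omega>) (2^k))\<^sup>2))"
      by (rule L2_nn_integral[OF doob_L2_discrete(1)[OF J u]])
    also have "\<dots> \<le> ennreal (4 * expectation (\<lambda>\<omega>. (J T \<omega>)\<^sup>2))"
      using doob_L2_discrete(2)[OF J u, of "2^k"] unfolding uT by (rule ennreal_leI)
    also have "\<dots> = 4 * (\<integral>\<^sup>+\<omega>. ennreal ((J T \<omega>)\<^sup>2) \<partial>M)"
      using L2_nn_integral[OF martingale_L2_D(2)[OF J T]] by (simp add: ennreal_mult)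
    finally show "(\<integral>\<^sup>+\<omega>. g k \<omega> \<partial>M) \<le> 4 * (\<integral>\<^sup>+\<omega>. ennreal ((J T \<omega>)\<^sup>2) \<partial>M)" .
  qed
  finally show thesis using AE by (intro that[of "\<lambda>\<omega>. SUP k. g k \<omega>"]) auto
qed

section \<open>Comparison of two stochastic integrals\<close>

text \<open>Progressive measurability speaks about the strip up to \<open>T\<close> only. Clamping
  the time to \<open>{0..T}\<close> extends the process to the whole line without changing it on the
  strip.\<close>

lemma progressive_measurable:
  assumes "progressive F H" "0 \<le> T"
  shows "(\<lambda>(\<omega>, s). H (max 0 (min T s)) \<omega>) \<in> borel_measurable (M \<Otimes>\<^sub>M lborel)"
proof -
  have 1: "(\<lambda>s. max 0 (min T s)) \<in> lborel \<rightarrow>\<^sub>M restrict_space borel {0..T}"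
    using assms(2) by (intro measurable_restrict_space2) auto
  have 2: "(\<lambda>\<omega>. \<omega>) \<in> M \<rightarrow>\<^sub>M F T"
    using measurable_from_subalg[OF subalgebra_F[OF assms(2)] measurable_ident] by (simp add: id_def)
  have 3: "(\<lambda>(s, \<omega>). H s \<omega>) \<in> borel_measurable (restrict_space borel {0..T} \<Otimes>\<^sub>M F T)"
    using assms by (auto simp: progressive_def)
  have "(\<lambda>z. (max 0 (min T (snd z)), fst z)) \<in> M \<Otimes>\<^sub>M lborel \<rightarrow>\<^sub>M restrict_space borel {0..T} \<Otimes>\<^sub>M F T"
    by (intro measurable_Pair measurable_compose[OF measurable_snd 1] measurable_compose[OF measurable_fst 2])
  from measurable_compose[OF this 3] show ?thesis by (simp add: case_prod_beta')
qed

lemma elem_process_measurable: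
  assumes "elementary F k \<tau> \<phi>"
  shows "(\<lambda>(\<omega>, s). elem_process k \<tau> \<phi> s \<omega>) \<in> borel_measurable (M \<Otimes>\<^sub>M lborel)"
proof -
  have "(\<lambda>z. \<phi> i (fst z)) \<in> borel_measurable (M \<Otimes>\<^sub>M lborel)" if "i < k" for i
    using bounded_atD[OF elementaryD(3,1)[OF assms that]] by (rule measurable_compose[OF measurable_fst])
  then show ?thesis unfolding elem_process_def case_prod_beta'
    by (intro borel_measurable_sum borel_measurable_times) auto
qed

text \<open>The difference is split through the elementary integrals, whose distance the isometry
  turns into a distance of elementary processes; that one is split again through \<open>H\<close>
  and \<open>H'\<close>. The approximation errors vanish, and each split costs a factor 2, hence the
  4 in place of the exact isometry.\<close>

lemma ito_difference_bound:
  assumes ito: "ito_integral M F B H I" and ito': "ito_integral M F B H' I'" and T: "0 \<le> T"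
  shows "(\<integral>\<^sup>+\<omega>. ennreal ((I T \<omega> - I' T \<omega>)\<^sup>2) \<partial>M) \<le>
    4 * (\<integral>\<^sup>+\<omega>. (\<integral>\<^sup>+s\<in>{0..T}. ennreal ((H s \<omega> - H' s \<omega>)\<^sup>2) \<partial>lborel) \<partial>M)"
proof -
  obtain k \<tau> \<phi> where e: "\<And>j. elementary F (k j) (\<tau> j) (\<phi> j)"
    and P: "\<And>T. 0 \<le> T \<Longrightarrow> (\<lambda>j::nat. \<integral>\<^sup>+\<omega>. (\<integral>\<^sup>+s\<in>{0..T}.
              ennreal ((elem_process (k j) (\<tau> j) (\<phi> j) s \<omega> - H s \<omega>)\<^sup>2) \<partial>lborel) \<partial>M) \<longlonglongrightarrow> 0"
    and Q: "\<And>T. 0 \<le> T \<Longrightarrow> (\<lambda>j::nat. \<integral>\<^sup>+\<omega>. ennreal ((elem_integral B (k j) (\<tau> j) (\<phi> j) T \<omega> - I T \<omega>)\<^sup>2) \<partial>M) \<longlonglongrightarrow> 0"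
    by (rule ito_integralD[OF ito]) blast
  obtain k' \<tau>' \<phi>' where e': "\<And>j. elementary F (k' j) (\<tau>' j) (\<phi>' j)"
    and P': "\<And>T. 0 \<le> T \<Longrightarrow> (\<lambda>j::nat. \<integral>\<^sup>+\<omega>. (\<integral>\<^sup>+s\<in>{0..T}.
              ennreal ((elem_process (k' j) (\<tau>' j) (\<phi>' j) s \<omega> - H' s \<omega>)\<^sup>2) \<partial>lborel) \<partial>M) \<longlonglongrightarrow> 0"
    and Q': "\<And>T. 0 \<le> T \<Longrightarrow> (\<lambda>j::nat. \<integral>\<^sup>+\<omega>. ennreal ((elem_integral B (k' j) (\<tau>' j) (\<phi>' j) T \<omega> - I' T \<omega>)\<^sup>2) \<partial>M) \<longlonglongrightarrow> 0"
    by (rule ito_integralD[OF ito']) blast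
  let ?N = "\<lambda>j. elem_integral B (k j) (\<tau> j) (\<phi> j) T" and ?N' = "\<lambda>j. elem_integral B (k' j) (\<tau>' j) (\<phi>' j) T"
  let ?E = "\<lambda>j. elem_process (k j) (\<tau> j) (\<phi> j)" and ?E' = "\<lambda>j. elem_process (k' j) (\<tau>' j) (\<phi>' j)"
  let ?A = "\<integral>\<^sup>+\<omega>. (\<integral>\<^sup>+s\<in>{0..T}. ennreal ((H s \<omega> - H' s \<omega>)\<^sup>2) \<partial>lborel) \<partial>M"
  let ?p = "\<lambda>j. \<integral>\<^sup>+\<omega>. (\<integral>\<^sup>+s\<in>{0..T}. ennreal ((?E j s \<omega> - H s \<omega>)\<^sup>2) \<partial>lborel) \<partial>M"
  let ?p' = "\<lambda>j. \<integral>\<^sup>+\<omega>. (\<integral>\<^sup>+s\<in>{0..T}. ennreal ((?E' j s \<omega> - H' s \<omega>)\<^sup>2) \<partial>lborel) \<partial>M"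
  let ?q = "\<lambda>j. \<integral>\<^sup>+\<omega>. ennreal ((?N j \<omega> - I T \<omega>)\<^sup>2) \<partial>M" and ?q' = "\<lambda>j. \<integral>\<^sup>+\<omega>. ennreal ((?N' j \<omega> - I' T \<omega>)\<^sup>2) \<partial>M"
  define c where "c s = max 0 (min T s)" for s :: real
  have c: "c s = s" if "s \<in> {0..T}" for s using that by (auto simp: c_def)
  have Hm[measurable]: "(\<lambda>z. H (c (snd z)) (fst z)) \<in> borel_measurable (M \<Otimes>\<^sub>M lborel)"
    "(\<lambda>z. H' (c (snd z)) (fst z)) \<in> borel_measurable (M \<Otimes>\<^sub>M lborel)"
    using progressive_measurable[OF ito_integral_progressive[OF ito] T] progressive_measurable[OF ito_integral_progressive[OF ito'] T]
    by (auto simp: c_def case_prod_beta')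
  have Em[measurable]: "(\<lambda>z. ?E j (snd z) (fst z)) \<in> borel_measurable (M \<Otimes>\<^sub>M lborel)"
    "(\<lambda>z. ?E' j (snd z) (fst z)) \<in> borel_measurable (M \<Otimes>\<^sub>M lborel)" for j
    using elem_process_measurable[OF e] elem_process_measurable[OF e'] by (auto simp: case_prod_beta')
  have iter: "(\<integral>\<^sup>+\<omega>. (\<integral>\<^sup>+s\<in>{0..T}. ennreal ((f s \<omega>)\<^sup>2) \<partial>lborel) \<partial>M) =
      (\<integral>\<^sup>+z. ennreal ((g z * indicator {0..T} (snd z))\<^sup>2) \<partial>(M \<Otimes>\<^sub>M lborel))"
    if fg: "\<And>s \<omega>. s \<in> {0..T} \<Longrightarrow> f s \<omega> = g (\<omega>, s)" and gm: "g \<in> borel_measurable (M \<Otimes>\<^sub>M lborel)"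
    for f :: "real \<Rightarrow> 'a \<Rightarrow> real" and g :: "'a \<times> real \<Rightarrow> real"
  proof -
    note [measurable] = gm
    have "(\<integral>\<^sup>+\<omega>. (\<integral>\<^sup>+s\<in>{0..T}. ennreal ((f s \<omega>)\<^sup>2) \<partial>lborel) \<partial>M) =
      (\<integral>\<^sup>+\<omega>. (\<integral>\<^sup>+s\<in>{0..T}. ennreal ((g (\<omega>, s))\<^sup>2) \<partial>lborel) \<partial>M)"
      using fg by (intro nn_integral_cong) (auto simp: indicator_def)
    also have "\<dots> = (\<integral>\<^sup>+z. ennreal ((g (fst z, snd z) * indicator {0..T} (snd z))\<^sup>2) \<partial>(M \<Otimes>\<^sub>M lborel))"
      by (rule nn_integral_iterated_square) simp
    finally show ?thesis by simp
  qed
  have step: "(\<integral>\<^sup>+\<omega>. ennreal ((I T \<omega> - I' T \<omega>)\<^sup>2) \<partial>M) \<le> 4 * ?q j + 2 * (4 * ?p j + 2 * ?A + 4 * ?p' j) + 4 * ?q' j" for j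
  proof -
    have m: "?N j \<in> borel_measurable M" "?N' j \<in> borel_measurable M" "I T \<in> borel_measurable M" "I' T \<in> borel_measurable M"
      using L2_measurable elem_L2[OF e T] elem_L2[OF e' T] martingale_L2_D(2)[OF ito_integral_martingale[OF ito] T]
        martingale_L2_D(2)[OF ito_integral_martingale[OF ito'] T] by auto
    have "(\<integral>\<^sup>+\<omega>. ennreal ((I T \<omega> - I' T \<omega>)\<^sup>2) \<partial>M) =
      (\<integral>\<^sup>+\<omega>. ennreal (((I T \<omega> - ?N j \<omega>) + (?N j \<omega> - ?N' j \<omega>) + (?N' j \<omega> - I' T \<omega>))\<^sup>2) \<partial>M)" by simp
    also have "\<dots> \<le> 4 * (\<integral>\<^sup>+\<omega>. ennreal ((I T \<omega> - ?N j \<omega>)\<^sup>2) \<partial>M) +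
      2 * (\<integral>\<^sup>+\<omega>. ennreal ((?N j \<omega> - ?N' j \<omega>)\<^sup>2) \<partial>M) + 4 * ?q' j"
      by (rule nn_integral_square_add3_le) (use m in auto)
    also have "(\<integral>\<^sup>+\<omega>. ennreal ((I T \<omega> - ?N j \<omega>)\<^sup>2) \<partial>M) = ?q j" by (simp add: power2_commute)
    also have "(\<integral>\<^sup>+\<omega>. ennreal ((?N j \<omega> - ?N' j \<omega>)\<^sup>2) \<partial>M) =
      (\<integral>\<^sup>+\<omega>. (\<integral>\<^sup>+s\<in>{0..T}. ennreal ((?E j s \<omega> - ?E' j s \<omega>)\<^sup>2) \<partial>lborel) \<partial>M)"
      by (rule elem_isometry(2)[OF e e' T])
    also have "\<dots> = (\<integral>\<^sup>+z. ennreal (((?E j (snd z) (fst z) - ?E' j (snd z) (fst z)) * indicator {0..T} (snd z))\<^sup>2) \<partial>(M \<Otimes>\<^sub>M lborel))"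
      by (rule iter[of _ "\<lambda>z. ?E j (snd z) (fst z) - ?E' j (snd z) (fst z)"]) auto
    also have "\<dots> = (\<integral>\<^sup>+z. ennreal (((?E j (snd z) (fst z) - H (c (snd z)) (fst z)) * indicator {0..T} (snd z)
        + (H (c (snd z)) (fst z) - H' (c (snd z)) (fst z)) * indicator {0..T} (snd z)
        + (H' (c (snd z)) (fst z) - ?E' j (snd z) (fst z)) * indicator {0..T} (snd z))\<^sup>2) \<partial>(M \<Otimes>\<^sub>M lborel))"
      by (intro nn_integral_cong) (simp add: algebra_simps)
    also have "\<dots> \<le> 4 * (\<integral>\<^sup>+z. ennreal (((?E j (snd z) (fst z) - H (c (snd z)) (fst z)) * indicator {0..T} (snd z))\<^sup>2) \<partial>(M \<Otimes>\<^sub>M lborel))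
        + 2 * (\<integral>\<^sup>+z. ennreal (((H (c (snd z)) (fst z) - H' (c (snd z)) (fst z)) * indicator {0..T} (snd z))\<^sup>2) \<partial>(M \<Otimes>\<^sub>M lborel))
        + 4 * (\<integral>\<^sup>+z. ennreal (((H' (c (snd z)) (fst z) - ?E' j (snd z) (fst z)) * indicator {0..T} (snd z))\<^sup>2) \<partial>(M \<Otimes>\<^sub>M lborel))"
      by (rule nn_integral_square_add3_le) measurable
    also have "(\<integral>\<^sup>+z. ennreal (((?E j (snd z) (fst z) - H (c (snd z)) (fst z)) * indicator {0..T} (snd z))\<^sup>2) \<partial>(M \<Otimes>\<^sub>M lborel)) = ?p j"
      by (rule iter[of _ "\<lambda>z. ?E j (snd z) (fst z) - H (c (snd z)) (fst z)", symmetric]) (auto simp: c)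
    also have "(\<integral>\<^sup>+z. ennreal (((H (c (snd z)) (fst z) - H' (c (snd z)) (fst z)) * indicator {0..T} (snd z))\<^sup>2) \<partial>(M \<Otimes>\<^sub>M lborel)) = ?A"
      by (rule iter[of _ "\<lambda>z. H (c (snd z)) (fst z) - H' (c (snd z)) (fst z)", symmetric]) (auto simp: c)
    also have "(\<integral>\<^sup>+z. ennreal (((H' (c (snd z)) (fst z) - ?E' j (snd z) (fst z)) * indicator {0..T} (snd z))\<^sup>2) \<partial>(M \<Otimes>\<^sub>M lborel)) =
        (\<integral>\<^sup>+\<omega>. (\<integral>\<^sup>+s\<in>{0..T}. ennreal ((H' s \<omega> - ?E' j s \<omega>)\<^sup>2) \<partial>lborel) \<partial>M)"
      by (rule iter[of _ "\<lambda>z. H' (c (snd z)) (fst z) - ?E' j (snd z) (fst z)", symmetric]) (auto simp: c)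
    also have "\<dots> = ?p' j" by (simp add: power2_commute)
    finally show ?thesis by (simp add: add_mono mult_left_mono)
  qed
  have "(\<lambda>j. 4 * ?q j + 2 * (4 * ?p j + 2 * ?A + 4 * ?p' j) + 4 * ?q' j) \<longlonglongrightarrow> 4 * 0 + 2 * (4 * 0 + 2 * ?A + 4 * 0) + 4 * 0"
    by (intro tendsto_add tendsto_const ennreal_tendsto_cmult P P' Q Q' T) auto
  then have "(\<integral>\<^sup>+\<omega>. ennreal ((I T \<omega> - I' T \<omega>)\<^sup>2) \<partial>M) \<le> 4 * 0 + 2 * (4 * 0 + 2 * ?A + 4 * 0) + 4 * 0"
    by (rule LIMSEQ_le_const) (use step in blast)
  then show ?thesis by (simp flip: mult.assoc)
qed

text \<open>The constant 16 is the 4 of Doob's inequality times the 4 of the preceding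
  bound.\<close>

lemma ito_difference_sup_bound:
  assumes ito: "ito_integral M F B H I" and ito': "ito_integral M F B H' I'" and T: "0 \<le> T"
  obtains Q where "Q \<in> borel_measurable M" "AE \<omega> in M. \<forall>t\<in>{0..T}. ennreal ((I t \<omega> - I' t \<omega>)\<^sup>2) \<le> Q \<omega>"
    "(\<integral>\<^sup>+\<omega>. Q \<omega> \<partial>M) \<le> 16 * (\<integral>\<^sup>+\<omega>. (\<integral>\<^sup>+s\<in>{0..T}. ennreal ((H s \<omega> - H' s \<omega>)\<^sup>2) \<partial>lborel) \<partial>M)"
proof -
  have "AE \<omega> in M. continuous_on {0..} (\<lambda>t. I t \<omega>)" "AE \<omega> in M. continuous_on {0..} (\<lambda>t. I' t \<omega>)"
    using ito_integral_continuous[OF ito] ito_integral_continuous[OF ito'] .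
  then have "AE \<omega> in M. continuous_on {0..} (\<lambda>t. I t \<omega> - I' t \<omega>)"
    by eventually_elim (intro continuous_on_diff)
  from doob_L2[OF martingale_L2_diff[OF ito_integral_martingale[OF ito] ito_integral_martingale[OF ito']] this T]
  obtain Q where Q: "Q \<in> borel_measurable M" "AE \<omega> in M. \<forall>t\<in>{0..T}. ennreal ((I t \<omega> - I' t \<omega>)\<^sup>2) \<le> Q \<omega>"
    "(\<integral>\<^sup>+\<omega>. Q \<omega> \<partial>M) \<le> 4 * (\<integral>\<^sup>+\<omega>. ennreal ((I T \<omega> - I' T \<omega>)\<^sup>2) \<partial>M)" .
  note Q(3)
  also have "4 * (\<integral>\<^sup>+\<omega>. ennreal ((I T \<omega> - I' T \<omega>)\<^sup>2) \<partial>M) \<le>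
    4 * (4 * (\<integral>\<^sup>+\<omega>. (\<integral>\<^sup>+s\<in>{0..T}. ennreal ((H s \<omega> - H' s \<omega>)\<^sup>2) \<partial>lborel) \<partial>M))"
    by (intro mult_left_mono ito_difference_bound[OF ito ito' T]) auto
  finally show thesis using Q(1,2) by (intro that[of Q]) (auto simp flip: mult.assoc)
qed

end

section \<open>Laws, compensators and measurability of continuous processes\<close>

text \<open>The joint law of \<open>X\<close> and \<open>Y\<close> is one of the couplings over
  which the infimum is taken.\<close>

lemma (in prob_space) W2_law_le:
  assumes [measurable]: "X \<in> borel_measurable M" "Y \<in> borel_measurable M"
  shows "W2 (law M X) (law M Y) \<le> sqrt (\<integral>\<omega>. (X \<omega> - Y \<omega>)\<^sup>2 \<partial>M)"
proof -
  define \<pi> where "\<pi> = distr M (borel \<Otimes>\<^sub>M borel) (\<lambda>\<omega>. (X \<omega>, Y \<omega>))"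
  have "\<pi> \<in> couplings (law M X) (law M Y)"
    unfolding couplings_def \<pi>_def
    by (auto simp: space_prob_algebra distr_distr o_def intro!: prob_space_distr)
  moreover have "bdd_below ((\<lambda>\<pi>. \<integral>z. (fst z - snd z)\<^sup>2 \<partial>\<pi>) ` couplings (law M X) (law M Y))"
    by (rule bdd_belowI[of _ 0]) auto
  ultimately have "(INF \<pi>\<in>couplings (law M X) (law M Y). \<integral>z. (fst z - snd z)\<^sup>2 \<partial>\<pi>) \<le> (\<integral>z. (fst z - snd z)\<^sup>2 \<partial>\<pi>)"
    by (intro cINF_lower)
  also have "\<dots> = (\<integral>\<omega>. (X \<omega> - Y \<omega>)\<^sup>2 \<partial>M)"
    unfolding \<pi>_def by (subst integral_distr) auto
  finally show ?thesis unfolding W2_def by (rule real_sqrt_le_mono)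
qed

text \<open>A nonnegative function with integral zero vanishes almost everywhere, so a set on which
  it is positive is null; the mass of \<open>{s<..t}\<close> is the increment of \<open>K\<close>.
  The left end is excluded because \<open>g\<close> may vanish at the last time before the
  excursion.\<close>

lemma stieltjes_flat:
  fixes g :: "real \<Rightarrow> real"
  assumes mono: "mono_on {0..} K" and cont: "continuous_on {0..} K" and st: "0 \<le> s" "s \<le> t"
    and int: "set_integrable (stieltjes K) {0..t} g" and zero: "(LINT r:{0..t}|stieltjes K. g r) = 0"
    and nonneg: "\<And>r. r \<in> {0..t} \<Longrightarrow> 0 \<le> g r" and pos: "\<And>r. r \<in> {s<..t} \<Longrightarrow> 0 < g r"
  shows "K s = K t"
proof -
  let ?f = "\<lambda>r. indicator {0..t} r *\<^sub>R g r"
  have "AE r in stieltjes K. ?f r = 0"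
  proof -
    have "integrable (stieltjes K) ?f" using int by (simp add: set_integrable_def)
    moreover have "AE r in stieltjes K. 0 \<le> ?f r" using nonneg by (intro AE_I2) (auto simp: indicator_def)
    ultimately have "integral\<^sup>L (stieltjes K) ?f = 0 \<longleftrightarrow> (AE r in stieltjes K. ?f r = 0)"
      by (rule integral_nonneg_eq_0_iff_AE)
    then show ?thesis using zero by (simp add: set_lebesgue_integral_def)
  qed
  then have "AE r in stieltjes K. r \<notin> {s<..t}"
  proof eventually_elim
    case (elim r)
    then show ?case using pos[of r] st by (auto simp: indicator_def split: if_splits)
  qed
  moreover have sets: "{s<..t} \<in> sets (stieltjes K)" by (simp add: stieltjes_def)
  moreover have "{r \<in> space (stieltjes K). \<not> r \<notin> {s<..t}} = {s<..t}" by (auto simp: stieltjes_def)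
  ultimately have "emeasure (stieltjes K) {s<..t} = 0"
    using AE_iff_measurable[of "{s<..t}" "stieltjes K" "\<lambda>r. r \<notin> {s<..t}"] by blast
  moreover have "emeasure (stieltjes K) {s<..t} = ennreal (K (max 0 t) - K (max 0 s))"
    unfolding stieltjes_def
  proof (rule emeasure_interval_measure_Ioc[OF st(2)])
    show "K (max 0 x) \<le> K (max 0 y)" if "x \<le> y" for x y
      using that by (intro mono_onD[OF mono]) auto
    have "continuous_on UNIV (\<lambda>x::real. K (max 0 x))"
      by (rule continuous_on_compose2[OF cont]) (auto intro!: continuous_intros)
    then show "continuous (at_right a) (\<lambda>x. K (max 0 x))" for a
      by (simp add: continuous_on_eq_continuous_at continuous_at_imp_continuous_within)
  qed
  moreover have "K s \<le> K t" using st by (intro mono_onD[OF mono]) auto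
  ultimately show ?thesis using st by (simp add: ennreal_eq_0_iff)
qed

text \<open>After the last time at which \<open>K - K'\<close> is at most \<open>c\<close>, flatness forbids \<open>K\<close> to grow.\<close>

lemma compensator_compare:
  fixes g :: "real \<Rightarrow> real"
  assumes K: "K 0 = 0" "mono_on {0..} K" "continuous_on {0..} K"
    and K': "K' 0 = 0" "mono_on {0..} K'" "continuous_on {0..} K'"
    and t: "0 \<le> t" and c: "0 \<le> c"
    and int: "set_integrable (stieltjes K) {0..t} g" and zero: "(LINT r:{0..t}|stieltjes K. g r) = 0"
    and nonneg: "\<And>r. r \<in> {0..t} \<Longrightarrow> 0 \<le> g r"
    and pos: "\<And>r. r \<in> {0..t} \<Longrightarrow> c < K r - K' r \<Longrightarrow> 0 < g r"
  shows "K t - K' t \<le> c"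
proof -
  let ?S = "{r\<in>{0..t}. K r - K' r \<le> c}"
  have cont: "continuous_on {0..t} (\<lambda>r. K r - K' r)"
    by (intro continuous_intros continuous_on_subset[OF K(3)] continuous_on_subset[OF K'(3)]) auto
  have "compact ?S"
  proof -
    have eq: "?S = {0..t} \<inter> (\<lambda>r. K r - K' r) -` {..c}" by auto
    have "closed ?S" unfolding eq by (rule continuous_closed_preimage[OF cont]) auto
    moreover have "bounded ?S" by (rule bounded_subset[OF compact_imp_bounded[OF compact_Icc]]) auto
    ultimately show ?thesis by (simp add: compact_eq_bounded_closed)
  qed
  \<comment> \<open>Time 0 belongs to the set, since both compensators start at 0 and
    \<open>c\<close> is nonnegative.\<close>
  moreover have "?S \<noteq> {}" using K(1) K'(1) t c by force
  ultimately obtain s where s: "s \<in> ?S" "\<And>r. r \<in> ?S \<Longrightarrow> r \<le> s"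
    using compact_attains_sup[of ?S] by blast
  have "K s = K t"
  proof (rule stieltjes_flat[OF K(2,3) _ _ int zero nonneg])
    fix r assume r: "r \<in> {s<..t}"
    then have "r \<notin> ?S" using s(2)[of r] by auto
    then show "0 < g r" using r s(1) by (intro pos) auto
  qed (use s in auto)
  \<comment> \<open>Growth of the other compensator can only lower the difference.\<close>
  moreover have "K' s \<le> K' t" using s by (intro mono_onD[OF K'(2)]) auto
  ultimately show ?thesis using s(1) by auto
qed

text \<open>Rounding the time down to multiples of \<open>1 / Suc n\<close> leaves countably many
  time values, where joint measurability reduces to that of single variables; continuity of paths
  gives the limit. Negative times are sent to 0.\<close>

lemma continuous_process_measurable:
  fixes Z :: "real \<Rightarrow> 'a \<Rightarrow> real"
  assumes meas: "\<And>s. 0 \<le> s \<Longrightarrow> Z s \<in> borel_measurable M"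
    and cont: "\<And>\<omega>. \<omega> \<in> space M \<Longrightarrow> continuous_on {0..} (\<lambda>s. Z s \<omega>)"
  shows "(\<lambda>z. Z (max 0 (snd z)) (fst z)) \<in> borel_measurable (M \<Otimes>\<^sub>M lborel)"
proof (rule borel_measurable_LIMSEQ_real)
  let ?q = "\<lambda>n (i::int). of_int i / real (Suc n)"
  show "(\<lambda>z. Z (max 0 (?q n \<lfloor>snd z * real (Suc n)\<rfloor>)) (fst z)) \<in> borel_measurable (M \<Otimes>\<^sub>M lborel)" for n
  proof (rule measurable_compose_countable[where f="\<lambda>i z. Z (max 0 (?q n i)) (fst z)" and g="\<lambda>z. \<lfloor>snd z * real (Suc n)\<rfloor>"])
    show "(\<lambda>z. Z (max 0 (?q n i)) (fst z)) \<in> borel_measurable (M \<Otimes>\<^sub>M lborel)" for i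
      by (rule measurable_compose[OF measurable_fst meas]) simp
    have "(\<lambda>z::'a \<times> real. snd z * real (Suc n)) \<in> borel_measurable (M \<Otimes>\<^sub>M lborel)" by measurable
    from measurable_compose[OF this measurable_real_floor]
    show "(\<lambda>z. \<lfloor>snd z * real (Suc n)\<rfloor>) \<in> M \<Otimes>\<^sub>M lborel \<rightarrow>\<^sub>M count_space UNIV" .
  qed
  fix z :: "'a \<times> real" assume "z \<in> space (M \<Otimes>\<^sub>M lborel)"
  then have z: "fst z \<in> space M" by (auto simp: space_pair_measure)
  have lim: "(\<lambda>n. ?q n \<lfloor>snd z * real (Suc n)\<rfloor>) \<longlonglongrightarrow> snd z"
  proof (rule real_tendsto_sandwich)
    show "\<forall>\<^sub>F n in sequentially. snd z - inverse (real (Suc n)) \<le> ?q n \<lfloor>snd z * real (Suc n)\<rfloor>"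
    proof (rule always_eventually, rule allI)
      fix n
      have "snd z * real (Suc n) - 1 \<le> of_int \<lfloor>snd z * real (Suc n)\<rfloor>" by linarith
      then have "(snd z * real (Suc n) - 1) / real (Suc n) \<le> ?q n \<lfloor>snd z * real (Suc n)\<rfloor>"
        by (intro divide_right_mono) auto
      then show "snd z - inverse (real (Suc n)) \<le> ?q n \<lfloor>snd z * real (Suc n)\<rfloor>"
        by (simp add: diff_divide_distrib inverse_eq_divide del: of_nat_Suc)
    qed
    show "\<forall>\<^sub>F n in sequentially. ?q n \<lfloor>snd z * real (Suc n)\<rfloor> \<le> snd z"
    proof (rule always_eventually, rule allI)
      fix n
      have "?q n \<lfloor>snd z * real (Suc n)\<rfloor> \<le> (snd z * real (Suc n)) / real (Suc n)"
        by (intro divide_right_mono) auto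
      then show "?q n \<lfloor>snd z * real (Suc n)\<rfloor> \<le> snd z" by (simp del: of_nat_Suc)
    qed
    have "(\<lambda>n. snd z - inverse (real (Suc n))) \<longlonglongrightarrow> snd z - 0"
      by (intro tendsto_diff tendsto_const LIMSEQ_inverse_real_of_nat)
    then show "(\<lambda>n. snd z - inverse (real (Suc n))) \<longlonglongrightarrow> snd z" by simp
  qed simp
  have "continuous_on UNIV (\<lambda>s. Z (max 0 s) (fst z))"
    by (rule continuous_on_compose2[OF cont[OF z]]) (auto intro!: continuous_intros)
  then show "(\<lambda>n. Z (max 0 (?q n \<lfloor>snd z * real (Suc n)\<rfloor>)) (fst z)) \<longlonglongrightarrow> Z (max 0 (snd z)) (fst z)"
    using lim by (rule continuous_on_tendsto_compose) auto
qed

lemma (in prob_space) continuous_process_Tonelli: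
  fixes Z :: "real \<Rightarrow> 'a \<Rightarrow> real"
  assumes meas: "\<And>s. 0 \<le> s \<Longrightarrow> Z s \<in> borel_measurable M"
    and cont: "\<And>\<omega>. \<omega> \<in> space M \<Longrightarrow> continuous_on {0..} (\<lambda>s. Z s \<omega>)"
  shows "(\<integral>\<^sup>+\<omega>. (\<integral>\<^sup>+s\<in>{0..t}. ennreal ((Z s \<omega>)\<^sup>2) \<partial>lborel) \<partial>M) = (\<integral>\<^sup>+s\<in>{0..t}. (\<integral>\<^sup>+\<omega>. ennreal ((Z s \<omega>)\<^sup>2) \<partial>M) \<partial>lborel)"
    and "(\<lambda>\<omega>. \<integral>\<^sup>+s\<in>{0..t}. ennreal ((Z s \<omega>)\<^sup>2) \<partial>lborel) \<in> borel_measurable M"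
proof -
  define f where "f \<omega> s = ennreal ((Z (max 0 s) \<omega>)\<^sup>2) * indicator {0..t} s" for \<omega> s
  have eq: "ennreal ((Z s \<omega>)\<^sup>2) * indicator {0..t} s = f \<omega> s" for \<omega> s
    by (auto simp: f_def indicator_def)
  have [measurable]: "(\<lambda>z. Z (max 0 (snd z)) (fst z)) \<in> borel_measurable (M \<Otimes>\<^sub>M lborel)"
    by (rule continuous_process_measurable[OF meas cont])
  have fm: "(\<lambda>(\<omega>, s). f \<omega> s) \<in> borel_measurable (M \<Otimes>\<^sub>M lborel)"
    unfolding f_def case_prod_beta' by measurable
  interpret P: pair_sigma_finite M "lborel :: real measure"
    by (intro pair_sigma_finite.intro sigma_finite_measure_axioms lborel.sigma_finite_measure_axioms)
  have "(\<integral>\<^sup>+\<omega>. (\<integral>\<^sup>+s. f \<omega> s \<partial>lborel) \<partial>M) = (\<integral>\<^sup>+s. (\<integral>\<^sup>+\<omega>. f \<omega> s \<partial>M) \<partial>lborel)"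
    using P.Fubini'[OF fm] by simp
  also have "\<dots> = (\<integral>\<^sup>+s\<in>{0..t}. (\<integral>\<^sup>+\<omega>. ennreal ((Z s \<omega>)\<^sup>2) \<partial>M) \<partial>lborel)"
    by (intro nn_integral_cong) (auto simp: f_def indicator_def)
  finally show "(\<integral>\<^sup>+\<omega>. (\<integral>\<^sup>+s\<in>{0..t}. ennreal ((Z s \<omega>)\<^sup>2) \<partial>lborel) \<partial>M) = (\<integral>\<^sup>+s\<in>{0..t}. (\<integral>\<^sup>+\<omega>. ennreal ((Z s \<omega>)\<^sup>2) \<partial>M) \<partial>lborel)"
    unfolding eq .
  show "(\<lambda>\<omega>. \<integral>\<^sup>+s\<in>{0..t}. ennreal ((Z s \<omega>)\<^sup>2) \<partial>lborel) \<in> borel_measurable M"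
    unfolding eq using lborel.borel_measurable_nn_integral[OF fm] .
qed

lemma continuous_SUP_measurable:
  fixes Z :: "real \<Rightarrow> 'a \<Rightarrow> real"
  assumes T: "0 \<le> T" and meas: "\<And>s. 0 \<le> s \<Longrightarrow> Z s \<in> borel_measurable M"
    and cont: "\<And>\<omega>. \<omega> \<in> space M \<Longrightarrow> continuous_on {0..T} (\<lambda>s. Z s \<omega>)"
  shows "(\<lambda>\<omega>. SUP t\<in>{0..T}. ennreal ((Z t \<omega>)\<^sup>2)) \<in> borel_measurable M"
proof -
  have [measurable]: "Z (T * real i / 2^k) \<in> borel_measurable M" for i k using T by (intro meas) simp
  have "(SUP t\<in>{0..T}. ennreal ((Z t \<omega>)\<^sup>2)) = (SUP k. SUP i\<in>{..(2::nat)^k}. ennreal ((Z (T * real i / 2^k) \<omega>)\<^sup>2))"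
    if "\<omega> \<in> space M" for \<omega>
    by (rule SUP_dyadic[OF T]) (intro continuous_intros cont that)
  then have "(\<lambda>\<omega>. SUP t\<in>{0..T}. ennreal ((Z t \<omega>)\<^sup>2)) \<in> borel_measurable M \<longleftrightarrow>
    (\<lambda>\<omega>. SUP k. SUP i\<in>{..(2::nat)^k}. ennreal ((Z (T * real i / 2^k) \<omega>)\<^sup>2)) \<in> borel_measurable M"
    by (rule measurable_cong)
  also have "\<dots>" by measurable
  finally show ?thesis .
qed

section \<open>Flat solutions\<close>

text \<open>Coupling \<open>Z\<close> with itself shows that \<open>W2\<close> of its law with
  itself is at most 0, so only the spatial distance remains.\<close>

lemma (in prob_space) lipschitz_same_law:
  assumes lip: "lipschitz_coeffs L f g" and L: "0 \<le> L" and Z: "Z \<in> borel_measurable M" "law M Z \<in> P2"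
  shows "\<bar>f x (law M Z) - f y (law M Z)\<bar> + \<bar>g x (law M Z) - g y (law M Z)\<bar> \<le> L * \<bar>x - y\<bar>"
proof -
  have "\<bar>f x (law M Z) - f y (law M Z)\<bar> + \<bar>g x (law M Z) - g y (law M Z)\<bar> \<le> L * (\<bar>x - y\<bar> + W2 (law M Z) (law M Z))"
    using lip Z(2) unfolding lipschitz_coeffs_def by blast
  also have "\<dots> \<le> L * \<bar>x - y\<bar>" using W2_law_le[OF Z(1) Z(1)] L by (intro mult_left_mono) auto
  finally show ?thesis .
qed

lemma (in prob_space) lipschitz_L2_integrable:
  fixes h :: "real \<Rightarrow> real"
  assumes h: "mono h" "\<And>x y. \<bar>h x - h y\<bar> \<le> N * \<bar>x - y\<bar>" and Z: "L2 M Z"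
  shows "integrable M (\<lambda>\<omega>. h (Z \<omega>))"
proof (rule Bochner_Integration.integrable_bound)
  show "integrable M (\<lambda>\<omega>. \<bar>h 0\<bar> + N * \<bar>Z \<omega>\<bar>)" using L2_integrable[OF Z] by simp
  show "(\<lambda>\<omega>. h (Z \<omega>)) \<in> borel_measurable M"
    using measurable_compose[OF L2_measurable[OF Z] borel_measurable_mono[OF h(1)]] .
  show "AE \<omega> in M. norm (h (Z \<omega>)) \<le> norm (\<bar>h 0\<bar> + N * \<bar>Z \<omega>\<bar>)"
  proof (rule AE_I2)
    fix \<omega>
    show "norm (h (Z \<omega>)) \<le> norm (\<bar>h 0\<bar> + N * \<bar>Z \<omega>\<bar>)" using h(2)[of "Z \<omega>" 0] by (simp add: abs_le_iff) linarith
  qed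
qed

context filtered_brownian_motion
begin

lemma flat_solutionD:
  assumes "deterministic_flat_solution M F B \<xi> b \<sigma> h X K"
  shows "adapted F X" "\<forall>\<omega>\<in>space M. continuous_on {0..} (\<lambda>t. X t \<omega>)" "\<forall>t\<ge>0. law M (X t) \<in> P2"
    "K 0 = 0" "mono_on {0..} K" "continuous_on {0..} K" "\<forall>t\<ge>0. 0 \<le> (\<integral>\<omega>. h (X t \<omega>) \<partial>M)"
    "\<forall>t\<ge>0. set_integrable (stieltjes K) {0..t} (\<lambda>s. \<integral>\<omega>. h (X s \<omega>) \<partial>M) \<and>
        (LINT s:{0..t}|stieltjes K. (\<integral>\<omega>. h (X s \<omega>) \<partial>M)) = 0"
    "\<exists>I. ito_integral M F B (\<lambda>s \<omega>. \<sigma> (X s \<omega>) (law M (X s))) I \<and>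
       (AE \<omega> in M. \<forall>t\<ge>0.
          set_integrable lborel {0..t} (\<lambda>s. b (X s \<omega>) (law M (X s))) \<and>
          X t \<omega> = \<xi> \<omega> + (LINT s:{0..t}|lborel. b (X s \<omega>) (law M (X s))) + I t \<omega> + K t)"
  using assms unfolding deterministic_flat_solution_def by - (elim conjE, assumption)+

lemma flat_solution_measurable:
  assumes "deterministic_flat_solution M F B \<xi> b \<sigma> h X K" "0 \<le> t"
  shows "X t \<in> borel_measurable M"
  by (rule F_measurable_M[OF assms(2)]) (use flat_solutionD(1)[OF assms(1)] assms(2) in \<open>simp add: adapted_def\<close>)

lemma flat_solution_L2:
  assumes "deterministic_flat_solution M F B \<xi> b \<sigma> h X K" "0 \<le> t"
  shows "L2 M (X t)"
proof -
  have "integrable (law M (X t)) (\<lambda>x. x\<^sup>2)" using flat_solutionD(3)[OF assms(1)] assms(2) by (simp add: P2_def)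
  then show ?thesis using flat_solution_measurable[OF assms]
    by (subst (asm) integrable_distr_eq) (auto simp: L2_def)
qed

text \<open>The drift along an arbitrary path is controlled by the drift along one fixed path on which it
  is integrable. This replaces a growth bound for \<open>s \<mapsto> b 0 (law M (X s))\<close>.\<close>

lemma flat_solution_sup_L2:
  assumes sol: "deterministic_flat_solution M F B \<xi> b \<sigma> h X K" and \<xi>: "L2 M \<xi>"
    and lip: "lipschitz_coeffs L b \<sigma>" and L: "0 < L" and T: "0 \<le> T"
  obtains S where "L2 M S" "\<And>\<omega> t. \<omega> \<in> space M \<Longrightarrow> t \<in> {0..T} \<Longrightarrow> \<bar>X t \<omega>\<bar> \<le> S \<omega>"
proof -
  let ?b = "\<lambda>s \<omega>. b (X s \<omega>) (law M (X s))"
  note K = flat_solutionD(4-6)[OF sol]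
  have cont: "continuous_on {0..u} (\<lambda>t. X t \<omega>)" if "\<omega> \<in> space M" for \<omega> u
    using flat_solutionD(2)[OF sol] that by (auto intro: continuous_on_subset)
  obtain I where ito: "ito_integral M F B (\<lambda>s \<omega>. \<sigma> (X s \<omega>) (law M (X s))) I"
    and eq: "AE \<omega> in M. \<forall>t\<ge>0. set_integrable lborel {0..t} (\<lambda>s. ?b s \<omega>) \<and>
          X t \<omega> = \<xi> \<omega> + (LINT s:{0..t}|lborel. ?b s \<omega>) + I t \<omega> + K t"
    using flat_solutionD(9)[OF sol] by (elim exE conjE)
  note mart = ito_integral_martingale[OF ito]
  obtain Q where Qm: "Q \<in> borel_measurable M" and QI: "AE \<omega> in M. \<forall>t\<in>{0..T}. ennreal ((I t \<omega>)\<^sup>2) \<le> Q \<omega>"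
    and Qint: "(\<integral>\<^sup>+\<omega>. Q \<omega> \<partial>M) \<le> 4 * (\<integral>\<^sup>+\<omega>. ennreal ((I T \<omega>)\<^sup>2) \<partial>M)"
    by (rule doob_L2[OF mart ito_integral_continuous[OF ito] T])
  have Qfin: "(\<integral>\<^sup>+\<omega>. Q \<omega> \<partial>M) < \<infinity>"
    by (rule le_less_trans[OF Qint]) (simp add: L2_nn_integral[OF martingale_L2_D(2)[OF mart T]] ennreal_mult_less_top)
  \<comment> \<open>A probability space is not null, so an almost sure property holds at some point
    of it. This supplies the reference path \<open>\<omega>0\<close>.\<close>
  have "AE \<omega> in M. \<omega> \<in> space M \<and> (\<forall>t\<ge>0. set_integrable lborel {0..t} (\<lambda>s. ?b s \<omega>))"
    using eq AE_space by eventually_elim blast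
  moreover have "ae_filter M \<noteq> bot" by (simp add: Measure_Space.ae_filter_eq_bot_iff emeasure_space_1)
  ultimately obtain \<omega>0 where w0: "\<omega>0 \<in> space M" "\<And>t. 0 \<le> t \<Longrightarrow> set_integrable lborel {0..t} (\<lambda>s. ?b s \<omega>0)"
    using eventually_happens'[of "ae_filter M"] by blast
  define \<gamma> where "\<gamma> s = \<bar>?b s \<omega>0\<bar> + L * \<bar>X s \<omega>0\<bar>" for s
  have Xi: "set_integrable lborel {0..t} (\<lambda>s. L * \<bar>X s \<omega>\<bar>)" if "\<omega> \<in> space M" for \<omega> t
    by (intro borel_integrable_atLeastAtMost' continuous_intros cont that)
  have \<gamma>i: "set_integrable lborel {0..t} \<gamma>" if "0 \<le> t" for t
    unfolding \<gamma>_def by (intro set_integral_add(1) set_integrable_abs w0 that Xi)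
  have \<gamma>0: "0 \<le> \<gamma> s" for s using L by (simp add: \<gamma>_def)
  define G where "G = (LINT s:{0..T}|lborel. \<gamma> s)"
  have G0: "0 \<le> G" unfolding G_def set_lebesgue_integral_def using \<gamma>0 by (intro integral_nonneg_AE) auto
  have KT: "0 \<le> K T" using mono_onD[OF K(2), of 0 T] K(1) T by simp
  define e where "e = exp (2 * L * T)"
  \<comment> \<open>Gronwall is applied to each path separately: \<open>G\<close>,
    \<open>K T\<close> and the number \<open>i\<close> are constants in time, and \<open>K u\<close>
    is at most \<open>K T\<close> by monotonicity.\<close>
  have path: "\<bar>X t \<omega>\<bar> \<le> 2 * (\<bar>\<xi> \<omega>\<bar> + (G + K T) + i) * e"
    if w: "\<omega> \<in> space M" and good: "\<forall>t\<ge>0. set_integrable lborel {0..t} (\<lambda>s. ?b s \<omega>) \<and>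
          X t \<omega> = \<xi> \<omega> + (LINT s:{0..t}|lborel. ?b s \<omega>) + I t \<omega> + K t"
      and i: "\<forall>t\<in>{0..T}. \<bar>I t \<omega>\<bar> \<le> i" and t: "t \<in> {0..T}" for \<omega> i t
  proof -
    have i0: "0 \<le> i" using i T by (metis abs_ge_zero atLeastAtMost_iff order_refl order_trans)
    have bd: "\<bar>X u \<omega>\<bar> \<le> (\<bar>\<xi> \<omega>\<bar> + (G + K T) + i) + L * (LINT s:{0..u}|lborel. \<bar>X s \<omega>\<bar>)" if u: "u \<in> {0..T}" for u
    proof -
      have u0: "0 \<le> u" using u by simp
      have bi: "set_integrable lborel {0..u} (\<lambda>s. ?b s \<omega>)" using good u0 by blast
      have "\<bar>LINT s:{0..u}|lborel. ?b s \<omega>\<bar> \<le> (LINT s:{0..u}|lborel. \<bar>?b s \<omega>\<bar>)"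
        using set_integral_norm_bound[OF bi] by simp
      also have "\<dots> \<le> (LINT s:{0..u}|lborel. \<gamma> s + L * \<bar>X s \<omega>\<bar>)"
      proof (rule set_integral_mono)
        show "set_integrable lborel {0..u} (\<lambda>s. \<bar>?b s \<omega>\<bar>)" by (rule set_integrable_abs[OF bi])
        show "set_integrable lborel {0..u} (\<lambda>s. \<gamma> s + L * \<bar>X s \<omega>\<bar>)"
          by (rule set_integral_add(1)[OF \<gamma>i[OF u0] Xi[OF w]])
        fix s assume s: "s \<in> {0..u}"
        then have s0: "0 \<le> s" by simp
        have "\<bar>?b s \<omega> - ?b s \<omega>0\<bar> \<le> L * \<bar>X s \<omega> - X s \<omega>0\<bar>"
          using lipschitz_same_law[OF lip _ flat_solution_measurable[OF sol s0], of "X s \<omega>" "X s \<omega>0"] L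
            flat_solutionD(3)[OF sol] s0 by auto
        also have "\<dots> \<le> L * (\<bar>X s \<omega>\<bar> + \<bar>X s \<omega>0\<bar>)" using L by (intro mult_left_mono) auto
        finally show "\<bar>?b s \<omega>\<bar> \<le> \<gamma> s + L * \<bar>X s \<omega>\<bar>" by (simp add: \<gamma>_def algebra_simps)
      qed
      also have "\<dots> = (LINT s:{0..u}|lborel. \<gamma> s) + (LINT s:{0..u}|lborel. L * \<bar>X s \<omega>\<bar>)"
        by (rule set_integral_add(2)[OF \<gamma>i[OF u0] Xi[OF w]])
      also have "(LINT s:{0..u}|lborel. \<gamma> s) \<le> G"
        unfolding G_def set_lebesgue_integral_def
        using \<gamma>i[OF u0] \<gamma>i[OF T] \<gamma>0 u unfolding set_integrable_def by (intro integral_mono) (auto simp: indicator_def)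
      finally have 1: "\<bar>LINT s:{0..u}|lborel. ?b s \<omega>\<bar> \<le> G + L * (LINT s:{0..u}|lborel. \<bar>X s \<omega>\<bar>)" by simp
      have 2: "X u \<omega> = \<xi> \<omega> + (LINT s:{0..u}|lborel. ?b s \<omega>) + I u \<omega> + K u" using good u0 by blast
      have 3: "\<bar>K u\<bar> \<le> K T" using mono_onD[OF K(2), of 0 u] mono_onD[OF K(2), of u T] K(1) u by auto
      have 4: "\<bar>I u \<omega>\<bar> \<le> i" using i u by blast
      show ?thesis using 1 2 3 4 by linarith
    qed
    have "\<bar>X t \<omega>\<bar> \<le> 2 * (\<bar>\<xi> \<omega>\<bar> + (G + K T) + i) * exp (2 * L * T)"
      by (rule gronwall_continuous[OF L _ _ bd t]) (use i0 G0 KT cont[OF w] in \<open>auto intro!: continuous_intros\<close>)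
    then show ?thesis unfolding e_def .
  qed
  define SX where "SX \<omega> = (SUP t\<in>{0..T}. ennreal ((X t \<omega>)\<^sup>2))" for \<omega>
  have SXm: "SX \<in> borel_measurable M"
    unfolding SX_def by (rule continuous_SUP_measurable[OF T flat_solution_measurable[OF sol] cont])
  define R where "R \<omega> = ennreal ((2 * e)\<^sup>2) * (4 * ennreal ((\<xi> \<omega>)\<^sup>2) + 2 * ennreal ((G + K T)\<^sup>2) + 4 * Q \<omega>)" for \<omega>
  \<comment> \<open>Finiteness of \<open>Q\<close> is needed to extract the real bound
    \<open>i = sqrt q\<close> for the stochastic integral on the path.\<close>
  have "AE \<omega> in M. Q \<omega> \<noteq> \<infinity>" by (rule nn_integral_PInf_AE[OF Qm]) (use Qfin in auto)
  with eq QI AE_space have "AE \<omega> in M. SX \<omega> \<le> R \<omega>"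
  proof eventually_elim
    case (elim \<omega>)
    obtain q where q: "Q \<omega> = ennreal q" "0 \<le> q" using elim(4) by (cases "Q \<omega>") auto
    have i: "\<forall>t\<in>{0..T}. \<bar>I t \<omega>\<bar> \<le> sqrt q"
    proof
      fix t assume "t \<in> {0..T}"
      then have "ennreal ((I t \<omega>)\<^sup>2) \<le> ennreal q" using elim(2) q by metis
      then have "(I t \<omega>)\<^sup>2 \<le> q" using q by (simp add: ennreal_le_iff)
      then show "\<bar>I t \<omega>\<bar> \<le> sqrt q" using real_le_rsqrt by fastforce
    qed
    show "SX \<omega> \<le> R \<omega>" unfolding SX_def
    proof (rule SUP_least)
      fix t assume t: "t \<in> {0..T}"
      let ?c = "\<bar>\<xi> \<omega>\<bar> + (G + K T) + sqrt q"
      have "\<bar>X t \<omega>\<bar> \<le> 2 * ?c * e" by (rule path[OF elim(3,1) i t])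
      then have "(X t \<omega>)\<^sup>2 \<le> (2 * ?c * e)\<^sup>2" by (metis abs_ge_zero power2_abs power_mono)
      also have "\<dots> = (2 * e)\<^sup>2 * ?c\<^sup>2" by (simp only: power_mult_distrib mult_ac)
      also have "\<dots> \<le> (2 * e)\<^sup>2 * (4 * \<bar>\<xi> \<omega>\<bar>\<^sup>2 + 2 * (G + K T)\<^sup>2 + 4 * (sqrt q)\<^sup>2)"
        by (intro mult_left_mono square_add3_le) simp
      finally have "ennreal ((X t \<omega>)\<^sup>2) \<le> ennreal ((2 * e)\<^sup>2 * (4 * (\<xi> \<omega>)\<^sup>2 + 2 * (G + K T)\<^sup>2 + 4 * q))"
        using q by (intro ennreal_leI) simp
      also have "\<dots> = R \<omega>" unfolding R_def using q
        by (simp add: ennreal_mult ennreal_plus)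
      finally show "ennreal ((X t \<omega>)\<^sup>2) \<le> R \<omega>" .
    qed
  qed
  then have "(\<integral>\<^sup>+\<omega>. SX \<omega> \<partial>M) \<le> (\<integral>\<^sup>+\<omega>. R \<omega> \<partial>M)" by (rule nn_integral_mono_AE)
  also have "\<dots> = ennreal ((2 * e)\<^sup>2) * (4 * (\<integral>\<^sup>+\<omega>. ennreal ((\<xi> \<omega>)\<^sup>2) \<partial>M) + 2 * ennreal ((G + K T)\<^sup>2) + 4 * (\<integral>\<^sup>+\<omega>. Q \<omega> \<partial>M))"
    unfolding R_def using L2_measurable[OF \<xi>] Qm
    by (simp add: nn_integral_cmult nn_integral_add emeasure_space_1)
  also have "\<dots> < \<infinity>" using Qfin by (simp add: L2_nn_integral[OF \<xi>] ennreal_mult_less_top)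
  finally have SXfin: "(\<integral>\<^sup>+\<omega>. SX \<omega> \<partial>M) < \<infinity>" .
  \<comment> \<open>Finite on every path by compactness, not only almost everywhere. Converting to a
    real number therefore loses nothing, and \<open>S\<close> dominates \<open>X\<close> at every
    point of the space.\<close>
  have SXw: "SX \<omega> < \<infinity>" if w: "\<omega> \<in> space M" for \<omega>
  proof -
    have "continuous_on {0..T} (\<lambda>t. (X t \<omega>)\<^sup>2)" by (intro continuous_intros cont[OF w])
    then obtain u where "\<forall>t\<in>{0..T}. (X t \<omega>)\<^sup>2 \<le> (X u \<omega>)\<^sup>2"
      using continuous_attains_sup[of "{0..T}" "\<lambda>t. (X t \<omega>)\<^sup>2"] T by auto
    then have "SX \<omega> \<le> ennreal ((X u \<omega>)\<^sup>2)" unfolding SX_def by (intro SUP_least ennreal_leI) auto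
    then show ?thesis by (rule le_less_trans) simp
  qed
  define S where "S \<omega> = sqrt (enn2real (SX \<omega>))" for \<omega>
  have S2: "(S \<omega>)\<^sup>2 = enn2real (SX \<omega>)" for \<omega> by (simp add: S_def)
  have "S \<in> borel_measurable M" unfolding S_def using SXm by measurable
  moreover have "(\<integral>\<^sup>+\<omega>. ennreal ((S \<omega>)\<^sup>2) \<partial>M) = (\<integral>\<^sup>+\<omega>. SX \<omega> \<partial>M)"
    unfolding S2 using SXw by (intro nn_integral_cong) (simp add: ennreal_enn2real)
  ultimately have "L2 M S" using SXfin by (simp add: L2_iff_nn_integral)
  moreover have "\<bar>X t \<omega>\<bar> \<le> S \<omega>" if w: "\<omega> \<in> space M" and t: "t \<in> {0..T}" for \<omega> t
  proof -
    have "ennreal ((X t \<omega>)\<^sup>2) \<le> SX \<omega>" unfolding SX_def using t by (rule SUP_upper)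
    then have "(X t \<omega>)\<^sup>2 \<le> enn2real (SX \<omega>)" using enn2real_mono[of "ennreal ((X t \<omega>)\<^sup>2)" "SX \<omega>"] SXw[OF w] by simp
    then show ?thesis unfolding S_def using real_le_rsqrt by fastforce
  qed
  ultimately show thesis by (rule that)
qed

text \<open>Write \<open>X = X' + k + V\<close> with \<open>k = K - K'\<close>. Shifting the
  argument by \<open>k \<ge> 0\<close> raises \<open>h\<close> by at least \<open>m * k\<close>, and
  \<open>V\<close> changes it by at most \<open>N * \<bar>V\<bar>\<close>. Since
  \<open>E \<bar>V\<bar> \<le> sqrt q\<close> and the constraint holds for \<open>X'\<close>, a gap
  above \<open>N / m * sqrt q\<close> makes \<open>E (h X)\<close> strictly positive.\<close>

lemma compensator_bound:
  fixes h :: "real \<Rightarrow> real"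
  assumes sol: "deterministic_flat_solution M F B \<xi> b \<sigma> h X K"
    and sol': "deterministic_flat_solution M F B \<xi>' b' \<sigma>' h X' K'"
    and h: "mono h" and m: "0 < m" "m \<le> N"
    and bilip: "\<And>x y. m * \<bar>x - y\<bar> \<le> \<bar>h x - h y\<bar> \<and> \<bar>h x - h y\<bar> \<le> N * \<bar>x - y\<bar>"
    and t: "0 \<le> t" and q: "0 \<le> q"
    and V: "\<And>r. r \<in> {0..t} \<Longrightarrow> expectation (\<lambda>\<omega>. (X r \<omega> - X' r \<omega> - (K r - K' r))\<^sup>2) \<le> q"
  shows "K t - K' t \<le> N / m * sqrt q"
proof -
  have c: "0 \<le> N / m * sqrt q" using m q by simp
  have hi: "integrable M (\<lambda>\<omega>. h (Z \<omega>))" if "L2 M Z" for Z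
    using lipschitz_L2_integrable[OF h _ that, of N] bilip by blast
  note D = flat_solutionD[OF sol] and D' = flat_solutionD[OF sol']
  show ?thesis
  proof (rule compensator_compare[where g="\<lambda>r. \<integral>\<omega>. h (X r \<omega>) \<partial>M", OF D(4-6) D'(4-6) t c])
    show "set_integrable (stieltjes K) {0..t} (\<lambda>r. \<integral>\<omega>. h (X r \<omega>) \<partial>M)"
      "(LINT r:{0..t}|stieltjes K. (\<integral>\<omega>. h (X r \<omega>) \<partial>M)) = 0" using D(8) t by blast+
    show "0 \<le> (\<integral>\<omega>. h (X r \<omega>) \<partial>M)" if "r \<in> {0..t}" for r using D(7) that by simp
    fix r assume r: "r \<in> {0..t}" and gt: "N / m * sqrt q < K r - K' r"
    let ?k = "K r - K' r" and ?V = "\<lambda>\<omega>. X r \<omega> - X' r \<omega> - (K r - K' r)"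
    have r0: "0 \<le> r" using r by simp
    have k0: "0 \<le> ?k" using gt c by linarith
    have L: "L2 M (X r)" "L2 M (X' r)" using flat_solution_L2[OF sol r0] flat_solution_L2[OF sol' r0] .
    have VL: "L2 M ?V" by (intro L2_diff L L2_bounded[of _ "\<bar>?k\<bar>"]) auto
    have absL: "L2 M (\<lambda>\<omega>. \<bar>?V \<omega>\<bar>)" by (rule L2_bound[OF VL]) (use L2_measurable[OF VL] in auto)
    have "(expectation (\<lambda>\<omega>. \<bar>?V \<omega>\<bar>))\<^sup>2 \<le> q"
      using square_expectation_le[OF absL] V[OF r] by simp
    then have EV: "expectation (\<lambda>\<omega>. \<bar>?V \<omega>\<bar>) \<le> sqrt q" by (rule real_le_rsqrt)
    have "N * expectation (\<lambda>\<omega>. \<bar>?V \<omega>\<bar>) \<le> N * sqrt q" using EV m by (intro mult_left_mono) auto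
    also have "\<dots> < m * ?k" using gt m(1) by (simp add: field_simps)
    also have "m * ?k - N * expectation (\<lambda>\<omega>. \<bar>?V \<omega>\<bar>) =
      expectation (\<lambda>\<omega>. m * ?k - N * \<bar>?V \<omega>\<bar>)"
      using L2_integrable[OF absL] by (simp add: prob_space)
    finally have pos: "0 < expectation (\<lambda>\<omega>. m * ?k - N * \<bar>?V \<omega>\<bar>)" by simp
    have "expectation (\<lambda>\<omega>. h (X' r \<omega>) + (m * ?k - N * \<bar>?V \<omega>\<bar>)) \<le> expectation (\<lambda>\<omega>. h (X r \<omega>))"
    proof (rule integral_mono)
      show "integrable M (\<lambda>\<omega>. h (X' r \<omega>) + (m * ?k - N * \<bar>?V \<omega>\<bar>))"
        using hi[OF L(2)] L2_integrable[OF absL] by simp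
      show "integrable M (\<lambda>\<omega>. h (X r \<omega>))" by (rule hi[OF L(1)])
      fix \<omega>
      have 1: "m * \<bar>(X' r \<omega> + ?k) - X' r \<omega>\<bar> \<le> \<bar>h (X' r \<omega> + ?k) - h (X' r \<omega>)\<bar>" using bilip by blast
      have 2: "h (X' r \<omega>) \<le> h (X' r \<omega> + ?k)" using k0 by (intro monoD[OF h]) simp
      have 3: "\<bar>h (X r \<omega>) - h (X' r \<omega> + ?k)\<bar> \<le> N * \<bar>X r \<omega> - (X' r \<omega> + ?k)\<bar>" using bilip by blast
      have 4: "X r \<omega> - (X' r \<omega> + ?k) = ?V \<omega>" by simp
      have 5: "m * ?k \<le> h (X' r \<omega> + ?k) - h (X' r \<omega>)" using 1 2 k0 by simp
      show "h (X' r \<omega>) + (m * ?k - N * \<bar>?V \<omega>\<bar>) \<le> h (X r \<omega>)" using 5 3 unfolding 4 by linarith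
    qed
    moreover have "expectation (\<lambda>\<omega>. h (X' r \<omega>) + (m * ?k - N * \<bar>?V \<omega>\<bar>)) =
      expectation (\<lambda>\<omega>. h (X' r \<omega>)) + expectation (\<lambda>\<omega>. m * ?k - N * \<bar>?V \<omega>\<bar>)"
      using hi[OF L(2)] L2_integrable[OF absL] by (intro Bochner_Integration.integral_add) auto
    moreover have "0 \<le> expectation (\<lambda>\<omega>. h (X' r \<omega>))" using D'(7) r0 by blast
    ultimately show "0 < (\<integral>\<omega>. h (X r \<omega>) \<partial>M)" using pos by linarith
  qed
qed

end

section \<open>Stability\<close>

text \<open>The discrepancy of the coefficients is measured along \<open>X\<close>, with a random
  majorant \<open>D\<close> uniform in time. In the application \<open>X\<close> is the fixed limit,
  so the tail of its supremum does not depend on the approximating solution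
  \<open>X'\<close>.\<close>

locale two_flat_solutions = filtered_brownian_motion M F B
  for M :: "'a measure" and F :: "real \<Rightarrow> 'a measure" and B :: "real \<Rightarrow> 'a \<Rightarrow> real" +
  fixes \<xi> :: "'a \<Rightarrow> real" and b \<sigma> b' \<sigma>' :: "real \<Rightarrow> real measure \<Rightarrow> real"
    and h :: "real \<Rightarrow> real" and X X' :: "real \<Rightarrow> 'a \<Rightarrow> real" and K K' :: "real \<Rightarrow> real"
    and L m N T :: real and D :: "'a \<Rightarrow> real"
  assumes sol: "deterministic_flat_solution M F B \<xi> b \<sigma> h X K"
    and sol': "deterministic_flat_solution M F B \<xi> b' \<sigma>' h X' K'"
    and \<xi>: "L2 M \<xi>"
    and lip: "lipschitz_coeffs L b \<sigma>" and lip': "lipschitz_coeffs L b' \<sigma>'" and L: "0 < L"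
    and h_mono: "mono h" and m: "0 < m" "m \<le> N"
    and bilip: "\<And>x y. m * \<bar>x - y\<bar> \<le> \<bar>h x - h y\<bar> \<and> \<bar>h x - h y\<bar> \<le> N * \<bar>x - y\<bar>"
    and T: "0 < T"
    and D: "L2 M D" "\<And>\<omega>. 0 \<le> D \<omega>"
    and close: "\<And>\<omega> s. \<omega> \<in> space M \<Longrightarrow> s \<in> {0..T} \<Longrightarrow>
      \<bar>b' (X s \<omega>) (law M (X s)) - b (X s \<omega>) (law M (X s))\<bar> +
      \<bar>\<sigma>' (X s \<omega>) (law M (X s)) - \<sigma> (X s \<omega>) (law M (X s))\<bar> \<le> D \<omega>"
begin

definition Y :: "real \<Rightarrow> 'a \<Rightarrow> real" where "Y s \<omega> = X' s \<omega> - X s \<omega>"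

lemma Y_L2: "0 \<le> s \<Longrightarrow> L2 M (Y s)"
  unfolding Y_def by (intro L2_diff flat_solution_L2[OF sol] flat_solution_L2[OF sol'])

lemma Y_continuous: "\<omega> \<in> space M \<Longrightarrow> continuous_on {0..} (\<lambda>s. Y s \<omega>)"
  unfolding Y_def using flat_solutionD(2)[OF sol] flat_solutionD(2)[OF sol'] by (intro continuous_on_diff) auto

text \<open>\<open>\<kappa>\<close> collects the Cauchy-Schwarz constant \<open>T\<close> of the drift, the constant 16 of the
  stochastic integral and the factor caused by the compensators.\<close>

definition \<kappa> :: real where "\<kappa> = 2 * (1 + (N / m)\<^sup>2) * (2 * T + 32)"

lemma \<kappa>_pos: "0 < \<kappa>"
  unfolding \<kappa>_def using T by (intro mult_pos_pos) (auto intro: add_pos_nonneg)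

text \<open>An exponential bound on the second moments of \<open>Y\<close> is fed through the
  coefficients and the compensators and comes back as a bound on the expected supremum. Integrating
  \<open>exp (l * s)\<close> produces the factor \<open>1 / l\<close>, which a large rate makes
  small.\<close>

lemma square_bound_step:
  assumes l: "0 < l" and a: "0 \<le> a" and t: "t \<in> {0..T}"
    and Yb: "\<And>s. s \<in> {0..T} \<Longrightarrow> expectation (\<lambda>\<omega>. (Y s \<omega>)\<^sup>2) \<le> a * exp (l * s)"
  shows "(\<integral>\<^sup>+\<omega>. (SUP r\<in>{0..t}. ennreal ((Y r \<omega>)\<^sup>2)) \<partial>M) \<le>
    ennreal (\<kappa> * (6 * L\<^sup>2 * a * (exp (l * t) / l) + 3 * T * expectation (\<lambda>\<omega>. (D \<omega>)\<^sup>2)))"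
proof -
  have t0: "0 \<le> t" "t \<le> T" using t by auto
  \<comment> \<open>A deterministic majorant of the root mean square of \<open>Y s\<close>, hence of
    the Wasserstein distance between the two laws at time \<open>s\<close>.\<close>
  define e where "e s = sqrt a * exp (l * s / 2)" for s
  have e0: "0 \<le> e s" for s using a by (simp add: e_def)
  have e2: "(e s)\<^sup>2 = a * exp (l * s)" for s
    using a by (simp add: e_def power_mult_distrib flip: exp_double)
  \<comment> \<open>Moving from \<open>X'\<close> and its law to \<open>X\<close> and its law inside
    the primed coefficients costs the Lipschitz term; replacing the primed coefficients by the
    others at \<open>X\<close> costs \<open>D\<close>.\<close>
  define f where "f s \<omega> = L * (\<bar>Y s \<omega>\<bar> + e s) + D \<omega>" for s \<omega>
  have f0: "0 \<le> f s \<omega>" for s \<omega> unfolding f_def using L e0 D(2) by (intro add_nonneg_nonneg mult_nonneg_nonneg) auto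
  have absY: "L2 M (\<lambda>\<omega>. \<bar>Y s \<omega>\<bar>)" if "0 \<le> s" for s
    by (rule L2_bound[OF Y_L2[OF that]]) (use L2_measurable[OF Y_L2[OF that]] in auto)
  have const: "L2 M (\<lambda>_. c)" for c by (rule L2_bounded[of _ "\<bar>c\<bar>"]) auto
  have fL: "L2 M (f s)" if "0 \<le> s" for s
    unfolding f_def by (intro L2_add L2_cmult absY that const D)
  have f_cont: "continuous_on {0..} (\<lambda>s. f s \<omega>)" if "\<omega> \<in> space M" for \<omega>
    unfolding f_def e_def by (intro continuous_intros Y_continuous that) simp

  have coef: "\<bar>b' (X' s \<omega>) (law M (X' s)) - b (X s \<omega>) (law M (X s))\<bar> \<le> f s \<omega>"
    "\<bar>\<sigma>' (X' s \<omega>) (law M (X' s)) - \<sigma> (X s \<omega>) (law M (X s))\<bar> \<le> f s \<omega>"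
    if w: "\<omega> \<in> space M" and s: "s \<in> {0..T}" for s \<omega>
  proof -
    have s0: "0 \<le> s" using s by simp
    have "W2 (law M (X' s)) (law M (X s)) \<le> sqrt (expectation (\<lambda>\<omega>. (Y s \<omega>)\<^sup>2))"
      unfolding Y_def by (rule W2_law_le[OF flat_solution_measurable[OF sol' s0] flat_solution_measurable[OF sol s0]])
    also have "\<dots> \<le> sqrt ((e s)\<^sup>2)" unfolding e2 by (rule real_sqrt_le_mono[OF Yb[OF s]])
    finally have W: "W2 (law M (X' s)) (law M (X s)) \<le> e s" using e0 by simp
    have "law M (X' s) \<in> P2" "law M (X s) \<in> P2" using flat_solutionD(3)[OF sol] flat_solutionD(3)[OF sol'] s0 by auto
    then have "\<bar>b' (X' s \<omega>) (law M (X' s)) - b' (X s \<omega>) (law M (X s))\<bar> +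
      \<bar>\<sigma>' (X' s \<omega>) (law M (X' s)) - \<sigma>' (X s \<omega>) (law M (X s))\<bar> \<le>
      L * (\<bar>X' s \<omega> - X s \<omega>\<bar> + W2 (law M (X' s)) (law M (X s)))"
      using lip' unfolding lipschitz_coeffs_def by blast
    also have "\<dots> \<le> L * (\<bar>Y s \<omega>\<bar> + e s)" using W L by (intro mult_left_mono) (auto simp: Y_def)
    finally have "\<bar>b' (X' s \<omega>) (law M (X' s)) - b' (X s \<omega>) (law M (X s))\<bar> +
      \<bar>\<sigma>' (X' s \<omega>) (law M (X' s)) - \<sigma>' (X s \<omega>) (law M (X s))\<bar> \<le> L * (\<bar>Y s \<omega>\<bar> + e s)" .
    with close[OF w s]
    show "\<bar>b' (X' s \<omega>) (law M (X' s)) - b (X s \<omega>) (law M (X s))\<bar> \<le> f s \<omega>"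
      "\<bar>\<sigma>' (X' s \<omega>) (law M (X' s)) - \<sigma> (X s \<omega>) (law M (X s))\<bar> \<le> f s \<omega>"
      unfolding f_def by linarith+
  qed

  define ED where "ED = expectation (\<lambda>\<omega>. (D \<omega>)\<^sup>2)"
  have ED0: "0 \<le> ED" by (simp add: ED_def)
  \<comment> \<open>The three terms of \<open>f\<close> each carry a factor 3 after squaring. Those
    of \<open>Y\<close> and of the Wasserstein distance have the same bound
    \<open>L^2 * a * exp (l * s)\<close>, which gives 6.\<close>
  define p where "p = 6 * L\<^sup>2 * a * (exp (l * t) / l) + 3 * T * ED"
  have p0: "0 \<le> p" unfolding p_def using a l T ED0 by simp
  define \<Phi> where "\<Phi> = (\<integral>\<^sup>+\<omega>. (\<integral>\<^sup>+s\<in>{0..t}. ennreal ((f s \<omega>)\<^sup>2) \<partial>lborel) \<partial>M)"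
  have \<Phi>m: "(\<lambda>\<omega>. \<integral>\<^sup>+s\<in>{0..t}. ennreal ((f s \<omega>)\<^sup>2) \<partial>lborel) \<in> borel_measurable M"
    by (rule continuous_process_Tonelli(2)[OF L2_measurable[OF fL] f_cont])
  have "\<Phi> = (\<integral>\<^sup>+s\<in>{0..t}. (\<integral>\<^sup>+\<omega>. ennreal ((f s \<omega>)\<^sup>2) \<partial>M) \<partial>lborel)"
    unfolding \<Phi>_def by (rule continuous_process_Tonelli(1)[OF L2_measurable[OF fL] f_cont])
  also have "\<dots> \<le> (\<integral>\<^sup>+s. ennreal (indicator {0..t} s *\<^sub>R (6 * L\<^sup>2 * a * exp (l * s) + 3 * ED)) \<partial>lborel)"
  proof (rule nn_integral_mono)
    fix s :: real
    show "(\<integral>\<^sup>+\<omega>. ennreal ((f s \<omega>)\<^sup>2) \<partial>M) * indicator {0..t} s \<le> ennreal (indicator {0..t} s *\<^sub>R (6 * L\<^sup>2 * a * exp (l * s) + 3 * ED))"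
    proof (cases "s \<in> {0..t}")
      case True
      then have s: "0 \<le> s" "s \<in> {0..T}" using t by auto
      have "expectation (\<lambda>\<omega>. (f s \<omega>)\<^sup>2) \<le> expectation (\<lambda>\<omega>. 3 * L\<^sup>2 * (Y s \<omega>)\<^sup>2 + 3 * L\<^sup>2 * (e s)\<^sup>2 + 3 * (D \<omega>)\<^sup>2)"
      proof (rule integral_mono)
        show "integrable M (\<lambda>\<omega>. (f s \<omega>)\<^sup>2)" by (rule L2_square_integrable[OF fL[OF s(1)]])
        show "integrable M (\<lambda>\<omega>. 3 * L\<^sup>2 * (Y s \<omega>)\<^sup>2 + 3 * L\<^sup>2 * (e s)\<^sup>2 + 3 * (D \<omega>)\<^sup>2)"
          using L2_square_integrable[OF Y_L2[OF s(1)]] L2_square_integrable[OF D(1)] by simp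
        fix \<omega>
        show "(f s \<omega>)\<^sup>2 \<le> 3 * L\<^sup>2 * (Y s \<omega>)\<^sup>2 + 3 * L\<^sup>2 * (e s)\<^sup>2 + 3 * (D \<omega>)\<^sup>2"
          using square_add3_mean_le[of "L * \<bar>Y s \<omega>\<bar>" "L * e s" "D \<omega>"]
          by (simp add: f_def distrib_left power_mult_distrib)
      qed
      also have "\<dots> = 3 * L\<^sup>2 * expectation (\<lambda>\<omega>. (Y s \<omega>)\<^sup>2) + 3 * L\<^sup>2 * (e s)\<^sup>2 + 3 * ED"
        using L2_square_integrable[OF Y_L2[OF s(1)]] L2_square_integrable[OF D(1)] by (simp add: prob_space ED_def)
      also have "\<dots> \<le> 3 * L\<^sup>2 * (a * exp (l * s)) + 3 * L\<^sup>2 * (e s)\<^sup>2 + 3 * ED"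
        using Yb[OF s(2)] by (intro add_mono mult_left_mono) auto
      finally have "expectation (\<lambda>\<omega>. (f s \<omega>)\<^sup>2) \<le> 6 * L\<^sup>2 * a * exp (l * s) + 3 * ED" by (simp add: e2 mult_ac)
      then show ?thesis using True by (simp add: L2_nn_integral[OF fL[OF s(1)]] ennreal_leI)
    qed simp
  qed
  also have "\<dots> = ennreal (LINT s:{0..t}|lborel. 6 * L\<^sup>2 * a * exp (l * s) + 3 * ED)"
  proof -
    have "set_integrable lborel {0..t} (\<lambda>s. 6 * L\<^sup>2 * a * exp (l * s) + 3 * ED)"
      by (intro borel_integrable_atLeastAtMost' continuous_intros)
    then show ?thesis unfolding set_lebesgue_integral_def set_integrable_def
      using a ED0 by (intro nn_integral_eq_integral) auto
  qed
  also have "(LINT s:{0..t}|lborel. 6 * L\<^sup>2 * a * exp (l * s) + 3 * ED) \<le> p"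
  proof -
    have "(LINT s:{0..t}|lborel. 6 * L\<^sup>2 * a * exp (l * s) + 3 * ED) =
      (LINT s:{0..t}|lborel. 6 * L\<^sup>2 * a * exp (l * s)) + (LINT s:{0..t}|lborel. 3 * ED)"
      by (intro set_integral_add(2) borel_integrable_atLeastAtMost' continuous_intros)
    also have "(LINT s:{0..t}|lborel. 6 * L\<^sup>2 * a * exp (l * s)) = 6 * L\<^sup>2 * a * (LINT s:{0..t}|lborel. exp (l * s))"
      by simp
    also have "(LINT s:{0..t}|lborel. 3 * ED) = t * (3 * ED)"
      using t0 by (simp add: set_lebesgue_integral_def)
    also have "6 * L\<^sup>2 * a * (LINT s:{0..t}|lborel. exp (l * s)) + t * (3 * ED) \<le> 6 * L\<^sup>2 * a * (exp (l * t) / l) + T * (3 * ED)"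
      using a ED0 t0 by (intro add_mono mult_left_mono mult_right_mono set_integral_exp_le(2)[OF l t0(1)]) auto
    finally show ?thesis by (simp add: p_def)
  qed
  finally have \<Phi>: "\<Phi> \<le> ennreal p" by (simp add: ennreal_leI)

  obtain I where ito: "ito_integral M F B (\<lambda>s \<omega>. \<sigma> (X s \<omega>) (law M (X s))) I"
    and eq: "AE \<omega> in M. \<forall>t\<ge>0. set_integrable lborel {0..t} (\<lambda>s. b (X s \<omega>) (law M (X s))) \<and>
          X t \<omega> = \<xi> \<omega> + (LINT s:{0..t}|lborel. b (X s \<omega>) (law M (X s))) + I t \<omega> + K t"
    using flat_solutionD(9)[OF sol] by (elim exE conjE)
  obtain I' where ito': "ito_integral M F B (\<lambda>s \<omega>. \<sigma>' (X' s \<omega>) (law M (X' s))) I'"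
    and eq': "AE \<omega> in M. \<forall>t\<ge>0. set_integrable lborel {0..t} (\<lambda>s. b' (X' s \<omega>) (law M (X' s))) \<and>
          X' t \<omega> = \<xi> \<omega> + (LINT s:{0..t}|lborel. b' (X' s \<omega>) (law M (X' s))) + I' t \<omega> + K' t"
    using flat_solutionD(9)[OF sol'] by (elim exE conjE)
  obtain Q where Qm: "Q \<in> borel_measurable M"
    and QI: "AE \<omega> in M. \<forall>r\<in>{0..t}. ennreal ((I' r \<omega> - I r \<omega>)\<^sup>2) \<le> Q \<omega>"
    and Q16: "(\<integral>\<^sup>+\<omega>. Q \<omega> \<partial>M) \<le> 16 * (\<integral>\<^sup>+\<omega>. (\<integral>\<^sup>+s\<in>{0..t}.
      ennreal ((\<sigma>' (X' s \<omega>) (law M (X' s)) - \<sigma> (X s \<omega>) (law M (X s)))\<^sup>2) \<partial>lborel) \<partial>M)"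
    by (rule ito_difference_sup_bound[OF ito' ito t0(1)])
  note Q16
  also have "(\<integral>\<^sup>+\<omega>. (\<integral>\<^sup>+s\<in>{0..t}. ennreal ((\<sigma>' (X' s \<omega>) (law M (X' s)) - \<sigma> (X s \<omega>) (law M (X s)))\<^sup>2) \<partial>lborel) \<partial>M) \<le> \<Phi>"
    unfolding \<Phi>_def
  proof (intro nn_integral_mono)
    fix \<omega> and s :: real assume w: "\<omega> \<in> space M"
    show "ennreal ((\<sigma>' (X' s \<omega>) (law M (X' s)) - \<sigma> (X s \<omega>) (law M (X s)))\<^sup>2) * indicator {0..t} s \<le> ennreal ((f s \<omega>)\<^sup>2) * indicator {0..t} s"
    proof (cases "s \<in> {0..t}")
      case True
      then have "\<bar>\<sigma>' (X' s \<omega>) (law M (X' s)) - \<sigma> (X s \<omega>) (law M (X s))\<bar> \<le> f s \<omega>" using t by (intro coef(2)[OF w]) auto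
      then have "(\<sigma>' (X' s \<omega>) (law M (X' s)) - \<sigma> (X s \<omega>) (law M (X s)))\<^sup>2 \<le> (f s \<omega>)\<^sup>2"
        by (metis abs_ge_zero power2_abs power_mono)
      then show ?thesis by (intro mult_right_mono ennreal_leI) auto
    qed simp
  qed
  finally have Q\<Phi>: "(\<integral>\<^sup>+\<omega>. Q \<omega> \<partial>M) \<le> 16 * \<Phi>" by (simp add: mult_left_mono)

  define G where "G \<omega> = 2 * (ennreal T * (\<integral>\<^sup>+s\<in>{0..t}. ennreal ((f s \<omega>)\<^sup>2) \<partial>lborel)) + 2 * Q \<omega>" for \<omega>
  have Gm: "G \<in> borel_measurable M" unfolding G_def using \<Phi>m Qm by measurable
  \<comment> \<open>\<open>2 * T\<close> belongs to the drift by Cauchy-Schwarz, and 32 is twice the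
    constant 16 of the stochastic integral.\<close>
  define q where "q = (2 * T + 32) * p"
  have q0: "0 \<le> q" unfolding q_def using T p0 by simp
  have "(\<integral>\<^sup>+\<omega>. G \<omega> \<partial>M) = 2 * (ennreal T * \<Phi>) + 2 * (\<integral>\<^sup>+\<omega>. Q \<omega> \<partial>M)"
    unfolding G_def \<Phi>_def using \<Phi>m Qm by (simp add: nn_integral_add nn_integral_cmult)
  also have "\<dots> \<le> 2 * (ennreal T * ennreal p) + 2 * (16 * ennreal p)"
    by (intro add_mono mult_left_mono \<Phi> order_trans[OF Q\<Phi>]) auto
  also have "\<dots> = ennreal (2 * (T * p) + 2 * (16 * p))"
    using T p0 by (simp add: ennreal_plus ennreal_mult)
  also have "2 * (T * p) + 2 * (16 * p) = q" by (simp add: q_def algebra_simps)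
  finally have Gq: "(\<integral>\<^sup>+\<omega>. G \<omega> \<partial>M) \<le> ennreal q" .

  define V where "V r \<omega> = Y r \<omega> - (K' r - K r)" for r \<omega>
  have VG: "AE \<omega> in M. \<forall>r\<in>{0..t}. ennreal ((V r \<omega>)\<^sup>2) \<le> G \<omega>"
    using eq eq' QI AE_space
  proof eventually_elim
    case (elim \<omega>)
    note w = elim(4)
    show ?case
    proof
      fix r assume r: "r \<in> {0..t}"
      then have r0: "0 \<le> r" by simp
      let ?db = "\<lambda>s. b' (X' s \<omega>) (law M (X' s)) - b (X s \<omega>) (law M (X s))"
      let ?J = "LINT s:{0..r}|lborel. ?db s" and ?F = "LINT s:{0..r}|lborel. f s \<omega>"
      have bi: "set_integrable lborel {0..r} (\<lambda>s. b (X s \<omega>) (law M (X s)))"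
        "set_integrable lborel {0..r} (\<lambda>s. b' (X' s \<omega>) (law M (X' s)))" using elim(1,2) r0 by blast+
      have e1: "X r \<omega> = \<xi> \<omega> + (LINT s:{0..r}|lborel. b (X s \<omega>) (law M (X s))) + I r \<omega> + K r" using elim(1) r0 by blast
      have e1': "X' r \<omega> = \<xi> \<omega> + (LINT s:{0..r}|lborel. b' (X' s \<omega>) (law M (X' s))) + I' r \<omega> + K' r" using elim(2) r0 by blast
      have J: "?J = (LINT s:{0..r}|lborel. b' (X' s \<omega>) (law M (X' s))) - (LINT s:{0..r}|lborel. b (X s \<omega>) (law M (X s)))"
        by (rule set_integral_diff(2)[OF bi(2) bi(1)])
      have Veq: "V r \<omega> = ?J + (I' r \<omega> - I r \<omega>)" unfolding V_def Y_def J using e1 e1' by linarith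
      have fc: "continuous_on {0..t} (\<lambda>s. f s \<omega>)" using f_cont[OF w] by (rule continuous_on_subset) auto
      have dbi: "set_integrable lborel {0..r} ?db" by (rule set_integral_diff(1)[OF bi(2) bi(1)])
      have "\<bar>?J\<bar> \<le> (LINT s:{0..r}|lborel. \<bar>?db s\<bar>)" using set_integral_norm_bound[OF dbi] by simp
      also have "\<dots> \<le> ?F"
      proof (rule set_integral_mono)
        show "set_integrable lborel {0..r} (\<lambda>s. \<bar>?db s\<bar>)" by (rule set_integrable_abs[OF dbi])
        show "set_integrable lborel {0..r} (\<lambda>s. f s \<omega>)"
          by (rule borel_integrable_atLeastAtMost'[OF continuous_on_subset[OF fc]]) (use r in auto)
        show "\<bar>?db s\<bar> \<le> f s \<omega>" if "s \<in> {0..r}" for s using that r t by (intro coef(1)[OF w]) auto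
      qed
      finally have "?J\<^sup>2 \<le> ?F\<^sup>2" by (rule square_le_of_abs_le)
      then have "(V r \<omega>)\<^sup>2 \<le> 2 * ?F\<^sup>2 + 2 * (I' r \<omega> - I r \<omega>)\<^sup>2"
        unfolding Veq using square_add_le[of ?J "I' r \<omega> - I r \<omega>"] by linarith
      then have "ennreal ((V r \<omega>)\<^sup>2) \<le> ennreal (2 * ?F\<^sup>2 + 2 * (I' r \<omega> - I r \<omega>)\<^sup>2)" by (rule ennreal_leI)
      also have "\<dots> = 2 * ennreal (?F\<^sup>2) + 2 * ennreal ((I' r \<omega> - I r \<omega>)\<^sup>2)"
        by (simp add: ennreal_plus ennreal_mult)
      also have "\<dots> \<le> G \<omega>" unfolding G_def
      proof (intro add_mono mult_left_mono)
        show "ennreal (?F\<^sup>2) \<le> ennreal T * (\<integral>\<^sup>+s\<in>{0..t}. ennreal ((f s \<omega>)\<^sup>2) \<partial>lborel)"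
          by (rule square_set_integral_le[OF fc]) (use r t f0 in auto)
        show "ennreal ((I' r \<omega> - I r \<omega>)\<^sup>2) \<le> Q \<omega>" using elim(3) r by blast
      qed auto
      finally show "ennreal ((V r \<omega>)\<^sup>2) \<le> G \<omega>" .
    qed
  qed
  have const: "L2 M (\<lambda>_. c)" for c by (rule L2_bounded[of _ "\<bar>c\<bar>"]) auto
  have VL: "L2 M (V r)" if "0 \<le> r" for r unfolding V_def by (intro L2_diff Y_L2 that const)
  have EV: "expectation (\<lambda>\<omega>. (V r \<omega>)\<^sup>2) \<le> q" if r: "r \<in> {0..t}" for r
  proof -
    have "ennreal (expectation (\<lambda>\<omega>. (V r \<omega>)\<^sup>2)) = (\<integral>\<^sup>+\<omega>. ennreal ((V r \<omega>)\<^sup>2) \<partial>M)"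
      using L2_nn_integral[OF VL] r by simp
    also have "\<dots> \<le> (\<integral>\<^sup>+\<omega>. G \<omega> \<partial>M)"
      using VG by (intro nn_integral_mono_AE) (use r in \<open>auto elim: eventually_mono\<close>)
    also have "\<dots> \<le> ennreal q" by (rule Gq)
    finally show ?thesis using q0 by (simp add: ennreal_le_iff)
  qed
  \<comment> \<open>Exchanging the solutions only changes the sign of \<open>V\<close>, so the
    one-sided comparison applies in both directions with the same \<open>q\<close>.\<close>
  have KK: "\<bar>K' r - K r\<bar> \<le> N / m * sqrt q" if r: "r \<in> {0..t}" for r
  proof -
    have r0: "0 \<le> r" using r by simp
    have "K' r - K r \<le> N / m * sqrt q"
    proof (rule compensator_bound[OF sol' sol h_mono m bilip r0 q0])
      fix u assume "u \<in> {0..r}"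
      then show "expectation (\<lambda>\<omega>. (X' u \<omega> - X u \<omega> - (K' u - K u))\<^sup>2) \<le> q"
        using EV[of u] r unfolding V_def Y_def by simp
    qed
    moreover have "K r - K' r \<le> N / m * sqrt q"
    proof (rule compensator_bound[OF sol sol' h_mono m bilip r0 q0])
      fix u assume u: "u \<in> {0..r}"
      have "(X u \<omega> - X' u \<omega> - (K u - K' u))\<^sup>2 = (V u \<omega>)\<^sup>2" for \<omega>
        unfolding V_def Y_def by (simp add: power2_eq_square algebra_simps)
      then show "expectation (\<lambda>\<omega>. (X u \<omega> - X' u \<omega> - (K u - K' u))\<^sup>2) \<le> q"
        using EV[of u] u r by simp
    qed
    ultimately show ?thesis by linarith
  qed
  define c where "c = 2 * ((N / m)\<^sup>2 * q)"
  have c0: "0 \<le> c" unfolding c_def using q0 by simp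
  have "AE \<omega> in M. (SUP r\<in>{0..t}. ennreal ((Y r \<omega>)\<^sup>2)) \<le> 2 * G \<omega> + ennreal c"
    using VG
  proof eventually_elim
    case (elim \<omega>)
    show ?case
    proof (rule SUP_least)
      fix r assume r: "r \<in> {0..t}"
      have "(K' r - K r)\<^sup>2 \<le> (N / m * sqrt q)\<^sup>2" using KK[OF r] by (metis abs_ge_zero power2_abs power_mono)
      also have "\<dots> = (N / m)\<^sup>2 * q" using q0 by (simp only: power_mult_distrib real_sqrt_pow2)
      finally have "(Y r \<omega>)\<^sup>2 \<le> 2 * (V r \<omega>)\<^sup>2 + c"
        unfolding c_def using square_add_le[of "V r \<omega>" "K' r - K r"] by (simp add: V_def)
      then have "ennreal ((Y r \<omega>)\<^sup>2) \<le> ennreal (2 * (V r \<omega>)\<^sup>2 + c)" by (rule ennreal_leI)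
      also have "\<dots> = 2 * ennreal ((V r \<omega>)\<^sup>2) + ennreal c" using c0 by (simp add: ennreal_plus ennreal_mult)
      also have "\<dots> \<le> 2 * G \<omega> + ennreal c" using elim r by (intro add_mono mult_left_mono) auto
      finally show "ennreal ((Y r \<omega>)\<^sup>2) \<le> 2 * G \<omega> + ennreal c" .
    qed
  qed
  then have "(\<integral>\<^sup>+\<omega>. (SUP r\<in>{0..t}. ennreal ((Y r \<omega>)\<^sup>2)) \<partial>M) \<le> (\<integral>\<^sup>+\<omega>. 2 * G \<omega> + ennreal c \<partial>M)"
    by (rule nn_integral_mono_AE)
  also have "\<dots> = 2 * (\<integral>\<^sup>+\<omega>. G \<omega> \<partial>M) + ennreal c"
    using Gm by (simp add: nn_integral_add nn_integral_cmult emeasure_space_1)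
  also have "\<dots> \<le> 2 * ennreal q + ennreal c" using Gq by (intro add_mono mult_left_mono) auto
  also have "\<dots> = ennreal (2 * q + c)" using q0 c0 by (simp add: ennreal_plus ennreal_mult)
  also have "2 * q + c = \<kappa> * p" by (simp add: c_def q_def \<kappa>_def algebra_simps)
  finally show ?thesis by (simp add: p_def ED_def)
qed

text \<open>With the weight \<open>exp (- l * t)\<close> for \<open>l = 12 * \<kappa> * L\<^sup>2\<close>, the preceding estimate bounds the
  weighted supremum by half of itself plus a constant; no integral form of Gronwall's lemma is needed.\<close>

theorem stability_estimate:
  "(\<integral>\<^sup>+\<omega>. (SUP r\<in>{0..T}. ennreal ((Y r \<omega>)\<^sup>2)) \<partial>M) \<le>
    ennreal (3 * \<kappa> * T * (exp (12 * \<kappa> * L\<^sup>2 * T) + 1) * expectation (\<lambda>\<omega>. (D \<omega>)\<^sup>2))"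
proof -
  define l where "l = 12 * \<kappa> * L\<^sup>2"
  have l: "0 < l" unfolding l_def using \<kappa>_pos L by simp
  define d where "d = 3 * \<kappa> * T * expectation (\<lambda>\<omega>. (D \<omega>)\<^sup>2)"
  have d0: "0 \<le> d" unfolding d_def using \<kappa>_pos T by simp
  have step: "(\<integral>\<^sup>+\<omega>. (SUP r\<in>{0..t}. ennreal ((Y r \<omega>)\<^sup>2)) \<partial>M) \<le> ennreal (a / 2 * exp (l * t) + d)"
    if "0 \<le> a" "t \<in> {0..T}" "\<And>s. s \<in> {0..T} \<Longrightarrow> expectation (\<lambda>\<omega>. (Y s \<omega>)\<^sup>2) \<le> a * exp (l * s)" for a t
  proof -
    have "\<kappa> * (6 * L\<^sup>2 * a * (exp (l * t) / l) + 3 * T * expectation (\<lambda>\<omega>. (D \<omega>)\<^sup>2)) = (6 * \<kappa> * L\<^sup>2 / l) * a * exp (l * t) + d"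
      by (simp add: d_def algebra_simps)
    also have "6 * \<kappa> * L\<^sup>2 / l = 1 / 2" using \<kappa>_pos L by (simp add: l_def)
    finally show ?thesis using square_bound_step[OF l that] by simp
  qed
  have T0: "0 \<le> T" using T by simp
  \<comment> \<open>The two majorants guarantee that the weighted supremum \<open>a\<close> of
    second moments is finite, without which it could not be subtracted from both sides.\<close>
  obtain S where S: "L2 M S" "\<And>\<omega> t. \<omega> \<in> space M \<Longrightarrow> t \<in> {0..T} \<Longrightarrow> \<bar>X t \<omega>\<bar> \<le> S \<omega>"
    using flat_solution_sup_L2[OF sol \<xi> lip L T0] by blast
  obtain S' where S': "L2 M S'" "\<And>\<omega> t. \<omega> \<in> space M \<Longrightarrow> t \<in> {0..T} \<Longrightarrow> \<bar>X' t \<omega>\<bar> \<le> S' \<omega>"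
    using flat_solution_sup_L2[OF sol' \<xi> lip' L T0] by blast
  let ?y = "\<lambda>s. expectation (\<lambda>\<omega>. (Y s \<omega>)\<^sup>2)"
  have yb: "?y s \<le> expectation (\<lambda>\<omega>. (S \<omega> + S' \<omega>)\<^sup>2)" if s: "s \<in> {0..T}" for s
  proof (rule integral_mono)
    show "integrable M (\<lambda>\<omega>. (Y s \<omega>)\<^sup>2)" using L2_square_integrable[OF Y_L2] s by simp
    show "integrable M (\<lambda>\<omega>. (S \<omega> + S' \<omega>)\<^sup>2)" by (rule L2_square_integrable[OF L2_add[OF S(1) S'(1)]])
    fix \<omega> assume "\<omega> \<in> space M"
    then have "\<bar>Y s \<omega>\<bar> \<le> S \<omega> + S' \<omega>" using S(2)[of \<omega> s] S'(2)[of \<omega> s] s unfolding Y_def by linarith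
    then show "(Y s \<omega>)\<^sup>2 \<le> (S \<omega> + S' \<omega>)\<^sup>2" by (metis abs_ge_zero power2_abs power_mono)
  qed
  define a where "a = (SUP s\<in>{0..T}. ?y s * exp (- (l * s)))"
  have bdd: "bdd_above ((\<lambda>s. ?y s * exp (- (l * s))) ` {0..T})"
  proof (rule bdd_aboveI2)
    fix s assume s: "s \<in> {0..T}"
    have "?y s * exp (- (l * s)) \<le> ?y s * 1" using s l by (intro mult_left_mono) auto
    then show "?y s * exp (- (l * s)) \<le> expectation (\<lambda>\<omega>. (S \<omega> + S' \<omega>)\<^sup>2)" using yb[OF s] by simp
  qed
  have a_upper: "?y s * exp (- (l * s)) \<le> a" if "s \<in> {0..T}" for s
    unfolding a_def by (rule cSUP_upper[OF that bdd])
  have ya: "?y s \<le> a * exp (l * s)" if "s \<in> {0..T}" for s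
    using a_upper[OF that] by (simp add: exp_minus field_simps)
  have a0: "0 \<le> a" using a_upper[of 0] T0 by (auto intro: order_trans[rotated])
  have "a \<le> a / 2 + d"
    unfolding a_def
  proof (rule cSUP_least)
    show "{0..T} \<noteq> {}" using T0 by simp
    fix s assume s: "s \<in> {0..T}"
    have s0: "0 \<le> s" using s by simp
    have "ennreal (?y s) = (\<integral>\<^sup>+\<omega>. ennreal ((Y s \<omega>)\<^sup>2) \<partial>M)" by (rule L2_nn_integral[OF Y_L2[OF s0], symmetric])
    also have "\<dots> \<le> (\<integral>\<^sup>+\<omega>. (SUP r\<in>{0..s}. ennreal ((Y r \<omega>)\<^sup>2)) \<partial>M)"
      using s0 by (intro nn_integral_mono SUP_upper) auto
    also have "\<dots> \<le> ennreal (a / 2 * exp (l * s) + d)" by (rule step[OF a0 s ya])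
    finally have "ennreal (?y s) \<le> ennreal (a / 2 * exp (l * s) + d)" .
    moreover have "0 \<le> a / 2 * exp (l * s) + d" using a0 d0 by simp
    ultimately have "?y s \<le> a / 2 * exp (l * s) + d" by (simp only: ennreal_le_iff)
    then have "?y s * exp (- (l * s)) \<le> (a / 2 * exp (l * s) + d) * exp (- (l * s))" by (intro mult_right_mono) auto
    also have "\<dots> = a / 2 + d * exp (- (l * s))" by (simp add: exp_minus field_simps)
    also have "\<dots> \<le> a / 2 + d * 1" using s0 l d0 by (intro add_left_mono mult_left_mono) auto
    finally show "?y s * exp (- (l * s)) \<le> (SUP s\<in>{0..T}. ?y s * exp (- (l * s))) / 2 + d" unfolding a_def by simp
  qed
  \<comment> \<open>The second moments are now bounded; one more use of the step at the final time
    upgrades this to the expected supremum.\<close>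
  then have "a / 2 \<le> d" by simp
  then have "a / 2 * exp (l * T) + d \<le> d * exp (l * T) + d" by (intro add_right_mono mult_right_mono) auto
  also have "\<dots> = 3 * \<kappa> * T * (exp (l * T) + 1) * expectation (\<lambda>\<omega>. (D \<omega>)\<^sup>2)" by (simp add: d_def algebra_simps)
  finally show ?thesis unfolding l_def[symmetric]
    using order_trans[OF step[OF a0 _ ya, of T] ennreal_leI] T0 by simp
qed

end

text \<open>The order of choices matters: the stability constant depends on neither \<open>n\<close>
  nor the radius, so \<open>R\<close> is fixed from the tail of \<open>S\<close> alone, then
  \<open>\<delta>\<close>, and only then is \<open>n\<close> taken large.\<close>

theorem theorem5p2:
  fixes M :: "'a measure" and F :: "real \<Rightarrow> 'a measure" and B :: "real \<Rightarrow> 'a \<Rightarrow> real"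
    and b \<sigma> :: "real \<Rightarrow> real measure \<Rightarrow> real"
    and bn \<sigma>n :: "nat \<Rightarrow> real \<Rightarrow> real measure \<Rightarrow> real"
    and h :: "real \<Rightarrow> real" and \<xi> :: "'a \<Rightarrow> real"
    and X :: "real \<Rightarrow> 'a \<Rightarrow> real" and K :: "real \<Rightarrow> real"
    and Xn :: "nat \<Rightarrow> real \<Rightarrow> 'a \<Rightarrow> real" and Kn :: "nat \<Rightarrow> real \<Rightarrow> real"
    and L m N T :: real
  assumes space: "complete_filtered_prob_space M F"
    and BM: "brownian_motion M F B"
    and L_pos: "0 < L"
    and lip: "lipschitz_coeffs L b \<sigma>"
    and lip_n: "\<And>n. 1 \<le> n \<Longrightarrow> lipschitz_coeffs L (bn n) (\<sigma>n n)"
    and h_mono: "mono h"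
    and mN: "0 < m" "m \<le> N"
    and h_bilip: "\<And>x y. m * \<bar>x - y\<bar> \<le> \<bar>h x - h y\<bar> \<and> \<bar>h x - h y\<bar> \<le> N * \<bar>x - y\<bar>"
    and xi_meas: "\<xi> \<in> borel_measurable (F 0)"
    and xi_L2: "integrable M (\<lambda>\<omega>. (\<xi> \<omega>)\<^sup>2)"
    and xi_h: "0 \<le> (\<integral>\<omega>. h (\<xi> \<omega>) \<partial>M)"
    and conv: "\<And>D. compact D \<Longrightarrow>
      (\<lambda>n. SUP x\<in>D. SUP \<mu>\<in>P2. ennreal (\<bar>bn n x \<mu> - b x \<mu>\<bar> + \<bar>\<sigma>n n x \<mu> - \<sigma> x \<mu>\<bar>))
        \<longlonglongrightarrow> 0"
    and sol: "deterministic_flat_solution M F B \<xi> b \<sigma> h X K"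
    and sol_n: "\<And>n. 1 \<le> n \<Longrightarrow>
      deterministic_flat_solution M F B \<xi> (bn n) (\<sigma>n n) h (Xn n) (Kn n)"
    and T_pos: "0 < T"
  shows "(\<lambda>n. \<integral>\<^sup>+\<omega>. (SUP t\<in>{0..T}. ennreal (\<bar>Xn n t \<omega> - X t \<omega>\<bar>\<^sup>2)) \<partial>M) \<longlonglongrightarrow> 0"
proof -
  interpret filtered_brownian_motion M F B
    using space BM by (intro filtered_brownian_motion.intro filtered_brownian_motion_axioms.intro)
  have \<xi>: "L2 M \<xi>" using F_measurable_M[OF _ xi_meas] xi_L2 by (simp add: L2_def)
  obtain S where S: "L2 M S" "\<And>\<omega> t. \<omega> \<in> Sigma_Algebra.space M \<Longrightarrow> t \<in> {0..T} \<Longrightarrow> \<bar>X t \<omega>\<bar> \<le> S \<omega>"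
    using flat_solution_sup_L2[OF sol \<xi> lip L_pos] T_pos by (metis less_imp_le)
  note Sm = L2_measurable[OF S(1)]
  \<comment> \<open>Beyond radius \<open>R\<close> the coefficients are compared with their values
    at the origin. Each of the two pairs moves by at most \<open>L * \<bar>S \<omega>\<bar>\<close>,
    hence the factor 2.\<close>
  define tail where "tail R \<omega> = 2 * L * \<bar>S \<omega>\<bar> * indicator {\<omega>. real R < S \<omega>} \<omega>" for R :: nat and \<omega>
  have tailm: "tail R \<in> borel_measurable M" for R
  proof -
    have "tail R = (\<lambda>\<omega>. 2 * L * \<bar>S \<omega>\<bar> * (if real R < S \<omega> then 1 else 0))" by (auto simp: tail_def fun_eq_iff)
    then show ?thesis using Sm by simp
  qed
  have tailL: "L2 M (tail R)" for R
    by (rule L2_bound[OF L2_cmult[OF S(1), of "2 * L"] tailm]) (auto simp: tail_def power_mult_distrib indicator_def)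
  have "(\<lambda>R. expectation (\<lambda>\<omega>. (tail R \<omega>)\<^sup>2)) \<longlonglongrightarrow> expectation (\<lambda>\<omega>. 0)"
  proof (rule integral_dominated_convergence)
    show "integrable M (\<lambda>\<omega>. (2 * L * S \<omega>)\<^sup>2)" by (rule L2_square_integrable[OF L2_cmult[OF S(1)]])
    show "(\<lambda>\<omega>. (tail R \<omega>)\<^sup>2) \<in> borel_measurable M" for R using tailm by simp
    show "AE \<omega> in M. norm ((tail R \<omega>)\<^sup>2) \<le> (2 * L * S \<omega>)\<^sup>2" for R
      by (rule AE_I2) (auto simp: tail_def power_mult_distrib indicator_def)
    show "AE \<omega> in M. (\<lambda>R. (tail R \<omega>)\<^sup>2) \<longlonglongrightarrow> 0"
    proof (rule AE_I2)
      fix \<omega>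
      obtain R0 :: nat where "S \<omega> \<le> real R0" using real_arch_simple by blast
      then have "\<forall>\<^sub>F R in sequentially. (tail R \<omega>)\<^sup>2 = 0"
        unfolding eventually_sequentially by (intro exI[of _ R0]) (auto simp: tail_def)
      then show "(\<lambda>R. (tail R \<omega>)\<^sup>2) \<longlonglongrightarrow> 0" by (rule tendsto_eventually)
    qed
  qed simp
  then have tail0: "(\<lambda>R. expectation (\<lambda>\<omega>. (tail R \<omega>)\<^sup>2)) \<longlonglongrightarrow> 0" by simp
  \<comment> \<open>This repeats \<open>\<kappa>\<close> outside the locale: the locale is
    instantiated separately for each \<open>n\<close>, but the constant must be available before
    \<open>n\<close> is chosen.\<close>
  define k where "k = 2 * (1 + (N / m)\<^sup>2) * (2 * T + 32)"
  define C where "C = 3 * k * T * (exp (12 * k * L\<^sup>2 * T) + 1)"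
  have k0: "0 \<le> k" unfolding k_def using T_pos by simp
  have C0: "0 < C + 1" unfolding C_def using k0 T_pos by (intro add_nonneg_pos mult_nonneg_nonneg) (auto intro: add_nonneg_nonneg)
  have C0': "0 \<le> C" unfolding C_def using k0 T_pos by (intro mult_nonneg_nonneg) (auto intro: add_nonneg_nonneg)
  show ?thesis
  proof (rule order_tendstoI)
    fix y :: ennreal assume "0 < y"
    then obtain \<epsilon> where \<epsilon>: "0 < \<epsilon>" "ennreal \<epsilon> < y"
      by (metis dense ennreal_cases ennreal_less_zero_iff linorder_not_less top.not_eq_extremum top_greatest)
    have "\<forall>\<^sub>F R in sequentially. expectation (\<lambda>\<omega>. (tail R \<omega>)\<^sup>2) < \<epsilon> / (4 * (C + 1))"
      by (rule order_tendstoD(2)[OF tail0]) (use \<epsilon> C0 in simp)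
    then obtain R where R: "expectation (\<lambda>\<omega>. (tail R \<omega>)\<^sup>2) < \<epsilon> / (4 * (C + 1))"
      by (auto dest: eventually_happens)
    \<comment> \<open>With \<open>D^2 \<le> 2 * \<delta>^2 + 2 * tail^2\<close>, allotting
      \<open>\<epsilon> / (4 * (C + 1))\<close> to each part gives a total of
      \<open>\<epsilon> / (C + 1)\<close>. Using \<open>C + 1\<close> keeps the denominator
      positive.\<close>
    define \<delta> where "\<delta> = sqrt (\<epsilon> / (4 * (C + 1)))"
    have \<delta>: "0 < \<delta>" "\<delta>\<^sup>2 = \<epsilon> / (4 * (C + 1))" using \<epsilon> C0 by (simp_all add: \<delta>_def)
    have "\<forall>\<^sub>F n in sequentially. (SUP x\<in>{- real R..real R}. SUP \<mu>\<in>P2.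
        ennreal (\<bar>bn n x \<mu> - b x \<mu>\<bar> + \<bar>\<sigma>n n x \<mu> - \<sigma> x \<mu>\<bar>)) < ennreal \<delta>"
      by (rule order_tendstoD(2)[OF conv]) (use \<delta> in simp_all)
    then show "\<forall>\<^sub>F n in sequentially. (\<integral>\<^sup>+\<omega>. (SUP t\<in>{0..T}. ennreal (\<bar>Xn n t \<omega> - X t \<omega>\<bar>\<^sup>2)) \<partial>M) < y"
      using eventually_ge_at_top[of 1]
    proof eventually_elim
      case (elim n)
      have near: "\<bar>bn n x \<mu> - b x \<mu>\<bar> + \<bar>\<sigma>n n x \<mu> - \<sigma> x \<mu>\<bar> \<le> \<delta>"
        if "x \<in> {- real R..real R}" "\<mu> \<in> P2" for x \<mu>
      proof -
        have "ennreal (\<bar>bn n x \<mu> - b x \<mu>\<bar> + \<bar>\<sigma>n n x \<mu> - \<sigma> x \<mu>\<bar>) \<le>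
          (SUP x\<in>{- real R..real R}. SUP \<mu>\<in>P2. ennreal (\<bar>bn n x \<mu> - b x \<mu>\<bar> + \<bar>\<sigma>n n x \<mu> - \<sigma> x \<mu>\<bar>))"
          by (intro SUP_upper2[OF that(1)] SUP_upper2[OF that(2)] order_refl)
        also have "\<dots> \<le> ennreal \<delta>" using elim(1) by (rule less_imp_le)
        finally show ?thesis using less_imp_le[OF \<delta>(1)] by (simp only: ennreal_le_iff)
      qed
      define D where "D \<omega> = \<delta> + tail R \<omega>" for \<omega>
      have tail_nonneg: "0 \<le> tail R \<omega>" for \<omega> using L_pos by (simp add: tail_def)
      have DL: "L2 M D" unfolding D_def by (intro L2_add tailL L2_bounded[of _ "\<bar>\<delta>\<bar>"]) auto
      interpret two_flat_solutions M F B \<xi> b \<sigma> "bn n" "\<sigma>n n" h X "Xn n" K "Kn n" L m N T D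
      proof unfold_locales
        show "deterministic_flat_solution M F B \<xi> (bn n) (\<sigma>n n) h (Xn n) (Kn n)" by (rule sol_n[OF elim(2)])
        show "lipschitz_coeffs L (bn n) (\<sigma>n n)" by (rule lip_n[OF elim(2)])
        show "0 \<le> D \<omega>" for \<omega> unfolding D_def using \<delta>(1) tail_nonneg[of \<omega>] by linarith
        fix \<omega> s assume w: "\<omega> \<in> Sigma_Algebra.space M" and s: "s \<in> {0..T}"
        then have s0: "0 \<le> s" by simp
        let ?\<mu> = "law M (X s)"
        have P2: "?\<mu> \<in> P2" using flat_solutionD(3)[OF sol] s0 by blast
        have XS: "\<bar>X s \<omega>\<bar> \<le> S \<omega>" by (rule S(2)[OF w s])
        show "\<bar>bn n (X s \<omega>) ?\<mu> - b (X s \<omega>) ?\<mu>\<bar> + \<bar>\<sigma>n n (X s \<omega>) ?\<mu> - \<sigma> (X s \<omega>) ?\<mu>\<bar> \<le> D \<omega>"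
        proof (cases "S \<omega> \<le> real R")
          case True
          then have "X s \<omega> \<in> {- real R..real R}" using XS by auto
          from near[OF this P2] show ?thesis unfolding D_def using tail_nonneg[of \<omega>] by linarith
        next
          case False
          \<comment> \<open>The origin lies in the interval for every \<open>R\<close>, and the
            convergence is uniform over all measures, so it applies to the law of
            \<open>X s\<close>.\<close>
          have 0: "\<bar>bn n 0 ?\<mu> - b 0 ?\<mu>\<bar> + \<bar>\<sigma>n n 0 ?\<mu> - \<sigma> 0 ?\<mu>\<bar> \<le> \<delta>" by (rule near[OF _ P2]) simp
          have L0: "0 \<le> L" using L_pos by simp
          note same = lipschitz_same_law[OF _ L0 flat_solution_measurable[OF sol s0] P2, of _ _ "X s \<omega>" 0]
          have 1: "\<bar>b (X s \<omega>) ?\<mu> - b 0 ?\<mu>\<bar> + \<bar>\<sigma> (X s \<omega>) ?\<mu> - \<sigma> 0 ?\<mu>\<bar> \<le> L * \<bar>X s \<omega>\<bar>"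
            using same[OF lip] by simp
          have 2: "\<bar>bn n (X s \<omega>) ?\<mu> - bn n 0 ?\<mu>\<bar> + \<bar>\<sigma>n n (X s \<omega>) ?\<mu> - \<sigma>n n 0 ?\<mu>\<bar> \<le> L * \<bar>X s \<omega>\<bar>"
            using same[OF lip_n[OF elim(2)]] by simp
          have 3: "L * \<bar>X s \<omega>\<bar> \<le> L * \<bar>S \<omega>\<bar>" using XS L0 by (intro mult_left_mono) auto
          have tri: "\<bar>u - v\<bar> \<le> \<bar>u - u'\<bar> + \<bar>u' - v'\<bar> + \<bar>v - v'\<bar>" for u v u' v' :: real by linarith
          have "\<bar>bn n (X s \<omega>) ?\<mu> - b (X s \<omega>) ?\<mu>\<bar> + \<bar>\<sigma>n n (X s \<omega>) ?\<mu> - \<sigma> (X s \<omega>) ?\<mu>\<bar> \<le>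
            (\<bar>bn n (X s \<omega>) ?\<mu> - bn n 0 ?\<mu>\<bar> + \<bar>bn n 0 ?\<mu> - b 0 ?\<mu>\<bar> + \<bar>b (X s \<omega>) ?\<mu> - b 0 ?\<mu>\<bar>) +
            (\<bar>\<sigma>n n (X s \<omega>) ?\<mu> - \<sigma>n n 0 ?\<mu>\<bar> + \<bar>\<sigma>n n 0 ?\<mu> - \<sigma> 0 ?\<mu>\<bar> + \<bar>\<sigma> (X s \<omega>) ?\<mu> - \<sigma> 0 ?\<mu>\<bar>)"
            by (intro add_mono tri)
          also have "\<dots> = (\<bar>bn n (X s \<omega>) ?\<mu> - bn n 0 ?\<mu>\<bar> + \<bar>\<sigma>n n (X s \<omega>) ?\<mu> - \<sigma>n n 0 ?\<mu>\<bar>) +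
            (\<bar>bn n 0 ?\<mu> - b 0 ?\<mu>\<bar> + \<bar>\<sigma>n n 0 ?\<mu> - \<sigma> 0 ?\<mu>\<bar>) +
            (\<bar>b (X s \<omega>) ?\<mu> - b 0 ?\<mu>\<bar> + \<bar>\<sigma> (X s \<omega>) ?\<mu> - \<sigma> 0 ?\<mu>\<bar>)"
            by (simp only: add_ac)
          also have "\<dots> \<le> L * \<bar>S \<omega>\<bar> + \<delta> + L * \<bar>S \<omega>\<bar>"
            by (intro add_mono 0 order_trans[OF 1 3] order_trans[OF 2 3])
          also have "\<dots> = D \<omega>" using False by (simp add: D_def tail_def)
          finally show ?thesis .
        qed
      qed (fact sol \<xi> lip L_pos h_mono mN h_bilip T_pos DL)+
      have "(\<integral>\<^sup>+\<omega>. (SUP t\<in>{0..T}. ennreal (\<bar>Xn n t \<omega> - X t \<omega>\<bar>\<^sup>2)) \<partial>M) =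
        (\<integral>\<^sup>+\<omega>. (SUP t\<in>{0..T}. ennreal ((Y t \<omega>)\<^sup>2)) \<partial>M)" by (simp add: Y_def)
      also have "\<dots> \<le> ennreal (C * expectation (\<lambda>\<omega>. (D \<omega>)\<^sup>2))"
        using stability_estimate unfolding C_def k_def \<kappa>_def .
      also have "\<dots> \<le> ennreal \<epsilon>"
      proof (rule ennreal_leI)
        have "expectation (\<lambda>\<omega>. (D \<omega>)\<^sup>2) \<le> expectation (\<lambda>\<omega>. 2 * \<delta>\<^sup>2 + 2 * (tail R \<omega>)\<^sup>2)"
          using L2_square_integrable[OF DL] L2_square_integrable[OF tailL[of R]]
          by (intro integral_mono) (auto simp: D_def square_add_le)
        also have "\<dots> = 2 * \<delta>\<^sup>2 + 2 * expectation (\<lambda>\<omega>. (tail R \<omega>)\<^sup>2)"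
          using L2_square_integrable[OF tailL[of R]] by (simp add: prob_space)
        also have "\<dots> \<le> 4 * (\<epsilon> / (4 * (C + 1)))" using R unfolding \<delta>(2) by linarith
        also have "\<dots> = \<epsilon> / (C + 1)"
          by (simp only: times_divide_eq_right mult_divide_mult_cancel_left_if) simp
        finally have "C * expectation (\<lambda>\<omega>. (D \<omega>)\<^sup>2) \<le> C * (\<epsilon> / (C + 1))" using C0' by (rule mult_left_mono)
        also have "\<dots> \<le> \<epsilon>" using \<epsilon> C0' by (simp add: field_simps)
        finally show "C * expectation (\<lambda>\<omega>. (D \<omega>)\<^sup>2) \<le> \<epsilon>" .
      qed
      finally show ?case using \<epsilon>(2) by (rule le_less_trans)
    qed
  qed simp
qed

end
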